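(* Let $(R,\mathfrak{m},k)$ be a reduced F-finite Gorenstein Noetherian local ring of prime characteristic $p$ with infinite perfect residue field. Let $e$ denote the Hilbert-Samuel multiplicity of $R$ and let $s$ denote the F-signature of $R$. Choose a minimal reduction $\boldsymbol{x}=(x_1,\dots,x_d)$ of $\mathfrak{m}$. For any ideal $I$ of $R$ with $I\supseteq(\boldsymbol{x})$, let $\mu=\mu(I/(\boldsymbol{x}))$ be the minimal number of generators of $I/(\boldsymbol{x})$. Then $$e_{HK}(R)\geq \frac{e-s\mu}{e-\mu}=1+\frac{\mu}{e-\mu}(1-s).$$
   Context: For an $\mathfrak{m}$-primary ideal $I$ of a $d$-dimensional Noetherian local ring $R$ of characteristic $p$, and $q=p^e$, $I^{[q]}$ is the ideal generated by $q$-th powers of elements of $I$; the Hilbert-Kunz multiplicity is $e_{HK}(I)=\lim_{q\to\infty}\ell(R/I^{[q]})/q^d$, and $e_{HK}(R)=e_{HK}(\mathfrak{m})$. $R$ is F-finite if $R$ is a finitely generated module over itself via Frobenius. For $R$ F-finite and reduced, write $R^{1/q}\cong R^{a_q}\oplus M$ with $M$ having no free summands, and let $\alpha(R)=\log_p[k:k^p]$; the F-signature is $s(R)=\lim_{q\to\infty} a_q/q^{d+\alpha(R)}$ (this limit exists in the Gorenstein case). A minimal reduction of $\mathfrak{m}$ is an ideal $(\boldsymbol{x})\subseteq\mathfrak{m}$ generated by $d=\dim R$ elements over which $\mathfrak{m}$ is integral. *)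

theory Defs
  imports Complex_Main "HOL-Computational_Algebra.Primes"
begin

definition ideal :: "'a::comm_ring_1 set \<Rightarrow> bool" where
  "ideal I \<longleftrightarrow> 0 \<in> I \<and> (\<forall>x\<in>I. \<forall>y\<in>I. x + y \<in> I) \<and> (\<forall>r x. x \<in> I \<longrightarrow> r * x \<in> I)"

definition gen_ideal :: "'a::comm_ring_1 set \<Rightarrow> 'a set" where
  "gen_ideal S = \<Inter>{I. ideal I \<and> S \<subseteq> I}"

definition ideal_mult :: "'a::comm_ring_1 set \<Rightarrow> 'a set \<Rightarrow> 'a set" where
  "ideal_mult I J = gen_ideal {a * b | a b. a \<in> I \<and> b \<in> J}"

fun ideal_pow :: "'a::comm_ring_1 set \<Rightarrow> nat \<Rightarrow> 'a set" where
  "ideal_pow I 0 = UNIV"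
| "ideal_pow I (Suc n) = ideal_mult I (ideal_pow I n)"

definition frob_pow :: "'a::comm_ring_1 set \<Rightarrow> nat \<Rightarrow> 'a set" where
  "frob_pow I q = gen_ideal ((\<lambda>x. x ^ q) ` I)"

definition prime_ideal :: "'a::comm_ring_1 set \<Rightarrow> bool" where
  "prime_ideal P \<longleftrightarrow> ideal P \<and> P \<noteq> UNIV \<and> (\<forall>a b. a * b \<in> P \<longrightarrow> a \<in> P \<or> b \<in> P)"

definition maximal_ideal :: "'a::comm_ring_1 set \<Rightarrow> bool" where
  "maximal_ideal M \<longleftrightarrow> ideal M \<and> M \<noteq> UNIV \<and>
     (\<forall>J. ideal J \<and> M \<subseteq> J \<longrightarrow> J = M \<or> J = UNIV)"

definition local_ring :: "'a::comm_ring_1 set \<Rightarrow> bool" where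
  "local_ring m \<longleftrightarrow> maximal_ideal m \<and> (\<forall>M. maximal_ideal M \<longrightarrow> M = m)"

definition noetherian_ring :: "'a::comm_ring_1 itself \<Rightarrow> bool" where
  "noetherian_ring _ \<longleftrightarrow> (\<forall>f :: nat \<Rightarrow> 'a set. (\<forall>n. ideal (f n)) \<and> incseq f \<longrightarrow>
      (\<exists>N. \<forall>n\<ge>N. f n = f N))"

definition reduced_ring :: "'a::comm_ring_1 itself \<Rightarrow> bool" where
  "reduced_ring _ \<longleftrightarrow> (\<forall>(x::'a) n. x ^ n = 0 \<longrightarrow> x = 0)"

definition prime_chain_of_length :: "'a::comm_ring_1 itself \<Rightarrow> nat \<Rightarrow> bool" where
  "prime_chain_of_length _ n \<longleftrightarrow> (\<exists>P :: nat \<Rightarrow> 'a set.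
      (\<forall>i\<le>n. prime_ideal (P i)) \<and> (\<forall>i<n. P i \<subset> P (Suc i)))"

definition krull_dim_eq :: "'a::comm_ring_1 itself \<Rightarrow> nat \<Rightarrow> bool" where
  "krull_dim_eq T d \<longleftrightarrow> prime_chain_of_length T d \<and> \<not> prime_chain_of_length T (Suc d)"

text \<open>Length of the R-module R/J: supremum of lengths of strict chains of
  submodules of R/J, i.e. of ideals between J and R.\<close>
definition len_quot :: "'a::comm_ring_1 set \<Rightarrow> nat" where
  "len_quot J = Sup {n. \<exists>C :: nat \<Rightarrow> 'a set. C 0 = J \<and> C n = UNIV \<and>
      (\<forall>i\<le>n. ideal (C i)) \<and> (\<forall>i<n. C i \<subset> C (Suc i))}"

definition hs_mult :: "'a::comm_ring_1 set \<Rightarrow> nat \<Rightarrow> real" where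
  "hs_mult m d = lim (\<lambda>n. fact d * real (len_quot (ideal_pow m n)) / real n ^ d)"

definition hk_mult :: "nat \<Rightarrow> 'a::comm_ring_1 set \<Rightarrow> nat \<Rightarrow> real" where
  "hk_mult p I d = lim (\<lambda>e. real (len_quot (frob_pow I (p ^ e))) / real (p ^ e) ^ d)"

definition F_finite :: "nat \<Rightarrow> 'a::comm_ring_1 itself \<Rightarrow> bool" where
  "F_finite p _ \<longleftrightarrow> (\<exists>S :: 'a set. finite S \<and> (\<forall>r. \<exists>c. r = (\<Sum>s\<in>S. c s ^ p * s)))"

text \<open>Free rank a_q of R^{1/q}: identifying R^{1/q} with R carrying the action
  r . x = r^q x, a_q is the largest n such that R^n is a direct summand, i.e.
  there are R-linear maps phi_i : R^{1/q} \<rightarrow> R and elements y_j with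
  phi_i(y_j) = delta_ij (i, j < n).\<close>
definition free_rank_frob :: "nat \<Rightarrow> 'a::comm_ring_1 itself \<Rightarrow> nat" where
  "free_rank_frob q _ = Sup {n. \<exists>(\<phi> :: nat \<Rightarrow> 'a \<Rightarrow> 'a) (y :: nat \<Rightarrow> 'a).
      (\<forall>i<n. (\<forall>a b. \<phi> i (a + b) = \<phi> i a + \<phi> i b) \<and> (\<forall>r x. \<phi> i (r ^ q * x) = r * \<phi> i x)) \<and>
      (\<forall>i<n. \<forall>j<n. \<phi> i (y j) = (if i = j then 1 else 0))}"

text \<open>[k : k^p] for the residue field k = R/m: the maximal number of elements of k
  linearly independent over k^p; alpha(R) = log_p of it.\<close>
definition residue_frob_degree :: "nat \<Rightarrow> 'a::comm_ring_1 set \<Rightarrow> nat" where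
  "residue_frob_degree p m = Sup {n. \<exists>y :: nat \<Rightarrow> 'a. \<forall>c :: nat \<Rightarrow> 'a.
      (\<Sum>i<n. c i ^ p * y i) \<in> m \<longrightarrow> (\<forall>i<n. c i \<in> m)}"

definition alpha_F :: "nat \<Rightarrow> 'a::comm_ring_1 set \<Rightarrow> real" where
  "alpha_F p m = log (real p) (real (residue_frob_degree p m))"

definition F_signature :: "nat \<Rightarrow> 'a::comm_ring_1 set \<Rightarrow> nat \<Rightarrow> real" where
  "F_signature p m d = lim (\<lambda>e. real (free_rank_frob (p ^ e) TYPE('a)) /
      real (p ^ e) powr (real d + alpha_F p m))"

definition sop :: "'a::comm_ring_1 set \<Rightarrow> nat \<Rightarrow> (nat \<Rightarrow> 'a) \<Rightarrow> bool" where
  "sop m d x \<longleftrightarrow> (\<forall>i<d. x i \<in> m) \<and> (\<exists>n. ideal_pow m n \<subseteq> gen_ideal (x ` {..<d}))"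

definition regular_sequence :: "nat \<Rightarrow> (nat \<Rightarrow> 'a::comm_ring_1) \<Rightarrow> bool" where
  "regular_sequence d x \<longleftrightarrow> (\<forall>i<d. \<forall>r. x i * r \<in> gen_ideal (x ` {..<i}) \<longrightarrow>
      r \<in> gen_ideal (x ` {..<i})) \<and> gen_ideal (x ` {..<d}) \<noteq> UNIV"

definition irreducible_ideal :: "'a::comm_ring_1 set \<Rightarrow> bool" where
  "irreducible_ideal Q \<longleftrightarrow> (\<forall>J K. ideal J \<and> ideal K \<and> Q = J \<inter> K \<longrightarrow> J = Q \<or> K = Q)"

text \<open>Gorenstein local ring (of dimension d): Cohen-Macaulay (some system of parameters is a
  regular sequence) with an irreducible parameter ideal; this is the standard
  characterization (R/(x) Artinian Gorenstein, i.e. 1-dimensional socle).\<close>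
definition gorenstein_local :: "'a::comm_ring_1 set \<Rightarrow> nat \<Rightarrow> bool" where
  "gorenstein_local m d \<longleftrightarrow> (\<exists>x. sop m d x \<and> regular_sequence d x \<and>
      irreducible_ideal (gen_ideal (x ` {..<d})))"

definition integral_over_ideal :: "'a::comm_ring_1 set \<Rightarrow> 'a \<Rightarrow> bool" where
  "integral_over_ideal J a \<longleftrightarrow> (\<exists>n\<ge>1. \<exists>c :: nat \<Rightarrow> 'a. (\<forall>i\<in>{1..n}. c i \<in> ideal_pow J i) \<and>
      a ^ n + (\<Sum>i=1..n. c i * a ^ (n - i)) = 0)"

definition minimal_reduction :: "'a::comm_ring_1 set \<Rightarrow> nat \<Rightarrow> (nat \<Rightarrow> 'a) \<Rightarrow> bool" where
  "minimal_reduction m d x \<longleftrightarrow> (\<forall>i<d. x i \<in> m) \<and>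
      (\<forall>a\<in>m. integral_over_ideal (gen_ideal (x ` {..<d})) a)"

definition mu_quot :: "'a::comm_ring_1 set \<Rightarrow> 'a set \<Rightarrow> nat" where
  "mu_quot I J = (LEAST n. \<exists>y :: nat \<Rightarrow> 'a. I = gen_ideal (J \<union> y ` {..<n}))"

definition residue_field_infinite :: "'a::comm_ring_1 set \<Rightarrow> bool" where
  "residue_field_infinite m \<longleftrightarrow> infinite ((\<lambda>r. {s. r - s \<in> m}) ` (UNIV :: 'a set))"

definition residue_field_perfect :: "nat \<Rightarrow> 'a::comm_ring_1 set \<Rightarrow> bool" where
  "residue_field_perfect p m \<longleftrightarrow> (\<forall>a :: 'a. \<exists>b. a - b ^ p \<in> m)"

end

theory Submission
  imports Defs "HOL-Library.Set_Algebras" "HOL-Library.Extended_Nat" "HOL-Library.Function_Algebras"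
begin

text \<open>
  Write \<open>J = (x)\<close>, \<open>e = \<ell>(R/J)\<close>, and let \<open>u\<close> generate the socle of \<open>R/J\<close>. Put \<open>I\<^sub>q = (J\<^bsup>[q]\<^esup> : u\<^sup>q)\<close>,
  \<open>h = \<ell>(R/m\<^bsup>[q]\<^esup>)\<close> and \<open>a = \<ell>(R/I\<^sub>q)\<close>. As \<open>k\<close> is perfect, \<open>F\<^sub>*R\<close> is generated by \<open>h\<close> elements,
  of which all but \<open>a\<close> can be chosen in \<open>I\<^sub>q\<close>. Modulo \<open>J\<^bsup>[q]\<^esup> : I\<^bsup>[q]\<^esup>\<close> every generator is
  killed by \<open>J : I\<close>, and those in \<open>I\<^sub>q\<close> even by \<open>J : mI\<close>. Since \<open>R/J\<close> and \<open>R/J\<^bsup>[q]\<^esup>\<close> are Gorenstein, duality turns this into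
  \<open>\<ell>(I\<^bsup>[q]\<^esup>/J\<^bsup>[q]\<^esup>) \<le> a \<ell>(I/J) + (h - a) \<ell>((J + mI)/J)\<close>; together with \<open>\<ell>(R/I\<^bsup>[q]\<^esup>) \<le> h \<ell>(R/I)\<close>
  and \<open>\<ell>(R/J\<^bsup>[q]\<^esup>) = e q\<^sup>d\<close> this gives \<open>e q\<^sup>d \<le> (e - \<mu>) h + \<mu> a\<close>. Now divide by \<open>q\<^sup>d\<close> and let \<open>q\<close> tend to infinity.

  That \<open>a\<close> is the free rank of \<open>F\<^sub>*R\<close> follows by lifting homomorphisms \<open>F\<^sub>*R \<rightarrow> R/J\<close> along a regular
  sequence generating \<open>J\<close>. The limits exist because \<open>F\<^sub>*R\<close> has rank at most \<open>p\<^sup>d\<close> at every minimal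
  prime, whence \<open>\<ell>(R/K\<^bsup>[pq]\<^esup>) \<le> p\<^sup>d \<ell>(R/K\<^bsup>[q]\<^esup>) + O(q\<^bsup>d-1\<^esup>)\<close> for every \<open>m\<close>-primary ideal \<open>K\<close>.
\<close>

section \<open>Ideals\<close>

text \<open>The bound for generators in I_q rests on this: if \<open>w\<close> carries mI into
  \<open>J\<close>, then wI lies in the socle modulo \<open>J\<close>, so (wi)^q is a multiple of
  u^q modulo J^[q], and I_q kills u^q there. As \<mu> = l(I/J) - l((J + mI)/J), the smaller
  annihilator length saves \<mu> for each of the h - a generators in I_q. Two obstacles shape the
  rest. The Gorenstein hypothesis speaks of some irreducible parameter ideal, not of the given one,
  so regularity and the one-dimensional socle have to be carried over by exchanging parameters one
  at a time; the infinite residue field supplies elements in general position. And no quotient is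
  ever formed: statements modulo an ideal \<open>Y\<close> are congruences in \<open>R\<close> with
  \<open>Y\<close> as a parameter, and F_*R is \<open>R\<close> with twisted scalars. Lengths live
  in the lattices of ideals and of twisted submodules; perfectness of \<open>k\<close> makes them
  agree on ideals. The rank bound p^d comes from growth: independent elements multiply along
  iterated Frobenius, while q^d l(R/J) bounds the number of generators.\<close>

lemma ideal_0: "ideal I \<Longrightarrow> 0 \<in> I"
  and ideal_add: "ideal I \<Longrightarrow> a \<in> I \<Longrightarrow> b \<in> I \<Longrightarrow> a + b \<in> I"
  and ideal_mult_left: "ideal I \<Longrightarrow> a \<in> I \<Longrightarrow> r * a \<in> I"
  by (auto simp: ideal_def)

lemma ideal_mult_right: "ideal I \<Longrightarrow> a \<in> I \<Longrightarrow> a * r \<in> I"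
  by (metis ideal_mult_left mult.commute)

lemma ideal_uminus: "ideal I \<Longrightarrow> a \<in> I \<Longrightarrow> - a \<in> I"
  using ideal_mult_left[of I a "-1"] by simp

lemma ideal_diff: "ideal I \<Longrightarrow> a \<in> I \<Longrightarrow> b \<in> I \<Longrightarrow> a - b \<in> I"
  by (metis ideal_add ideal_uminus uminus_add_conv_diff add.commute)

lemmas ideal_rules = ideal_0 ideal_add ideal_mult_left ideal_mult_right ideal_uminus ideal_diff

lemma ideal_sum: "ideal I \<Longrightarrow> (\<And>i. i \<in> A \<Longrightarrow> f i \<in> I) \<Longrightarrow> sum f A \<in> I"
  by (induction A rule: infinite_finite_induct) (auto intro: ideal_rules)

lemma ideal_lin_mem: "ideal I \<Longrightarrow> a \<in> I \<Longrightarrow> b \<in> I \<Longrightarrow> c = r * a + s * b \<Longrightarrow> c \<in> I"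
  by (auto intro: ideal_rules)

lemma ideal_lin3_mem:
  "ideal I \<Longrightarrow> a \<in> I \<Longrightarrow> b \<in> I \<Longrightarrow> c \<in> I \<Longrightarrow> x = r * a + s * b + t * c \<Longrightarrow> x \<in> I"
  by (auto intro: ideal_rules)

lemma ideal_cong_mem: "ideal I \<Longrightarrow> a - b \<in> I \<Longrightarrow> a \<in> I \<longleftrightarrow> b \<in> I"
  by (metis add_diff_cancel_left' diff_add_cancel ideal_add ideal_diff)

lemma ideal_pow_mem: "ideal I \<Longrightarrow> a ^ n \<in> I \<Longrightarrow> n \<le> k \<Longrightarrow> a ^ k \<in> I"
  by (metis ideal_mult_left le_iff_add mult.commute power_add)

lemma ideal_UNIV [simp]: "ideal UNIV"
  by (simp add: ideal_def)

lemma ideal_zero [simp]: "ideal {0}"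
  by (simp add: ideal_def)

lemma ideal_Int: "ideal I \<Longrightarrow> ideal J \<Longrightarrow> ideal (I \<inter> J)"
  by (auto simp: ideal_def)

lemma ideal_eq_UNIV: "ideal I \<Longrightarrow> 1 \<in> I \<Longrightarrow> I = UNIV"
  using ideal_mult_left[of I 1] by auto

lemma ideal_plus:
  assumes "ideal I" "ideal J"
  shows "ideal (I + J)"
  unfolding ideal_def
proof (intro conjI ballI allI impI)
  show "0 \<in> I + J" using set_plus_intro[of 0 I 0 J] assms by (simp add: ideal_0)
next
  fix x y assume "x \<in> I + J" "y \<in> I + J"
  then obtain a b c d where "x = a + b" "y = c + d" "a \<in> I" "b \<in> J" "c \<in> I" "d \<in> J"
    by (metis set_plus_elim)
  then have "x + y = (a + c) + (b + d)" "a + c \<in> I" "b + d \<in> J"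
    using assms by (auto intro: ideal_rules)
  then show "x + y \<in> I + J" by (metis set_plus_intro)
next
  fix r x assume "x \<in> I + J"
  then show "r * x \<in> I + J"
  proof (elim set_plus_elim)
    fix a b assume "x = a + b" "a \<in> I" "b \<in> J"
    then show ?thesis using assms set_plus_intro[of "r * a" I "r * b" J]
      by (simp add: distrib_left ideal_mult_left)
  qed
qed

lemma ideal_colon: "ideal B \<Longrightarrow> ideal {r. r * a \<in> B}"
  by (auto simp: ideal_def distrib_right mult.assoc)

definition colon :: "'a::comm_ring_1 set \<Rightarrow> 'a set \<Rightarrow> 'a set" where
  "colon Q K = {r. \<forall>k\<in>K. r * k \<in> Q}"

lemma ideal_colon_set: "ideal Q \<Longrightarrow> ideal (colon Q K)"
  by (auto simp: ideal_def colon_def distrib_right mult.assoc)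

lemma gen_ideal_ideal: "ideal (gen_ideal S)"
  unfolding gen_ideal_def ideal_def by auto

lemma gen_ideal_incl: "S \<subseteq> gen_ideal S"
  unfolding gen_ideal_def by auto

lemma gen_ideal_least: "ideal I \<Longrightarrow> S \<subseteq> I \<Longrightarrow> gen_ideal S \<subseteq> I"
  unfolding gen_ideal_def by auto

lemma gen_ideal_eqI:
  "ideal I \<Longrightarrow> S \<subseteq> I \<Longrightarrow> (\<And>K. ideal K \<Longrightarrow> S \<subseteq> K \<Longrightarrow> I \<subseteq> K) \<Longrightarrow> gen_ideal S = I"
  by (simp add: gen_ideal_ideal gen_ideal_incl gen_ideal_least subset_antisym)

section \<open>Sums of ideals, principal ideals and lists of generators\<close>

definition prin :: "'a::comm_ring_1 \<Rightarrow> 'a set" where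
  "prin a = range (\<lambda>r. r * a)"

lemma ideal_prin [simp]: "ideal (prin a)"
  unfolding prin_def ideal_def
  by (auto simp: image_iff) (metis mult_zero_left, metis distrib_right, metis mult.assoc)

lemma prin_mem [simp]: "r * a \<in> prin a" "a * r \<in> prin a" "a \<in> prin a"
  unfolding prin_def by (auto simp: image_iff mult.commute) (metis mult_1)

lemma prin_subset: "ideal I \<Longrightarrow> prin a \<subseteq> I \<longleftrightarrow> a \<in> I"
  by (auto simp: prin_def intro: ideal_rules) (metis mult_1 rangeI subsetD)

lemma prin_0 [simp]: "prin 0 = {0}"
  by (auto simp: prin_def)

lemma prin_1 [simp]: "prin 1 = UNIV"
  by (auto simp: prin_def)

lemma mem_plus_prin: "ideal Y \<Longrightarrow> x \<in> Y + prin a \<longleftrightarrow> (\<exists>r. x - r * a \<in> Y)"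
  unfolding set_plus_def prin_def
  by (auto simp: image_iff) (metis add_diff_cancel_right', metis diff_add_cancel)

lemma plus_left_incl: "ideal J \<Longrightarrow> I \<subseteq> I + J"
  by (metis add.commute ideal_0 set_zero_plus2)

lemma plus_right_incl: "ideal I \<Longrightarrow> J \<subseteq> I + J"
  by (metis ideal_0 set_zero_plus2)

lemma plus_least: "ideal K \<Longrightarrow> I \<subseteq> K \<Longrightarrow> J \<subseteq> K \<Longrightarrow> I + J \<subseteq> K"
  by (auto elim!: set_plus_elim intro: ideal_rules)

lemma plus_absorb: "ideal I \<Longrightarrow> ideal J \<Longrightarrow> J \<subseteq> I \<Longrightarrow> I + J = I"
  by (simp add: plus_least plus_left_incl subset_antisym)

text \<open>Generators are kept in a list because their number and their order matter: regular
  sequences and inductions consume the list from the front.\<close>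

fun ig :: "'a::comm_ring_1 list \<Rightarrow> 'a set" where
  "ig [] = {0}"
| "ig (a # as) = prin a + ig as"

lemma ideal_ig [simp]: "ideal (ig as)"
  by (induction as) (auto intro: ideal_plus)

lemma ig_incl: "set as \<subseteq> ig as"
  by (induction as)
    (auto intro: subsetD[OF plus_left_incl] subsetD[OF plus_right_incl[OF ideal_prin]])

lemma ig_least: "ideal I \<Longrightarrow> set as \<subseteq> I \<Longrightarrow> ig as \<subseteq> I"
proof (induction as)
  case (Cons a as)
  then show ?case using plus_least[of I "prin a" "ig as"] by (simp add: prin_subset)
qed (auto simp: ideal_0)

lemma ig_eq_gen_ideal: "ig as = gen_ideal (set as)"
  by (metis gen_ideal_eqI ideal_ig ig_incl ig_least)

text \<open>A generator may be changed by a combination of the others, modulo \<open>Y\<close>. This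
  is the move by which a given generator is replaced by one in general position.\<close>

lemma ig_replace:
  assumes "z - y \<in> Y + ig xs" "ideal Y"
  shows "Y + (prin z + ig xs) = Y + (prin y + ig xs)"
proof -
  have *: "Y + (prin a + ig xs) \<subseteq> Y + (prin b + ig xs)" if h: "a - b \<in> Y + ig xs" for a b
  proof (intro plus_least ideal_plus assms ideal_prin ideal_ig)
    show "Y \<subseteq> Y + (prin b + ig xs)" by (intro plus_left_incl ideal_plus) auto
    show "ig xs \<subseteq> Y + (prin b + ig xs)"
      using plus_right_incl[OF ideal_plus[OF assms(2) ideal_prin[of b]], of "ig xs"]
      by (simp add: add.assoc)
    have "a = (a - b) + b" by simp
    also have "\<dots> \<in> (Y + ig xs) + prin b" using h by (intro set_plus_intro) auto
    finally have "a \<in> Y + (prin b + ig xs)" by (simp add: ac_simps)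
    then show "prin a \<subseteq> Y + (prin b + ig xs)"
      by (simp add: prin_subset assms ideal_plus)
  qed
  have "- (z - y) \<in> Y + ig xs" by (intro ideal_uminus ideal_plus assms ideal_ig)
  then have "y - z \<in> Y + ig xs" by simp
  then show ?thesis using *[OF assms(1)] *[of y z] by blast
qed

section \<open>Products, powers and Frobenius powers\<close>

lemma ideal_mult_ideal: "ideal (ideal_mult I J)"
  by (simp add: ideal_mult_def gen_ideal_ideal)

lemma ideal_mult_mem: "a \<in> I \<Longrightarrow> b \<in> J \<Longrightarrow> a * b \<in> ideal_mult I J"
  unfolding ideal_mult_def by (rule subsetD[OF gen_ideal_incl]) blast

lemma ideal_mult_least:
  "ideal K \<Longrightarrow> (\<And>a b. a \<in> I \<Longrightarrow> b \<in> J \<Longrightarrow> a * b \<in> K) \<Longrightarrow> ideal_mult I J \<subseteq> K"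
  unfolding ideal_mult_def by (intro gen_ideal_least) auto

lemma ideal_pow_ideal: "ideal (ideal_pow I n)"
  by (cases n) (auto simp: ideal_mult_ideal)

lemma ideal_mult_mono: "I \<subseteq> I' \<Longrightarrow> J \<subseteq> J' \<Longrightarrow> ideal_mult I J \<subseteq> ideal_mult I' J'"
  by (rule ideal_mult_least) (auto simp: ideal_mult_ideal intro: ideal_mult_mem)

lemma ideal_pow_mono: "I \<subseteq> J \<Longrightarrow> ideal_pow I n \<subseteq> ideal_pow J n"
  by (induction n) (auto simp: ideal_mult_mono)

lemma power_mem_ideal_pow: "a \<in> I \<Longrightarrow> a ^ n \<in> ideal_pow I n"
  by (induction n) (auto intro: ideal_mult_mem)

lemma ideal_pow_Suc_subset: "ideal_pow I (Suc n) \<subseteq> ideal_pow I n"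
  unfolding ideal_pow.simps by (rule ideal_mult_least) (auto simp: ideal_pow_ideal ideal_mult_left)

lemma ideal_pow_antimono: "k \<le> n \<Longrightarrow> ideal_pow I n \<subseteq> ideal_pow I k"
  by (rule lift_Suc_antimono_le[of "ideal_pow I"]) (use ideal_pow_Suc_subset in auto)

lemma ideal_pow_mult_mem:
  "a \<in> ideal_pow I i \<Longrightarrow> b \<in> ideal_pow I j \<Longrightarrow> a * b \<in> ideal_pow I (i + j)"
proof (induction i arbitrary: a)
  case 0
  then show ?case by (simp add: ideal_pow_ideal ideal_mult_left)
next
  case (Suc i)
  have "ideal_mult I (ideal_pow I i) \<subseteq> {r. r * b \<in> ideal_pow I (Suc i + j)}"
    using Suc.IH Suc.prems(2)
    by (intro ideal_mult_least ideal_colon ideal_pow_ideal)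
      (auto simp: mult.assoc intro!: ideal_mult_mem)
  then show ?case using Suc.prems(1) by auto
qed

lemma frob_pow_ideal: "ideal (frob_pow I q)"
  by (simp add: frob_pow_def gen_ideal_ideal)

lemma frob_pow_mem: "a \<in> I \<Longrightarrow> a ^ q \<in> frob_pow I q"
  unfolding frob_pow_def by (rule subsetD[OF gen_ideal_incl]) blast

lemma frob_pow_least: "ideal K \<Longrightarrow> (\<And>a. a \<in> I \<Longrightarrow> a ^ q \<in> K) \<Longrightarrow> frob_pow I q \<subseteq> K"
  unfolding frob_pow_def by (intro gen_ideal_least) auto

lemma frob_pow_mono: "I \<subseteq> J \<Longrightarrow> frob_pow I q \<subseteq> frob_pow J q"
  by (intro frob_pow_least frob_pow_ideal) (auto intro: frob_pow_mem)

section \<open>Noetherian local rings\<close>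

locale noeth_local =
  fixes m :: "'a::comm_ring_1 set"
  assumes loc: "local_ring m" and noeth: "noetherian_ring TYPE('a)"
begin

lemma noeth_wf: "wf {(B :: 'a set, A). ideal A \<and> ideal B \<and> A \<subset> B}"
  unfolding wf_iff_no_infinite_down_chain
proof
  assume "\<exists>f. \<forall>i. (f (Suc i), f i) \<in> {(B :: 'a set, A). ideal A \<and> ideal B \<and> A \<subset> B}"
  then obtain f :: "nat \<Rightarrow> 'a set" where f: "\<And>i. ideal (f i) \<and> f i \<subset> f (Suc i)" by blast
  then have "incseq f" by (intro incseq_SucI) auto
  then have "\<exists>N. \<forall>n\<ge>N. f n = f N" using f by (intro noeth[unfolded noetherian_ring_def, rule_format]) simp
  then obtain N where "f (Suc N) = f N" by (metis le_SucI order_refl)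
  then show False using f[of N] by simp
qed

lemma noeth_induct:
  fixes Y :: "'a set"
  assumes "ideal Y" and "\<And>Y. ideal Y \<Longrightarrow> (\<And>Z. ideal Z \<Longrightarrow> Y \<subset> Z \<Longrightarrow> Q Z) \<Longrightarrow> Q Y"
  shows "Q Y"
  using assms(1)
  by (induction Y rule: wf_induct_rule[OF noeth_wf]) (use assms(2) in auto)

lemma noeth_maximal:
  fixes F :: "'a set set"
  assumes "A \<in> F" "\<And>A. A \<in> F \<Longrightarrow> ideal A"
  obtains M where "M \<in> F" "\<And>B. B \<in> F \<Longrightarrow> \<not> M \<subset> B"
proof (rule wfE_min[OF noeth_wf assms(1)])
  fix M assume M: "M \<in> F" "\<And>y. (y, M) \<in> {(B :: 'a set, A). ideal A \<and> ideal B \<and> A \<subset> B} \<Longrightarrow> y \<notin> F"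
  show thesis
  proof (rule that[OF M(1)])
    fix B assume "B \<in> F"
    show "\<not> M \<subset> B"
    proof
      assume "M \<subset> B"
      then have "(B, M) \<in> {(B :: 'a set, A). ideal A \<and> ideal B \<and> A \<subset> B}"
        using assms(2)[OF M(1)] assms(2)[OF \<open>B \<in> F\<close>] by simp
      then show False using M(2) \<open>B \<in> F\<close> by blast
    qed
  qed
qed

text \<open>Among the ideals generated by lists inside \<open>I\<close>, a maximal one must be all
  of \<open>I\<close>, since any further element could be put into the list.\<close>

lemma ideal_fg:
  fixes I :: "'a set"
  assumes "ideal I"
  obtains as where "I = ig as"
proof -
  define F where "F = {ig as | as. set as \<subseteq> I}"
  have F: "ig as \<in> F" if "set as \<subseteq> I" for as using that by (auto simp: F_def)
  have "ig [] \<in> F" by (rule F) simp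
  then show thesis
  proof (rule noeth_maximal)
    show "ideal A" if "A \<in> F" for A using that by (auto simp: F_def)
    fix M assume M: "M \<in> F" "\<And>B. B \<in> F \<Longrightarrow> \<not> M \<subset> B"
    then obtain as where as: "M = ig as" "set as \<subseteq> I" by (auto simp: F_def)
    have "I \<subseteq> ig as"
    proof
      fix a assume a: "a \<in> I"
      have "ig (a # as) \<in> F" using a as by (intro F) simp
      moreover have "ig as \<subseteq> ig (a # as)" by (simp add: plus_right_incl)
      ultimately have "ig as = ig (a # as)" using M(2)[of "ig (a # as)"] as(1) by (simp add: psubset_eq)
      then show "a \<in> ig as" using ig_incl[of "a # as"] by simp
    qed
    then show thesis using that[of as] ig_least[OF assms as(2)] by simp
  qed
qed

lemma m_max: "maximal_ideal m" using loc by (simp add: local_ring_def)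

lemma m_ideal [simp]: "ideal m" using m_max by (simp add: maximal_ideal_def)

lemma one_notin_m [simp]: "1 \<notin> m"
  using m_max ideal_eq_UNIV[of m] unfolding maximal_ideal_def by auto

text \<open>A maximal element among the proper ideals above \<open>I\<close> is a maximal ideal,
  hence \<open>m\<close> by locality; it exists by the ascending chain condition.\<close>

lemma proper_sub_m:
  assumes "ideal I" "I \<noteq> UNIV"
  shows "I \<subseteq> m"
proof -
  have "I \<in> {A. ideal A \<and> A \<noteq> UNIV \<and> I \<subseteq> A}" using assms by simp
  then show ?thesis
  proof (rule noeth_maximal)
    fix M assume M: "M \<in> {A. ideal A \<and> A \<noteq> UNIV \<and> I \<subseteq> A}"
     "\<And>B. B \<in> {A. ideal A \<and> A \<noteq> UNIV \<and> I \<subseteq> A} \<Longrightarrow> \<not> M \<subset> B"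
    have "J = M \<or> J = UNIV" if "ideal J" "M \<subseteq> J" for J
      using M(1) M(2)[of J] that by auto
    then have "maximal_ideal M" using M(1) unfolding maximal_ideal_def by simp
    then show ?thesis using loc M(1) unfolding local_ring_def by simp
  qed simp
qed

lemma m_proper: "m \<noteq> UNIV" using one_notin_m by blast

lemma unit_ex: "r \<notin> m \<Longrightarrow> \<exists>s. s * r = 1"
proof -
  assume "r \<notin> m"
  then have "prin r = UNIV" using proper_sub_m[of "prin r"] by (auto simp: prin_subset)
  then have "1 \<in> prin r" by simp
  then show ?thesis unfolding prin_def by auto
qed

lemma unit_mult_mem: "ideal I \<Longrightarrow> r \<notin> m \<Longrightarrow> r * a \<in> I \<Longrightarrow> a \<in> I"
  by (metis ideal_mult_left mult.assoc mult_1 unit_ex)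

lemma one_minus_notin_m: "r \<in> m \<Longrightarrow> 1 - r \<notin> m"
  using ideal_add[OF m_ideal, of "1 - r" r] by auto

lemma m_prime: "a * b \<in> m \<Longrightarrow> a \<in> m \<or> b \<in> m"
  using unit_mult_mem[OF m_ideal] by blast

lemma m_power: "a ^ n \<in> m \<Longrightarrow> a \<in> m"
  by (induction n) (use m_prime in auto)

text \<open>The elements are eliminated one at a time: in the relation for \<open>z\<close> the term
  in \<open>z\<close> moves to the left, where \<open>1 - c z\<close> is a unit. The module is
  abstract because the lemma is applied to ideals, to F_*R with twisted scalars, and to vectors of
  values of homomorphisms.\<close>

lemma nakayama:
  fixes s :: "'a \<Rightarrow> 'b::ab_group_add \<Rightarrow> 'b"
  assumes "module s" "module.subspace s N" "finite S"
    and "\<forall>x\<in>S. \<exists>c. (\<forall>y\<in>S. c y \<in> m) \<and> x - (\<Sum>y\<in>S. s (c y) y) \<in> N"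
  shows "S \<subseteq> N"
  using assms(3,4)
proof (induction S rule: finite_induct)
  case (insert z S)
  interpret M: module s by fact
  note sub = assms(2)
  obtain c where c: "\<forall>y\<in>insert z S. c y \<in> m" "z - (\<Sum>y\<in>insert z S. s (c y) y) \<in> N"
    using insert.prems by blast
  obtain w where w: "w * (1 - c z) = 1" using c unit_ex one_minus_notin_m by blast
  have "s w (z - (\<Sum>y\<in>insert z S. s (c y) y)) = s (w * (1 - c z)) z - (\<Sum>y\<in>S. s (w * c y) y)"
    using insert.hyps
    by (simp add: M.scale_right_diff_distrib M.scale_right_distrib M.scale_sum_right
        M.scale_left_diff_distrib right_diff_distrib)
  then have z: "z - (\<Sum>y\<in>S. s (w * c y) y) \<in> N"
    using M.subspace_scale[OF sub c(2), of w] w by simp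
  have "S \<subseteq> N"
  proof (rule insert.IH, intro ballI)
    fix x assume "x \<in> S"
    then obtain e where e: "\<forall>y\<in>insert z S. e y \<in> m" "x - (\<Sum>y\<in>insert z S. s (e y) y) \<in> N"
      using insert.prems by blast
    \<comment> \<open>Substituting the solved relation for \<open>z\<close> gives relations among
      the elements of \<open>S\<close> alone; the coefficients stay in \<open>m\<close>.\<close>
    let ?f = "\<lambda>y. e y + e z * (w * c y)"
    have "\<forall>y\<in>S. ?f y \<in> m" using e c by (auto intro!: ideal_rules)
    moreover have eq: "x - (\<Sum>y\<in>S. s (?f y) y)
       = (x - (\<Sum>y\<in>insert z S. s (e y) y)) + s (e z) (z - (\<Sum>y\<in>S. s (w * c y) y))"
    proof -
      have "(\<Sum>y\<in>S. s (?f y) y) = (\<Sum>y\<in>S. s (e y) y) + s (e z) (\<Sum>y\<in>S. s (w * c y) y)"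
        by (simp add: M.scale_sum_right M.scale_left_distrib sum.distrib)
      then show ?thesis using insert.hyps by (simp add: M.scale_right_diff_distrib)
    qed
    ultimately have "(\<forall>y\<in>S. ?f y \<in> m) \<and> x - (\<Sum>y\<in>S. s (?f y) y) \<in> N"
      unfolding eq using M.subspace_add[OF sub e(2) M.subspace_scale[OF sub z, of "e z"]] by blast
    then show "\<exists>c. (\<forall>y\<in>S. c y \<in> m) \<and> x - (\<Sum>y\<in>S. s (c y) y) \<in> N" by (rule exI[of _ ?f])
  qed
  moreover have "(\<Sum>y\<in>S. s (w * c y) y) \<in> N"
    using calculation by (intro M.subspace_sum[OF sub] M.subspace_scale[OF sub]) auto
  ultimately show ?case using M.subspace_add[OF sub z, of "\<Sum>y\<in>S. s (w * c y) y"] by simp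
qed auto

lemma nakayama_ideal:
  assumes "ideal N" "ideal A" "A \<subseteq> N + ideal_mult m A"
  shows "A \<subseteq> N"
proof -
  obtain as where as: "A = ig as" using ideal_fg[OF assms(2)] .

  \<comment> \<open>Elements of mA are combinations of the fixed generators with coefficients in
    \<open>m\<close>: such combinations form an ideal that contains all products.\<close>
  have comb: "\<exists>c. (\<forall>y\<in>set as. c y \<in> m) \<and> v = (\<Sum>y\<in>set as. c y * y)" if "v \<in> ideal_mult m A" for v
  proof -
    let ?K = "{v. \<exists>c. (\<forall>y\<in>set as. c y \<in> m) \<and> v = (\<Sum>y\<in>set as. c y * y)}"
    have K: "ideal ?K"
      unfolding ideal_def
    proof (safe, goal_cases)
      case 1 show ?case by (intro exI[of _ "\<lambda>_. 0"]) (auto simp: ideal_0)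
    next
      case (2 x y c c') then show ?case
        by (intro exI[of _ "\<lambda>i. c i + c' i"]) (simp add: distrib_right sum.distrib ideal_add[OF m_ideal])
    next
      case (3 r x c) then show ?case
        by (intro exI[of _ "\<lambda>i. r * c i"]) (simp add: mult.assoc sum_distrib_left ideal_mult_left[OF m_ideal])
    qed
    have "ideal_mult m A \<subseteq> ?K"
    proof (rule ideal_mult_least[OF K])
      fix a b assume a: "a \<in> m" and "b \<in> A"
      moreover have "A \<subseteq> {b. a * b \<in> ?K}"
      proof -
        have "a * y \<in> ?K" if "y \<in> set as" for y
          using that a
          by (intro CollectI exI[of _ "\<lambda>i. if i = y then a else 0"])
            (auto simp: ideal_0 if_distrib[of "\<lambda>c. c * _"] cong: if_cong)
        then have "set as \<subseteq> {b. a * b \<in> ?K}" by blast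
        moreover have "ideal {b. a * b \<in> ?K}"
          using ideal_colon[OF K, of a] by (simp only: mult.commute[of a])
        ultimately show ?thesis unfolding as by (intro ig_least)
      qed
      ultimately show "a * b \<in> ?K" by blast
    qed
    then show ?thesis using that by blast
  qed
  interpret M: module "(*) :: 'a \<Rightarrow> 'a \<Rightarrow> 'a" by standard (auto simp: algebra_simps)
  have sub: "M.subspace N" using assms(1) by (auto simp: M.subspace_def ideal_def)
  have "set as \<subseteq> N"
  proof (rule nakayama[OF M.module_axioms sub], simp, intro ballI)
    fix x assume "x \<in> set as"
    then have "x \<in> N + ideal_mult m A" using as assms(3) ig_incl[of as] by auto
    then obtain n v where nv: "x = n + v" "n \<in> N" "v \<in> ideal_mult m A" by (rule set_plus_elim)
    show "\<exists>c. (\<forall>y\<in>set as. c y \<in> m) \<and> x - (\<Sum>y\<in>set as. c y * y) \<in> N"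
      using comb[OF nv(3)] nv(1,2) by auto
  qed
  then show ?thesis unfolding as by (rule ig_least[OF assms(1)])
qed

text \<open>Captures arguments in which an element of \<open>A\<close> can be divided by
  \<open>x\<close>, modulo \<open>N\<close>, again and again.\<close>

lemma nakayama_elem:
  assumes "ideal N" "ideal A" "x \<in> m" "\<And>a. a \<in> A \<Longrightarrow> \<exists>b\<in>A. a - x * b \<in> N"
  shows "A \<subseteq> N"
proof (rule nakayama_ideal[OF assms(1,2)])
  show "A \<subseteq> N + ideal_mult m A"
  proof
    fix a assume "a \<in> A"
    then obtain b where b: "b \<in> A" "a - x * b \<in> N" using assms(4) by blast
    have "(a - x * b) + x * b \<in> N + ideal_mult m A"
      using b assms(3) by (intro set_plus_intro ideal_mult_mem)
    then show "a \<in> N + ideal_mult m A" by simp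
  qed
qed

end

section \<open>Length\<close>

definition is_chain :: "('b set \<Rightarrow> bool) \<Rightarrow> (nat \<Rightarrow> 'b set) \<Rightarrow> nat \<Rightarrow> 'b set \<Rightarrow> 'b set \<Rightarrow> bool" where
  "is_chain P C n B A \<longleftrightarrow> C 0 = B \<and> C n = A \<and> (\<forall>i\<le>n. P (C i)) \<and> (\<forall>i<n. C i \<subset> C (Suc i))"

text \<open>Values are extended naturals, so additivity needs no finiteness proof. The predicate
  \<open>P\<close> is a parameter because the same theory serves ideals and twisted
  submodules.\<close>

definition elen :: "('b set \<Rightarrow> bool) \<Rightarrow> 'b set \<Rightarrow> 'b set \<Rightarrow> enat" where
  "elen P B A = Sup (enat ` {n. \<exists>C. is_chain P C n B A})"

lemma elen_ge: "is_chain P C n B A \<Longrightarrow> enat n \<le> elen P B A"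
  unfolding elen_def by (rule Sup_upper) auto

lemma elen_leI: "(\<And>n C. is_chain P C n B A \<Longrightarrow> enat n \<le> X) \<Longrightarrow> elen P B A \<le> X"
  unfolding elen_def by (rule Sup_least) auto

lemma is_chain_le:
  assumes "is_chain P C n B A" "j \<le> n" "i \<le> j"
  shows "C i \<subseteq> C j"
  using assms(3,2)
proof (induction j rule: dec_induct)
  case (step j)
  have "C j \<subset> C (Suc j)" using assms(1) step by (auto simp: is_chain_def)
  then show ?case using step by auto
qed auto

lemma is_chain_subset: "is_chain P C n B A \<Longrightarrow> i \<le> n \<Longrightarrow> B \<subseteq> C i \<and> C i \<subseteq> A"
  using is_chain_le[of P C n B A i 0] is_chain_le[of P C n B A n i] by (auto simp: is_chain_def)

lemma is_chain_append:
  assumes "is_chain P C n B A'" "is_chain P D k A' A"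
  shows "is_chain P (\<lambda>i. if i \<le> n then C i else D (i - n)) (n + k) B A"
proof -
  have "D 0 = C n" "\<And>i. i < k \<Longrightarrow> D i \<subset> D (Suc i)" "\<And>i. i < n \<Longrightarrow> C i \<subset> C (Suc i)"
    using assms by (auto simp: is_chain_def)
  note st = this
  have "(if i \<le> n then C i else D (i - n)) \<subset> (if Suc i \<le> n then C (Suc i) else D (Suc i - n))"
    if "i < n + k" for i
    using that st(2,3) st(1)[symmetric]
    by (cases "i < n"; cases "i = n") (simp_all add: Suc_diff_le not_less_eq_eq)
  then show ?thesis using assms unfolding is_chain_def by (auto split: if_splits)
qed

lemma is_chain_single: "P A \<Longrightarrow> is_chain P (\<lambda>_. A) 0 A A"
  by (simp add: is_chain_def)

lemma is_chain_pair: "P A \<Longrightarrow> P B \<Longrightarrow> B \<subset> A \<Longrightarrow> is_chain P (\<lambda>i. if i = 0 then B else A) 1 B A"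
  by (auto simp: is_chain_def)

lemma elen_ge_1: "P A \<Longrightarrow> P B \<Longrightarrow> B \<subset> A \<Longrightarrow> 1 \<le> elen P B A"
  using elen_ge[OF is_chain_pair] by (simp add: one_enat_def)

lemma elen_refl: "elen P A A = 0"
proof -
  have "n = 0" if "is_chain P C n A A" for n C
  proof (rule ccontr)
    assume "n \<noteq> 0"
    then have "C 0 \<subset> C (Suc 0)" "C (Suc 0) \<subseteq> A" "C 0 = A"
      using that is_chain_subset[OF that, of "Suc 0"] by (auto simp: is_chain_def)
    then show False by auto
  qed
  then have "elen P A A \<le> 0" by (intro elen_leI) (simp add: zero_enat_def)
  then show ?thesis by simp
qed

lemma chain_ex: "P A \<Longrightarrow> P B \<Longrightarrow> B \<subseteq> A \<Longrightarrow> \<exists>n C. is_chain P C n B A"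
  using is_chain_single[of P A] is_chain_pair[of P A B] by (cases "B = A") (fastforce simp: psubset_eq)+

lemma elen_attained:
  assumes "P A" "P B" "B \<subseteq> A" "elen P B A = enat n"
  obtains C where "is_chain P C n B A"
proof -
  let ?S = "enat ` {n. \<exists>C. is_chain P C n B A}"
  have ne: "?S \<noteq> {}" using chain_ex[of P A B] assms by auto
  have "finite ?S" using assms(4) ne unfolding elen_def Sup_enat_def by (auto split: if_splits)
  then have "Max ?S \<in> ?S" "Sup ?S = Max ?S" using ne by (auto simp: Sup_enat_def simp del: Max_in intro!: Max_in)
  then have "enat n \<in> ?S" using assms(4) unfolding elen_def by simp
  then show ?thesis using that by auto
qed

lemma enat_Sup_add_le:
  assumes "S \<noteq> {}" "T \<noteq> {}" "\<And>a b. a \<in> S \<Longrightarrow> b \<in> T \<Longrightarrow> enat (a + b) \<le> X"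
  shows "Sup (enat ` S) + Sup (enat ` T) \<le> X"
proof (cases X)
  case (enat x)
  obtain a0 b0 where ab: "a0 \<in> S" "b0 \<in> T" using assms by auto
  have bd: "a + b \<le> x" if "a \<in> S" "b \<in> T" for a b using assms(3)[OF that] enat by simp
  have "S \<subseteq> {..x}" "T \<subseteq> {..x}" using bd ab by (auto simp: subset_iff) (meson add_leD1 add_leD2)+
  then have fin: "finite (enat ` S)" "finite (enat ` T)" by (auto intro: finite_subset)
  then have "Max (enat ` S) \<in> enat ` S" "Max (enat ` T) \<in> enat ` T" using assms by (auto intro!: Max_in)
  then obtain a b where "a \<in> S" "b \<in> T" "Max (enat ` S) = enat a" "Max (enat ` T) = enat b" by auto
  then show ?thesis using fin assms bd[of a b] enat by (simp add: Sup_enat_def)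
qed simp

text \<open>A map that preserves strict inclusions carries chains to chains. One such map in each
  direction replaces an isomorphism theorem.\<close>

lemma elen_map_le:
  assumes "\<And>D. P D \<Longrightarrow> B \<subseteq> D \<Longrightarrow> D \<subseteq> A \<Longrightarrow> P' (f D)"
    and "\<And>D E. P D \<Longrightarrow> P E \<Longrightarrow> B \<subseteq> D \<Longrightarrow> E \<subseteq> A \<Longrightarrow> D \<subset> E \<Longrightarrow> f D \<subset> f E"
  shows "elen P B A \<le> elen P' (f B) (f A)"
proof (rule elen_leI)
  fix n C assume C: "is_chain P C n B A"
  have "is_chain P' (\<lambda>i. f (C i)) n (f B) (f A)"
    unfolding is_chain_def
  proof (intro conjI allI impI)
    fix i assume "i \<le> n"
    then show "P' (f (C i))" using is_chain_subset[OF C] C by (intro assms(1)) (auto simp: is_chain_def)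
  next
    fix i assume "i < n"
    then show "f (C i) \<subset> f (C (Suc i))"
      using is_chain_subset[OF C, of i] is_chain_subset[OF C, of "Suc i"] C
      by (intro assms(2)) (auto simp: is_chain_def)
  qed (use C in \<open>auto simp: is_chain_def\<close>)
  then show "enat n \<le> elen P' (f B) (f A)" by (rule elen_ge)
qed

text \<open>What Jordan-Hoelder additivity requires of a family of subgroups: closure under sums and
  intersections.\<close>

locale subgroup_lattice =
  fixes P :: "'b::ab_group_add set \<Rightarrow> bool"
  assumes P_zero: "P A \<Longrightarrow> 0 \<in> A"
    and P_diff: "P A \<Longrightarrow> a \<in> A \<Longrightarrow> b \<in> A \<Longrightarrow> a - b \<in> A"
    and P_plus: "P A \<Longrightarrow> P B \<Longrightarrow> P (A + B)"
    and P_Int: "P A \<Longrightarrow> P B \<Longrightarrow> P (A \<inter> B)"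
begin

lemma P_add: "P A \<Longrightarrow> a \<in> A \<Longrightarrow> b \<in> A \<Longrightarrow> a + b \<in> A"
  using P_diff[of A a "- b"] P_diff[of A 0 b] P_zero[of A] by simp

lemma P_plus_subset: "P C \<Longrightarrow> A \<subseteq> C \<Longrightarrow> B \<subseteq> C \<Longrightarrow> A + B \<subseteq> C"
  by (auto elim!: set_plus_elim intro: P_add)

lemma elen_superadd:
  assumes "P A" "P B" "P C" "B \<subseteq> C" "C \<subseteq> A"
  shows "elen P B C + elen P C A \<le> elen P B A"
  unfolding elen_def[of P B C] elen_def[of P C A]
proof (rule enat_Sup_add_le)
  show "{n. \<exists>Ca. is_chain P Ca n B C} \<noteq> {}" using chain_ex[of P C B] assms by auto
  show "{n. \<exists>Ca. is_chain P Ca n C A} \<noteq> {}" using chain_ex[of P A C] assms by auto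
  fix a b assume "a \<in> {n. \<exists>Ca. is_chain P Ca n B C}" "b \<in> {n. \<exists>Ca. is_chain P Ca n C A}"
  then obtain C1 C2 where "is_chain P C1 a B C" "is_chain P C2 b C A" by auto
  then show "enat (a + b) \<le> elen P B A" by (rule elen_ge[OF is_chain_append])
qed

text \<open>Intersecting a chain with a fixed member, or adding a fixed member to it, leaves a chain
  with repetitions, of which only the strict steps count.\<close>

lemma weak_chain_le:
  assumes "\<And>i. i \<le> n \<Longrightarrow> P (E i)" "\<And>i. i < n \<Longrightarrow> E i \<subseteq> E (Suc i)"
  shows "enat (card {i. i < n \<and> E i \<noteq> E (Suc i)}) \<le> elen P (E 0) (E n) \<and> E 0 \<subseteq> E n"
  using assms
proof (induction n)
  case (Suc n)
  have IH: "enat (card {i. i < n \<and> E i \<noteq> E (Suc i)}) \<le> elen P (E 0) (E n)" "E 0 \<subseteq> E n"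
    using Suc.IH Suc.prems by auto
  have P: "P (E 0)" "P (E n)" "P (E (Suc n))" and s: "E n \<subseteq> E (Suc n)" using Suc.prems by auto
  show ?case
  proof (cases "E n = E (Suc n)")
    case True
    then have "{i. i < Suc n \<and> E i \<noteq> E (Suc i)} = {i. i < n \<and> E i \<noteq> E (Suc i)}"
      by (auto simp: less_Suc_eq)
    then show ?thesis using IH True by simp
  next
    case False
    then have "{i. i < Suc n \<and> E i \<noteq> E (Suc i)} = insert n {i. i < n \<and> E i \<noteq> E (Suc i)}"
      by (auto simp: less_Suc_eq)
    then have "enat (card {i. i < Suc n \<and> E i \<noteq> E (Suc i)}) = enat (card {i. i < n \<and> E i \<noteq> E (Suc i)}) + 1"
      by (simp add: one_enat_def)
    also have "\<dots> \<le> elen P (E 0) (E n) + elen P (E n) (E (Suc n))"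
      using False s P IH by (intro add_mono elen_ge_1) auto
    also have "\<dots> \<le> elen P (E 0) (E (Suc n))" by (rule elen_superadd) (use P IH s in auto)
    finally show ?thesis using IH s by auto
  qed
qed (simp add: zero_enat_def[symmetric])

text \<open>A chain from \<open>B\<close> to \<open>A\<close> is intersected with \<open>C\<close>
  and added to \<open>C\<close>. No strict step is lost in both images, which gives the upper bound;
  concatenation of chains gives the lower one.\<close>

lemma elen_add:
  assumes "P A" "P B" "P C" "B \<subseteq> C" "C \<subseteq> A"
  shows "elen P B A = elen P B C + elen P C A"
proof (rule antisym)
  show "elen P B A \<le> elen P B C + elen P C A"
  proof (rule elen_leI)
    fix n D assume D: "is_chain P D n B A"
    let ?E = "\<lambda>i. D i \<inter> C" and ?F = "\<lambda>i. D i + C"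
    have DP: "P (D i)" if "i \<le> n" for i using D that by (auto simp: is_chain_def)
    have Ds: "D i \<subset> D (Suc i)" if "i < n" for i using D that by (auto simp: is_chain_def)
    have "enat (card {i. i < n \<and> ?E i \<noteq> ?E (Suc i)}) \<le> elen P (?E 0) (?E n)"
      by (rule conjunct1[OF weak_chain_le]) (use DP Ds assms in \<open>auto intro: P_Int\<close>)
    moreover have "?E 0 = B" "?E n = C" using D assms by (auto simp: is_chain_def)
    ultimately have 1: "enat (card {i. i < n \<and> ?E i \<noteq> ?E (Suc i)}) \<le> elen P B C" by simp
    have "enat (card {i. i < n \<and> ?F i \<noteq> ?F (Suc i)}) \<le> elen P (?F 0) (?F n)"
    proof (rule conjunct1[OF weak_chain_le])
      fix i assume "i < n"
      then show "?F i \<subseteq> ?F (Suc i)" using Ds by (intro set_plus_mono2) auto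
    qed (use DP assms in \<open>auto intro: P_plus\<close>)
    moreover have "B + C = C" "A + C = A"
      using P_plus_subset[of C B C] P_plus_subset[of A A C] set_zero_plus2[of B C] set_zero_plus2[of C A]
        assms P_zero by (auto simp: add.commute)
    moreover have "D 0 = B" "D n = A" using D by (auto simp: is_chain_def)
    ultimately have 2: "enat (card {i. i < n \<and> ?F i \<noteq> ?F (Suc i)}) \<le> elen P C A" by simp
    have "{i. i < n} \<subseteq> {i. i < n \<and> ?E i \<noteq> ?E (Suc i)} \<union> {i. i < n \<and> ?F i \<noteq> ?F (Suc i)}"
    proof (clarsimp)
      fix i assume i: "i < n" and e: "?E i = ?E (Suc i)" and f: "?F i = ?F (Suc i)"
      \<comment> \<open>Modular law: \<open>x\<close> in the larger member equals some
        \<open>a\<close> of the smaller one plus some \<open>c\<close> in \<open>C\<close>, and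
        \<open>c = x - a\<close> then lies in both intersections with \<open>C\<close>.\<close>
      have "D (Suc i) \<subseteq> D i"
      proof
        fix x assume x: "x \<in> D (Suc i)"
        have "x + 0 \<in> ?F (Suc i)" using x assms P_zero by (intro set_plus_intro) auto
        then obtain a c where ac: "x = a + c" "a \<in> D i" "c \<in> C" using f by (metis add.right_neutral set_plus_elim)
        then have "c = x - a" by simp
        then have "c \<in> D (Suc i)" using x ac(2) Ds[OF i] DP[of "Suc i"] i P_diff[of "D (Suc i)" x a]
          by (auto dest: psubsetD)
        then have "c \<in> D i" using e ac by auto
        then show "x \<in> D i" using ac DP[of i] i P_add[of "D i" a c] by simp
      qed
      then show False using Ds[OF i] by auto
    qed
    then have "card {i. i < n} \<le> card ({i. i < n \<and> ?E i \<noteq> ?E (Suc i)} \<union> {i. i < n \<and> ?F i \<noteq> ?F (Suc i)})"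
      by (rule card_mono[rotated]) auto
    then have "n \<le> card {i. i < n \<and> ?E i \<noteq> ?E (Suc i)} + card {i. i < n \<and> ?F i \<noteq> ?F (Suc i)}"
      using order_trans[OF _ card_Un_le] by simp
    then have "enat n \<le> enat (card {i. i < n \<and> ?E i \<noteq> ?E (Suc i)}) + enat (card {i. i < n \<and> ?F i \<noteq> ?F (Suc i)})"
      by simp
    then show "enat n \<le> elen P B C + elen P C A" using add_mono[OF 1 2] by (rule order_trans)
  qed
qed (rule elen_superadd[OF assms])

lemma elen_mono:
  assumes "P A" "P B" "P A'" "P B'" "B \<subseteq> B'" "B' \<subseteq> A'" "A' \<subseteq> A"
  shows "elen P B' A' \<le> elen P B A"
proof -
  have "elen P B A = elen P B B' + (elen P B' A' + elen P A' A)"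
    using elen_add[of A B B'] elen_add[of A B' A'] assms by auto
  then show ?thesis by (simp add: add_increasing add_increasing2)
qed

text \<open>A strictly descending chain, read backwards, is a chain in the sense of
  \<open>is_chain\<close> and cannot be longer than the length.\<close>

lemma dcc_stable:
  assumes "P U" "P Q" "elen P Q U \<noteq> \<infinity>" "\<And>n. P (D n)" "\<And>n. Q \<subseteq> D n" "\<And>n. D n \<subseteq> U"
    "\<And>n. D (Suc n) \<subseteq> D n"
  shows "\<exists>n. D (Suc n) = D n"
proof (rule ccontr)
  assume "\<nexists>n. D (Suc n) = D n"
  then have s: "D (Suc n) \<subset> D n" for n using assms(7)[of n] by auto
  obtain k where k: "elen P Q U = enat k" using assms(3) by auto
  have "is_chain P (\<lambda>i. D (Suc k - i)) (Suc k) (D (Suc k)) (D 0)"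
    unfolding is_chain_def using s assms(4) by (auto simp: Suc_diff_le)
  then have "enat (Suc k) \<le> elen P (D (Suc k)) (D 0)" by (rule elen_ge)
  also have "elen P (D (Suc k)) (D 0) \<le> elen P Q U"
    using lift_Suc_antimono_le[of D, OF assms(7), of 0 "Suc k"] by (intro elen_mono assms(1,2,4,5,6)) simp

  finally show False using k by simp
qed

end

interpretation IL: subgroup_lattice ideal
  by standard (auto intro: ideal_rules ideal_plus ideal_Int)

text \<open>The supremum of an unbounded set of naturals carries no information, so
  \<open>len_quot\<close> is compared with \<open>elen\<close> only in finite length.\<close>

lemma len_quot_eq_elen:
  assumes "ideal J" "elen ideal J UNIV \<noteq> \<infinity>"
  shows "enat (len_quot J) = elen ideal J UNIV"
proof -
  let ?S = "{n. \<exists>C. is_chain ideal C n J UNIV}"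
  have ne: "?S \<noteq> {}" using chain_ex[of ideal UNIV J] assms by auto
  have fin: "finite (enat ` ?S)" using assms(2) ne unfolding elen_def Sup_enat_def by (auto split: if_splits)
  then have finS: "finite ?S" by (rule finite_imageD) (auto intro: inj_onI)
  have "len_quot J = Max ?S"
    unfolding len_quot_def is_chain_def[symmetric] using ne finS by (simp add: cSup_eq_Max is_chain_def)
  moreover have "elen ideal J UNIV = Max (enat ` ?S)"
    unfolding elen_def Sup_enat_def using ne fin by auto
  moreover have "Max (enat ` ?S) = enat (Max ?S)"
    using finS ne by (intro mono_Max_commute[symmetric] monoI) auto
  ultimately show ?thesis by simp
qed

section \<open>The Frobenius and twisted submodules\<close>

text \<open>The module \<open>F\<^sup>e\<^sub>*R\<close> is \<open>R\<close> itself with \<open>r\<close> acting as multiplication by \<open>r ^ q\<close>,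
  where \<open>q = p ^ e\<close>.\<close>

definition submod :: "nat \<Rightarrow> 'a::comm_ring_1 set \<Rightarrow> bool" where
  "submod q S \<longleftrightarrow> 0 \<in> S \<and> (\<forall>x\<in>S. \<forall>y\<in>S. x + y \<in> S) \<and> (\<forall>r x. x \<in> S \<longrightarrow> r ^ q * x \<in> S)"

definition cyc :: "nat \<Rightarrow> 'a::comm_ring_1 \<Rightarrow> 'a set" where
  "cyc q a = range (\<lambda>r. r ^ q * a)"

fun qspan :: "nat \<Rightarrow> 'a::comm_ring_1 list \<Rightarrow> 'a set" where
  "qspan q [] = {0}"
| "qspan q (a # as) = cyc q a + qspan q as"

lemma submod_one: "submod (Suc 0) = ideal"
  by (auto simp: fun_eq_iff submod_def ideal_def)

lemma cyc_one: "cyc (Suc 0) = prin"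
  by (auto simp: fun_eq_iff cyc_def prin_def)

lemma submod_0: "submod q S \<Longrightarrow> 0 \<in> S"
  and submod_add: "submod q S \<Longrightarrow> a \<in> S \<Longrightarrow> b \<in> S \<Longrightarrow> a + b \<in> S"
  and submod_scale: "submod q S \<Longrightarrow> a \<in> S \<Longrightarrow> r ^ q * a \<in> S"
  by (auto simp: submod_def)

lemma ideal_submod: "ideal S \<Longrightarrow> submod q S"
  by (auto simp: submod_def ideal_def)

lemma submod_UNIV [simp]: "submod q UNIV"
  by (simp add: submod_def)

lemma cyc_mem [simp]: "r ^ q * a \<in> cyc q a"
  by (auto simp: cyc_def)

lemma cyc_self [simp]: "a \<in> cyc q a"
  using cyc_mem[of 1 q a] by simp

lemma cyc_subset: "submod q S \<Longrightarrow> a \<in> S \<Longrightarrow> cyc q a \<subseteq> S"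
  by (auto simp: cyc_def submod_scale)

lemma submod_plus_subset: "submod q S \<Longrightarrow> A \<subseteq> S \<Longrightarrow> B \<subseteq> S \<Longrightarrow> A + B \<subseteq> S"
  by (auto elim!: set_plus_elim intro: submod_add)

lemma qspan_subset: "submod q S \<Longrightarrow> set as \<subseteq> S \<Longrightarrow> qspan q as \<subseteq> S"
proof (induction as)
  case (Cons a as)
  then show ?case using submod_plus_subset[of q S "cyc q a" "qspan q as"] by (simp add: cyc_subset)
qed (auto simp: submod_0)

locale frob_local = noeth_local m for m :: "'a::comm_ring_1 set" +
  fixes p :: nat
  assumes prime_p: "prime p" and char_p: "CHAR('a) = p"
    and perfect: "residue_field_perfect p m"
begin

text \<open>The exponent zero is included: at \<open>q = 1\<close> twisted submodules are ideals, so
  results on F_*R specialise to results on \<open>R\<close>.\<close>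

definition frobq :: "nat \<Rightarrow> bool" where
  "frobq q \<longleftrightarrow> (\<exists>e. q = p ^ e)"

lemma frobq_power [simp]: "frobq (p ^ e)"
  by (auto simp: frobq_def)

lemma frobq_p [simp]: "frobq p"
  using frobq_power[of 1] by simp

lemma frobq_1 [simp]: "frobq (Suc 0)"
  using frobq_power[of 0] by simp

lemma frobq_mult: "frobq q \<Longrightarrow> frobq q' \<Longrightarrow> frobq (q * q')"
  by (auto simp: frobq_def power_add[symmetric])

lemma p_gt_1: "1 < p" using prime_p by (rule prime_gt_1_nat)

lemma frobq_pos: "frobq q \<Longrightarrow> 0 < q"
  using p_gt_1 by (auto simp: frobq_def)

lemma frob_add: "frobq q \<Longrightarrow> (a + b) ^ q = a ^ q + b ^ (q :: nat)" for a b :: 'a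
  using freshmans_dream'[of q _ a b] prime_p char_p by (auto simp: frobq_def)

lemma frob_minus: "frobq q \<Longrightarrow> (- b) ^ q = - (b ^ q)" for b :: 'a
  using frob_add[of q b "- b"] frobq_pos[of q] by (simp add: eq_neg_iff_add_eq_0 add.commute zero_power)

lemma frob_diff: "frobq q \<Longrightarrow> (a - b) ^ q = a ^ q - b ^ q" for a b :: 'a
  using frob_add[of q a "- b"] frob_minus[of q b] by simp

lemma frob_zero: "frobq q \<Longrightarrow> (0::'a) ^ q = 0"
  using frobq_pos by (simp add: zero_power)

lemma frob_sum: "frobq q \<Longrightarrow> (sum f A) ^ q = (\<Sum>i\<in>A. f i ^ q)" for f :: "_ \<Rightarrow> 'a"
  by (induction A rule: infinite_finite_induct) (auto simp: frob_add frob_zero)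

lemma frob_perfect: "frobq q \<Longrightarrow> \<exists>b. a - b ^ q \<in> m" for a :: 'a
proof -
  have "\<exists>b. a - b ^ (p ^ e) \<in> m" for e
  proof (induction e arbitrary: a)
    case 0 show ?case by (rule exI[of _ a]) (simp add: ideal_0)
  next
    case (Suc e)
    obtain b where b: "a - b ^ (p ^ e) \<in> m" using Suc by blast
    obtain c where c: "b - c ^ p \<in> m" using perfect unfolding residue_field_perfect_def by blast
    have "(b - c ^ p) ^ (p ^ e) \<in> m"
      using c ideal_pow_mem[OF m_ideal, of "b - c ^ p" 1 "p ^ e"] p_gt_1 by simp
    then have "b ^ (p ^ e) - c ^ (p ^ Suc e) \<in> m" by (simp add: frob_diff power_mult[symmetric])
    then have "(a - b ^ (p ^ e)) + (b ^ (p ^ e) - c ^ (p ^ Suc e)) \<in> m" using b by (intro ideal_add m_ideal)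
    then show ?case by (intro exI[of _ c]) simp
  qed
  then show "frobq q \<Longrightarrow> \<exists>b. a - b ^ q \<in> m" by (auto simp: frobq_def)
qed

lemma submod_uminus: "frobq q \<Longrightarrow> submod q S \<Longrightarrow> a \<in> S \<Longrightarrow> - a \<in> S" for a :: 'a
  using submod_scale[of q S a "- 1"] frob_minus[of q 1] by simp

lemma submod_diff: "frobq q \<Longrightarrow> submod q S \<Longrightarrow> a \<in> S \<Longrightarrow> b \<in> S \<Longrightarrow> a - b \<in> S" for a :: 'a
  using submod_add[of q S a "- b"] submod_uminus[of q S b] by simp

lemma submod_plus:
  assumes "submod q A" "submod q B"
  shows "submod q (A + B)"
  unfolding submod_def
proof (intro conjI ballI allI impI)
  show "0 \<in> A + B" using set_plus_intro[of 0 A 0 B] assms by (simp add: submod_0)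
next
  fix x y assume "x \<in> A + B" "y \<in> A + B"
  then obtain a b c d where x: "x = a + b" "a \<in> A" "b \<in> B" and y: "y = c + d" "c \<in> A" "d \<in> B"
    by (metis set_plus_elim)
  have "x + y = (a + c) + (b + d)" using x y by simp
  moreover have "a + c \<in> A" "b + d \<in> B" using x y assms submod_add by blast+
  ultimately show "x + y \<in> A + B" by (simp add: set_plus_intro)
next
  fix r x assume "x \<in> A + B"
  then show "r ^ q * x \<in> A + B"
  proof (elim set_plus_elim)
    fix a b assume "x = a + b" "a \<in> A" "b \<in> B"
    then show ?thesis using assms set_plus_intro[of "r ^ q * a" A "r ^ q * b" B]
      by (simp add: distrib_left submod_scale)
  qed
qed

lemma submod_image:
  fixes a :: 'a
  assumes q: "frobq q" and Q: "ideal Q"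
  shows "submod q ((\<lambda>r. r ^ q * a) ` Q)"
  unfolding submod_def
proof (intro conjI ballI allI impI)
  show "0 \<in> (\<lambda>r. r ^ q * a) ` Q"
    using Q by (intro image_eqI[of _ _ 0]) (auto simp: frob_zero[OF q] ideal_0)
next
  fix x y assume "x \<in> (\<lambda>r. r ^ q * a) ` Q" "y \<in> (\<lambda>r. r ^ q * a) ` Q"
  then obtain r s where "x = r ^ q * a" "y = s ^ q * a" "r \<in> Q" "s \<in> Q" by blast
  then show "x + y \<in> (\<lambda>r. r ^ q * a) ` Q" using Q
    by (intro image_eqI[of _ _ "r + s"]) (simp_all add: frob_add[OF q] distrib_right ideal_add)
next
  fix r x assume "x \<in> (\<lambda>r. r ^ q * a) ` Q"
  then obtain s where "x = s ^ q * a" "s \<in> Q" by blast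
  then show "r ^ q * x \<in> (\<lambda>r. r ^ q * a) ` Q" using Q
    by (intro image_eqI[of _ _ "r * s"]) (simp_all add: power_mult_distrib mult.assoc ideal_mult_left)
qed

lemma submod_cyc: "frobq q \<Longrightarrow> submod q (cyc q (a :: 'a))"
proof -
  assume "frobq q"
  then show ?thesis using submod_image[of q UNIV a] by (simp add: cyc_def)
qed

lemma submod_qspan: "frobq q \<Longrightarrow> submod q (qspan q (as :: 'a list))"
  by (induction as) (auto intro: submod_plus submod_cyc ideal_submod)

lemma subgroup_lattice_submod: "frobq q \<Longrightarrow> subgroup_lattice (submod q :: 'a set \<Rightarrow> bool)"
  by standard (auto intro: submod_0 submod_diff submod_plus simp: submod_def[of q "_ \<inter> _"] submod_scale submod_add)

lemmas elen_submod_add = subgroup_lattice.elen_add[OF subgroup_lattice_submod]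
lemma qspan_incl: "frobq q \<Longrightarrow> set as \<subseteq> qspan q (as :: 'a list)"
proof (induction as)
  case (Cons a as)
  have "a + 0 \<in> cyc q a + qspan q as" using Cons.prems submod_qspan submod_0 by (intro set_plus_intro) auto
  moreover have "qspan q as \<subseteq> cyc q a + qspan q as"
    using submod_0[OF submod_cyc[OF Cons.prems]] by (rule set_zero_plus2)
  ultimately show ?case using Cons by auto
qed simp

lemma qspan_append: "qspan q (as @ bs) = qspan q as + qspan q bs"
  by (induction as) (auto simp: add.assoc)

lemma ideal_twisted_colon: "frobq q \<Longrightarrow> submod q B \<Longrightarrow> ideal {r. r ^ q * a \<in> B}" for a :: 'a
  unfolding ideal_def
proof (safe, goal_cases)
  case 1 then show ?case by (simp add: frob_zero submod_0)
next
  case (2 x y) then show ?case by (simp add: frob_add distrib_right submod_add)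
next
  case (3 r x) then show ?case using submod_scale[of q B "x ^ q * a" r] by (simp add: power_mult_distrib mult.assoc)
qed

text \<open>\<open>B + cyc q a\<close> modulo \<open>B\<close> is cyclic, hence isomorphic to
  \<open>R\<close> modulo the annihilator of \<open>a\<close>. Preimage and image under the map from
  r to r^q a are strictly monotone in the two directions.\<close>

lemma elen_cyc:
  fixes a :: 'a
  assumes q: "frobq q" and B: "submod q B"
  shows "elen (submod q) B (B + cyc q a) = elen ideal {r. r ^ q * a \<in> B} UNIV"
proof (rule antisym)
  let ?f = "\<lambda>D. {r. r ^ q * a \<in> D}"
  have aB: "a \<in> B + cyc q a" using set_plus_intro[of 0 B a "cyc q a"] B by (simp add: submod_0)
  have "elen (submod q) B (B + cyc q a) \<le> elen ideal (?f B) (?f (B + cyc q a))"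
  proof (rule elen_map_le)
    fix D E assume DE: "submod q D" "submod q E" "B \<subseteq> D" "E \<subseteq> B + cyc q a" "D \<subset> E"
    then obtain x where x: "x \<in> E" "x \<notin> D" by auto
    then have "x \<in> B + cyc q a" using DE by auto
    then obtain b c where bc: "x = b + c" "b \<in> B" "c \<in> cyc q a" by (rule set_plus_elim)
    then obtain r where r: "c = r ^ q * a" by (auto simp: cyc_def)
    have "x - b \<in> E" using x(1) bc DE by (intro submod_diff[OF q DE(2)]) auto
    then have "r ^ q * a \<in> E" using bc r by simp
    moreover have "r ^ q * a \<notin> D" using x bc r DE submod_add[OF DE(1), of b "r ^ q * a"] by auto
    ultimately show "?f D \<subset> ?f E" using DE(5) by auto
  qed (use ideal_twisted_colon[OF q] in auto)
  moreover have "?f (B + cyc q a) = UNIV"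
    using submod_scale[OF submod_plus[OF B submod_cyc[OF q]] aB] by auto
  ultimately show "elen (submod q) B (B + cyc q a) \<le> elen ideal (?f B) UNIV" by simp
next
  let ?Q = "{r. r ^ q * a \<in> B}"
  let ?g = "\<lambda>Q. B + (\<lambda>r. r ^ q * a) ` Q"
  note sub = submod_image[OF q, of _ a]
  have "elen ideal ?Q UNIV \<le> elen (submod q) (?g ?Q) (?g UNIV)"
  proof (rule elen_map_le)
    show "submod q (?g D)" if "ideal D" for D using sub[OF that] B by (rule submod_plus[rotated])
    fix D E assume DE: "ideal D" "ideal E" "?Q \<subseteq> D" "D \<subset> E"
    then obtain r where r: "r \<in> E" "r \<notin> D" by auto
    have "0 + r ^ q * a \<in> ?g E" using r B by (intro set_plus_intro) (auto simp: submod_0)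
    moreover have "r ^ q * a \<notin> ?g D"
    proof
      assume "r ^ q * a \<in> ?g D"
      then obtain b s where "r ^ q * a = b + s ^ q * a" "b \<in> B" "s \<in> D"
        by (auto elim!: set_plus_elim)
      then have "(r - s) ^ q * a \<in> B" by (simp add: frob_diff[OF q] left_diff_distrib)
      then have "r - s \<in> D" using DE(3) by auto
      then show False using r \<open>s \<in> D\<close> ideal_add[OF DE(1), of "r - s" s] by simp
    qed
    moreover have "?g D \<subseteq> ?g E" using DE by (intro set_plus_mono2) auto
    ultimately show "?g D \<subset> ?g E" by auto
  qed
  moreover have "?g ?Q = B"
  proof
    show "?g ?Q \<subseteq> B" using B by (intro submod_plus_subset[OF B]) auto
    show "B \<subseteq> ?g ?Q"
      using set_zero_plus2[of "(\<lambda>r. r ^ q * a) ` ?Q" B] submod_0[OF sub[OF ideal_twisted_colon[OF q B]]]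
      by (simp add: add.commute)
  qed
  ultimately show "elen ideal ?Q UNIV \<le> elen (submod q) B (B + cyc q a)" by (simp add: cyc_def)
qed

lemma elen_prin: "ideal B \<Longrightarrow> elen ideal B (B + prin a) = elen ideal {r. r * a \<in> B} UNIV" for a :: 'a
  using elen_cyc[OF frobq_1, of B a] by (simp add: submod_one cyc_one)

text \<open>Modulo \<open>B\<close> each generator is killed by \<open>Q\<close> and adds at most
  the length of R/Q. This count is the source of the upper bounds that come from generators of
  F_*R.\<close>

lemma elen_qspan_le:
  fixes as :: "'a list"
  assumes q: "frobq q" and "submod q B" "ideal Q" "\<And>a r. a \<in> set as \<Longrightarrow> r \<in> Q \<Longrightarrow> r ^ q * a \<in> B"
  shows "elen (submod q) B (B + qspan q as) \<le> enat (length as) * elen ideal Q UNIV"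
  using assms(2-)
proof (induction as arbitrary: B)
  case Nil
  then show ?case by (simp add: elen_refl zero_enat_def[symmetric])
next
  case (Cons a as)
  let ?B = "B + cyc q a"
  have B': "submod q ?B" using Cons.prems submod_cyc[OF q] by (intro submod_plus)
  have incl: "B \<subseteq> ?B" "?B \<subseteq> ?B + qspan q as"
    using set_zero_plus2[of "cyc q a" B] set_zero_plus2[of "qspan q as" ?B]
      submod_0[OF submod_cyc[OF q]] submod_0[OF submod_qspan[OF q]] by (auto simp: add.commute)
  have "elen (submod q) B (?B + qspan q as) = elen (submod q) B ?B + elen (submod q) ?B (?B + qspan q as)"
    using incl B' Cons.prems(1) submod_qspan[OF q] by (intro elen_submod_add[OF q] submod_plus[OF B']) auto
  moreover have "elen (submod q) B ?B \<le> elen ideal Q UNIV"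
    unfolding elen_cyc[OF q Cons.prems(1)]
    by (rule IL.elen_mono) (use Cons.prems ideal_twisted_colon[OF q] in auto)
  moreover have "elen (submod q) ?B (?B + qspan q as) \<le> enat (length as) * elen ideal Q UNIV"
    by (rule Cons.IH[OF B']) (use Cons.prems incl in auto)
  moreover have "enat (length (a # as)) * elen ideal Q UNIV = elen ideal Q UNIV + enat (length as) * elen ideal Q UNIV"
    by (simp add: eSuc_enat[symmetric] mult_eSuc)
  ultimately show ?case by (simp add: add.assoc add_mono)
qed

section \<open>Finite length\<close>

lemma elen_m: "elen ideal m UNIV = 1"
proof (rule antisym)
  show "elen ideal m UNIV \<le> 1"
  proof (rule elen_leI, rule ccontr)
    fix n C assume C: "is_chain ideal C n m UNIV" and "\<not> enat n \<le> 1"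
    then have n: "1 < n" by (simp add: one_enat_def)
    then have "m \<subset> C 1" "C 1 \<subset> C (Suc 1)" "ideal (C 1)" using C by (auto simp: is_chain_def)
    then show False using m_max unfolding maximal_ideal_def by auto
  qed
  show "1 \<le> elen ideal m UNIV" using m_proper by (intro elen_ge_1) auto
qed

text \<open>The bottom step of a longest chain can be taken cyclic. The annihilator of its generator
  then has colength one, so it is \<open>m\<close> and the factor is a copy of the residue
  field.\<close>

lemma simple_step:
  fixes A :: "'a set"
  assumes "ideal B" "ideal A" "B \<subseteq> A" "elen ideal B A = enat (Suc n)"
  obtains a where "a \<in> A" "a \<notin> B" "\<And>r. r \<in> m \<Longrightarrow> r * a \<in> B" "elen ideal (B + prin a) A = enat n"
    "elen ideal B (B + prin a) = 1"
proof -
  obtain C where C: "is_chain ideal C (Suc n) B A" using elen_attained[of ideal A B] assms by blast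
  have C1: "ideal (C 1)" "B \<subset> C 1" "C 1 \<subseteq> A" "C (Suc n) = A"
    using C is_chain_subset[OF C, of 1] by (auto simp: is_chain_def)
  then obtain a where a: "a \<in> C 1" "a \<notin> B" by auto
  have sub: "B \<subset> B + prin a" "B + prin a \<subseteq> C 1" and id: "ideal (B + prin a)"
    subgoal using a(2) plus_left_incl[OF ideal_prin, of B a] plus_right_incl[OF assms(1), of "prin a"] prin_mem(3)[of a] by blast
    subgoal using a C1 by (intro plus_least) (auto simp: prin_subset)
    subgoal using assms by (intro ideal_plus) auto
    done
  have "is_chain ideal (\<lambda>i. C (Suc i)) n (C 1) A" using C by (auto simp: is_chain_def)
  then have "enat n \<le> elen ideal (C 1) A" by (rule elen_ge)
  also have "\<dots> \<le> elen ideal (B + prin a) A" using sub C1 id assms by (intro IL.elen_mono) auto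
  finally have 1: "enat n \<le> elen ideal (B + prin a) A" .
  have 2: "1 \<le> elen ideal B (B + prin a)" using sub id assms by (intro elen_ge_1) auto
  have 3: "enat (Suc n) = elen ideal B (B + prin a) + elen ideal (B + prin a) A"
    using IL.elen_add[of A B "B + prin a"] sub C1 id assms by auto
  obtain u v where uv: "elen ideal B (B + prin a) = enat u" "elen ideal (B + prin a) A = enat v"
    using 3 by (metis enat.exhaust plus_enat_simps(2,3) enat.distinct(1))
  then have "u = 1" "v = n" using 1 2 3 by (auto simp: one_enat_def)
  then have eq: "elen ideal (B + prin a) A = enat n" "elen ideal B (B + prin a) = 1"
    using uv by (auto simp: one_enat_def)
  let ?Q = "{r. r * a \<in> B}"
  have Q: "ideal ?Q" "?Q \<noteq> UNIV" using a assms ideal_colon[of B a] by (auto simp: set_eq_iff) (metis mult_1)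
  have "?Q = m"
  proof (rule ccontr)
    assume "?Q \<noteq> m"
    then have "?Q \<subset> m" using proper_sub_m[OF Q] by auto
    then have "1 + 1 \<le> elen ideal ?Q m + elen ideal m UNIV"
      using Q elen_m elen_ge_1[of ideal m ?Q] by (intro add_mono) simp_all
    also have "\<dots> = elen ideal ?Q UNIV" using Q \<open>?Q \<subset> m\<close> by (intro IL.elen_add[symmetric]) auto
    also have "\<dots> = 1" using elen_prin[OF assms(1), of a] eq by simp
    finally show False by (simp add: one_enat_def)
  qed
  then show ?thesis using that[of a] a C1 eq by auto
qed

text \<open>Perfectness enters here: every scalar is a \<open>q\<close>-th power up to an element of
  \<open>m\<close>, which kills \<open>a\<close>, so plain and twisted multiples of \<open>a\<close>
  agree modulo \<open>B\<close>.\<close>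

lemma simple_twisted:
  fixes a :: 'a
  assumes q: "frobq q" and B: "ideal B" and a: "\<And>r. r \<in> m \<Longrightarrow> r * a \<in> B"
  shows "B + prin a = B + cyc q a"
proof
  show "B + cyc q a \<subseteq> B + prin a" by (intro set_plus_mono2) (auto simp: cyc_def)
  show "B + prin a \<subseteq> B + cyc q a"
  proof
    fix x assume "x \<in> B + prin a"
    then obtain r where r: "x - r * a \<in> B" using mem_plus_prin[OF B] by auto
    obtain b where b: "r - b ^ q \<in> m" using frob_perfect[OF q] by blast
    have "(x - r * a) + (r - b ^ q) * a \<in> B" using r a[OF b] B by (intro ideal_add)
    then have "x - b ^ q * a \<in> B" by (simp add: algebra_simps)
    then have "(x - b ^ q * a) + b ^ q * a \<in> B + cyc q a" by (intro set_plus_intro) auto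
    then show "x \<in> B + cyc q a" by simp
  qed
qed

text \<open>Copies of the residue field are peeled off one by one, and each is simple for the
  twisted action too. Hence the length of A/B does not depend on the action, and the peeled elements
  generate over Frobenius.\<close>

lemma finite_len_qspan:
  fixes A :: "'a set"
  assumes q: "frobq q" and "ideal B" "ideal A" "B \<subseteq> A" "elen ideal B A = enat n"
  shows "elen (submod q) B A = enat n \<and> (\<exists>as. length as = n \<and> set as \<subseteq> A \<and> A = B + qspan q as)"
  using assms(2-)
proof (induction n arbitrary: B)
  case 0
  then have "B = A" using elen_ge_1[of ideal A B] by (auto simp: zero_enat_def[symmetric])
  then show ?case by (auto simp: elen_refl zero_enat_def)
next
  case (Suc n)
  obtain a where a: "a \<in> A" "a \<notin> B" "\<And>r. r \<in> m \<Longrightarrow> r * a \<in> B" "elen ideal (B + prin a) A = enat n"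
    "elen ideal B (B + prin a) = 1"
    using simple_step[OF Suc.prems] by blast
  have tw: "B + prin a = B + cyc q a" using simple_twisted[OF q Suc.prems(1) a(3)] .
  have B': "ideal (B + prin a)" "B + prin a \<subseteq> A" "B \<subseteq> B + prin a"
    using Suc.prems a(1) plus_left_incl[OF ideal_prin, of B a] plus_least[of A B "prin a"]
    by (simp_all add: ideal_plus prin_subset)
  obtain as where as: "length as = n" "set as \<subseteq> A" "A = (B + prin a) + qspan q as"
    and el: "elen (submod q) (B + prin a) A = enat n"
    using Suc.IH[OF B'(1) Suc.prems(2) B'(2) a(4)] by blast
  have "{r. r ^ q * a \<in> B} = m"
  proof
    show "m \<subseteq> {r. r ^ q * a \<in> B}"
      using a(3) ideal_pow_mem[OF m_ideal, of _ 1 q] frobq_pos[OF q] by auto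
    have "{r. r ^ q * a \<in> B} \<noteq> UNIV" using a(2) by (auto simp: set_eq_iff intro!: exI[of _ 1])
    then show "{r. r ^ q * a \<in> B} \<subseteq> m"
      by (intro proper_sub_m ideal_twisted_colon[OF q] ideal_submod Suc.prems)
  qed
  then have "elen (submod q) B (B + prin a) = 1"
    unfolding tw using elen_cyc[OF q ideal_submod[OF Suc.prems(1)], of a] elen_m by simp
  moreover have "elen (submod q) B A = elen (submod q) B (B + prin a) + elen (submod q) (B + prin a) A"
    using B' Suc.prems by (intro elen_submod_add[OF q] ideal_submod)
  ultimately have "elen (submod q) B A = enat (Suc n)" using el by (simp add: one_enat_def)
  moreover have "A = B + qspan q (a # as)" using as(3) tw by (simp add: add.assoc)
  ultimately show ?case using as a(1) by (intro conjI exI[of _ "a # as"]) auto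
qed

text \<open>The radical of \<open>Q\<close> contains \<open>m\<close>, phrased elementwise; as
  \<open>m\<close> is finitely generated this means that \<open>Q\<close> contains a power of
  \<open>m\<close>. The unit ideal qualifies.\<close>

definition mprim :: "'a set \<Rightarrow> bool" where
  "mprim Q \<longleftrightarrow> ideal Q \<and> (\<forall>a\<in>m. \<exists>n. a ^ n \<in> Q)"

lemma mprim_ideal: "mprim Q \<Longrightarrow> ideal Q"
  by (simp add: mprim_def)

lemma mprim_mono: "mprim Q \<Longrightarrow> ideal Q' \<Longrightarrow> Q \<subseteq> Q' \<Longrightarrow> mprim Q'"
  unfolding mprim_def by blast

definition nzd :: "'a set \<Rightarrow> 'a \<Rightarrow> bool" where
  "nzd Y x \<longleftrightarrow> (\<forall>r. x * r \<in> Y \<longrightarrow> r \<in> Y)"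

lemma nzdD: "nzd Y x \<Longrightarrow> x * r \<in> Y \<Longrightarrow> r \<in> Y"
  unfolding nzd_def by blast

lemma nzdI: "(\<And>r. x * r \<in> Y \<Longrightarrow> r \<in> Y) \<Longrightarrow> nzd Y x"
  unfolding nzd_def by blast

lemma nzd_power: "nzd Y x \<Longrightarrow> nzd Y (x ^ n)"
proof (induction n)
  case (Suc n)
  show ?case
  proof (rule nzdI)
    fix r assume "x ^ Suc n * r \<in> Y"
    then have "x * (x ^ n * r) \<in> Y" by (simp add: mult.assoc)
    then show "r \<in> Y" using Suc nzdD by blast
  qed
qed (auto intro: nzdI)

text \<open>In the filtration by the ideals \<open>Y + prin (x ^ i)\<close> each factor is a
  quotient of \<open>R\<close> modulo \<open>Y + prin x\<close>, and is isomorphic to it when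
  \<open>x\<close> is a nonzerodivisor modulo \<open>Y\<close>.\<close>

lemma elen_pow:
  assumes Y: "ideal Y"
  shows "elen ideal (Y + prin (x ^ n)) UNIV \<le> enat n * elen ideal (Y + prin x) UNIV"
    and "nzd Y x \<Longrightarrow> elen ideal (Y + prin (x ^ n)) UNIV = enat n * elen ideal (Y + prin x) UNIV"
proof (induction n)
  case 0
  have "Y + UNIV = UNIV" using plus_right_incl[OF Y, of UNIV] by auto
  then show "elen ideal (Y + prin (x ^ 0)) UNIV \<le> enat 0 * elen ideal (Y + prin x) UNIV"
    "elen ideal (Y + prin (x ^ 0)) UNIV = enat 0 * elen ideal (Y + prin x) UNIV"
    by (simp_all add: elen_refl zero_enat_def[symmetric])
next
  case (Suc n)
  let ?A = "Y + prin (x ^ Suc n)" and ?B = "Y + prin (x ^ n)"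
  let ?Q = "{r. r * x ^ n \<in> ?A}"
  have id: "ideal ?A" "ideal ?B" "ideal (Y + prin x)" using Y by (auto intro: ideal_plus)
  have eq: "?A + prin (x ^ n) = ?B"
  proof
    show "?A + prin (x ^ n) \<subseteq> ?B"
      using id Y plus_left_incl[OF ideal_prin, of Y "x ^ n"] plus_right_incl[OF Y, of "prin (x ^ n)"]
      by (intro plus_least) (auto simp: prin_subset intro!: ideal_mult_left)
    show "?B \<subseteq> ?A + prin (x ^ n)"
      by (intro set_plus_mono2 plus_left_incl ideal_prin) auto
  qed
  have AB: "?A \<subseteq> ?B" using eq plus_left_incl[OF ideal_prin, of ?A] by blast
  have e: "elen ideal ?A UNIV = elen ideal ?Q UNIV + elen ideal ?B UNIV"
    using IL.elen_add[of UNIV ?A ?B] id AB elen_prin[OF id(1), of "x ^ n"] unfolding eq by simp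
  have Q: "ideal ?Q" using id by (intro ideal_colon)
  have YQ: "Y + prin x \<subseteq> ?Q"
  proof (intro plus_least Q)
    show "Y \<subseteq> ?Q" using Y plus_left_incl[OF ideal_prin, of Y] by (auto intro: ideal_mult_right)
    have "x * x ^ n \<in> ?A" using plus_right_incl[OF Y, of "prin (x ^ Suc n)"] by auto
    then show "prin x \<subseteq> ?Q" using Q by (simp add: prin_subset)
  qed
  have s: "enat (Suc n) * elen ideal (Y + prin x) UNIV
      = elen ideal (Y + prin x) UNIV + enat n * elen ideal (Y + prin x) UNIV"
    by (simp add: eSuc_enat[symmetric] mult_eSuc)
  show "elen ideal ?A UNIV \<le> enat (Suc n) * elen ideal (Y + prin x) UNIV"
    unfolding e s by (rule add_mono[OF IL.elen_mono[OF ideal_UNIV id(3) ideal_UNIV Q YQ] Suc.IH(1)]) simp_all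
  assume nz: "nzd Y x"
  have nzn: "x ^ k * r \<in> Y \<Longrightarrow> r \<in> Y" for k r
    using nzdD[OF nzd_power[OF nz]] .
  have "?Q \<subseteq> Y + prin x"
  proof
    fix r assume "r \<in> ?Q"
    then obtain t where "r * x ^ n - t * x ^ Suc n \<in> Y" using mem_plus_prin[OF Y] by auto
    then have "x ^ n * (r - t * x) \<in> Y" by (simp add: algebra_simps)
    then show "r \<in> Y + prin x" using nzn mem_plus_prin[OF Y] by blast
  qed
  then have "?Q = Y + prin x" using YQ by auto
  then show "elen ideal ?A UNIV = enat (Suc n) * elen ideal (Y + prin x) UNIV"
    unfolding s e using Suc.IH(2)[OF nz] by simp
qed

lemma elen_ig_pow:
  fixes xs :: "'a list"
  assumes "ideal Y"
  shows "elen ideal (Y + ig (map (\<lambda>x. x ^ n) xs)) UNIV \<le> enat (n ^ length xs) * elen ideal (Y + ig xs) UNIV"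
  using assms
proof (induction xs arbitrary: Y)
  case Nil
  then show ?case by (simp add: one_enat_def[symmetric] flip: One_nat_def)
next
  case (Cons x xs)
  let ?Y = "Y + prin (x ^ n)" and ?Z = "Y + ig xs"
  have "elen ideal (?Y + ig (map (\<lambda>x. x ^ n) xs)) UNIV \<le> enat (n ^ length xs) * elen ideal (?Y + ig xs) UNIV"
    using Cons by (intro Cons.IH ideal_plus) auto
  also have "elen ideal (?Y + ig xs) UNIV = elen ideal (?Z + prin (x ^ n)) UNIV" by (simp add: ac_simps)
  also have "enat (n ^ length xs) * elen ideal (?Z + prin (x ^ n)) UNIV
      \<le> enat (n ^ length xs) * (enat n * elen ideal (?Z + prin x) UNIV)"
    using Cons.prems by (intro mult_left_mono elen_pow(1) ideal_plus) auto
  finally show ?case by (simp add: ac_simps mult.assoc[symmetric])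
qed

text \<open>\<open>Q\<close> contains the \<open>n\<close>-th powers of generators of
  \<open>m\<close> for some \<open>n\<close>, and raising generators to powers multiplies the
  colength by a finite factor at most.\<close>

lemma mprim_elen_finite: "mprim Q \<Longrightarrow> elen ideal Q UNIV \<noteq> \<infinity>"
proof -
  assume Q: "mprim Q"
  obtain xs where xs: "m = ig xs" using ideal_fg[OF m_ideal] .
  have "\<exists>n. \<forall>x\<in>set xs. x ^ n \<in> Q"
  proof -
    have "set xs \<subseteq> m" using xs ig_incl[of xs] by simp
    then have "\<forall>x\<in>set xs. \<exists>n. x ^ n \<in> Q" using Q unfolding mprim_def by blast
    then obtain f where f: "\<And>x. x \<in> set xs \<Longrightarrow> x ^ f x \<in> Q" by metis
    have "x ^ (sum f (set xs)) \<in> Q" if "x \<in> set xs" for x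
      using ideal_pow_mem[OF mprim_ideal[OF Q] f[OF that]] member_le_sum[of x "set xs" f] that by simp
    then show ?thesis by blast
  qed
  then obtain n where n: "\<forall>x\<in>set xs. x ^ n \<in> Q" by blast
  have "Q + ig (map (\<lambda>x. x ^ n) xs) = Q"
    using n mprim_ideal[OF Q] by (intro plus_absorb ig_least) auto
  then have "elen ideal Q UNIV \<le> enat (n ^ length xs) * elen ideal (Q + m) UNIV"
    using elen_ig_pow[OF mprim_ideal[OF Q], of n xs] xs by simp
  also have "\<dots> \<le> enat (n ^ length xs) * elen ideal m UNIV"
    using mprim_ideal[OF Q] plus_right_incl[of Q m]
    by (intro mult_left_mono IL.elen_mono) (auto intro: ideal_plus)
  finally have "elen ideal Q UNIV \<le> enat (n ^ length xs)" unfolding elen_m by simp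
  then show ?thesis by (cases "elen ideal Q UNIV") simp_all
qed

end

section \<open>Regular sequences\<close>

lemma power_cong_ideal:
  assumes "ideal W" "u - v \<in> W"
  shows "u ^ k - v ^ k \<in> W"
proof (induction k)
  case (Suc k)
  have "u ^ Suc k - v ^ Suc k = u * (u ^ k - v ^ k) + v ^ k * (u - v)" by (simp add: algebra_simps)
  then show ?case using ideal_lin_mem[OF assms(1) Suc assms(2)] by blast
qed (simp add: assms ideal_0)

context frob_local
begin

text \<open>The base ideal grows as entries are consumed, so inductions pass to a quotient of the
  ring by changing \<open>Y\<close> alone.\<close>

fun regseq :: "'a set \<Rightarrow> 'a list \<Rightarrow> bool" where
  "regseq Y [] \<longleftrightarrow> True"
| "regseq Y (x # xs) \<longleftrightarrow> nzd Y x \<and> regseq (Y + prin x) xs"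

lemma regseq_snoc: "regseq Y (xs @ [a]) \<longleftrightarrow> regseq Y xs \<and> nzd (Y + ig xs) a"
  by (induction xs arbitrary: Y) (auto simp: add.assoc)

text \<open>Regular sequences of length two may be swapped in a local ring. An element killed by
  \<open>b\<close> modulo \<open>Y\<close> is \<open>a\<close> times another such element, so
  Nakayama disposes of all of them; this is where \<open>a \<in> m\<close> is used.\<close>

lemma nzd_swap:
  assumes Y: "ideal Y" and a: "a \<in> m" and na: "nzd Y a" and nb: "nzd (Y + prin a) b"
  shows "nzd Y b" "nzd (Y + prin b) a"
proof -
  let ?D = "{r. r * b \<in> Y}"
  have "?D \<subseteq> Y"
  proof (rule nakayama_elem[OF Y ideal_colon[OF Y] a])
    fix r assume "r \<in> ?D"
    then have r: "b * r \<in> Y" by (simp add: mult.commute)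
    then have "r \<in> Y + prin a" using nzdD[OF nb] plus_left_incl[OF ideal_prin, of Y a] by blast
    then obtain t where t: "r - t * a \<in> Y" using mem_plus_prin[OF Y] by blast
    have "a * (t * b) \<in> Y"
      by (rule ideal_lin_mem[OF Y r t, where r = 1 and s = "- b"]) (simp add: algebra_simps)
    then have "t * b \<in> Y" by (rule nzdD[OF na])
    then show "\<exists>t\<in>?D. r - a * t \<in> Y" using t by (intro bexI[of _ t]) (simp_all add: mult.commute)
  qed
  then show "nzd Y b" by (intro nzdI) (auto simp: mult.commute)
  show "nzd (Y + prin b) a"
  proof (rule nzdI)
    fix r assume "a * r \<in> Y + prin b"
    then obtain s where s: "a * r - s * b \<in> Y" using mem_plus_prin[OF Y] by blast
    then have "- (a * r - s * b) \<in> Y" by (rule ideal_uminus[OF Y])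
    then have "b * s - r * a \<in> Y" by (simp add: algebra_simps)
    then have "b * s \<in> Y + prin a" using mem_plus_prin[OF Y] by blast
    then have "s \<in> Y + prin a" by (rule nzdD[OF nb])
    then obtain t where t: "s - t * a \<in> Y" using mem_plus_prin[OF Y] by blast
    have "a * (r - t * b) \<in> Y"
      by (rule ideal_lin_mem[OF Y s t, where r = 1 and s = b]) (simp add: algebra_simps)
    then have "r - t * b \<in> Y" by (rule nzdD[OF na])
    then show "r \<in> Y + prin b" using mem_plus_prin[OF Y] by blast
  qed
qed

text \<open>Adjacent swaps carry the first entry to the end. In last position an entry is subject to
  a single condition, so it can be altered without touching the others.\<close>

lemma regseq_rotate:
  assumes "ideal Y" "set (a # xs) \<subseteq> m"
  shows "regseq Y (a # xs) \<longleftrightarrow> regseq Y (xs @ [a])"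
  using assms
proof (induction xs arbitrary: Y)
  case (Cons b xs)
  have id: "ideal (Y + prin b)" using Cons.prems by (simp add: ideal_plus)
  have IH: "regseq (Y + prin b) (a # xs) \<longleftrightarrow> regseq (Y + prin b) (xs @ [a])"
    using Cons.prems id by (intro Cons.IH) auto
  have eq: "Y + prin b + prin a = Y + prin a + prin b" by (simp add: ac_simps)
  have "nzd Y a \<and> nzd (Y + prin a) b \<longleftrightarrow> nzd Y b \<and> nzd (Y + prin b) a"
  proof -
    have "a \<in> m" "b \<in> m" using Cons.prems(2) by auto
    then show ?thesis
      using nzd_swap[OF Cons.prems(1), of a b] nzd_swap[OF Cons.prems(1), of b a] by blast
  qed
  moreover have "regseq Y (b # xs @ [a]) \<longleftrightarrow> nzd Y b \<and> nzd (Y + prin b) a \<and> regseq (Y + prin a + prin b) xs"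
    using IH eq by simp
  moreover have "regseq Y (a # b # xs) \<longleftrightarrow> nzd Y a \<and> nzd (Y + prin a) b \<and> regseq (Y + prin a + prin b) xs"
    by simp
  ultimately show ?case unfolding append_Cons by blast
qed simp

lemma regseq_last: "ideal Y \<Longrightarrow> set (a # xs) \<subseteq> m \<Longrightarrow> regseq Y (a # xs) \<Longrightarrow> nzd (Y + ig xs) a"
  using regseq_rotate[of Y a xs] regseq_snoc by blast

lemma regseq_replace:
  assumes "ideal Y" "set (a # xs) \<subseteq> m" "b \<in> m" "regseq Y (a # xs)"
    and "nzd (Y + ig xs) a \<Longrightarrow> nzd (Y + ig xs) b"
  shows "regseq Y (b # xs)"
  using assms regseq_rotate[of Y a xs] regseq_rotate[of Y b xs] regseq_snoc by simp

lemma power_mem_m: "a \<in> m \<Longrightarrow> 0 < n \<Longrightarrow> a ^ n \<in> m"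
  using ideal_pow_mem[OF m_ideal, of a 1 n] by simp

lemma regseq_power_hd:
  "ideal Y \<Longrightarrow> set (a # xs) \<subseteq> m \<Longrightarrow> regseq Y (a # xs) \<Longrightarrow> 0 < n \<Longrightarrow> regseq Y (a ^ n # xs)"
  by (rule regseq_replace[of Y a xs]) (auto intro: nzd_power power_mem_m)

lemma regseq_powers:
  "ideal Y \<Longrightarrow> set xs \<subseteq> m \<Longrightarrow> regseq Y xs \<Longrightarrow> 0 < n \<Longrightarrow> regseq Y (map (\<lambda>x. x ^ n) xs)"
proof (induction xs arbitrary: Y)
  case (Cons x xs)
  have "regseq Y (x ^ n # xs)" using Cons.prems by (intro regseq_power_hd)
  then show ?case using Cons.IH[of "Y + prin (x ^ n)"] Cons.prems by (auto simp: ideal_plus)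
qed simp

text \<open>Each entry is raised to its power while regarded as the last one, where
  \<open>elen_pow\<close> gives the exact factor \<open>n\<close>. For \<open>n = q\<close> this
  computes the colength of J^[q].\<close>

lemma elen_regseq_powers:
  "ideal Y \<Longrightarrow> set xs \<subseteq> m \<Longrightarrow> regseq Y xs \<Longrightarrow> 0 < n \<Longrightarrow>
    elen ideal (Y + ig (map (\<lambda>x. x ^ n) xs)) UNIV = enat (n ^ length xs) * elen ideal (Y + ig xs) UNIV"
proof (induction xs arbitrary: Y)
  case Nil
  then show ?case by (simp add: one_enat_def[symmetric] flip: One_nat_def)
next
  case (Cons x xs)
  have r: "regseq Y (x ^ n # xs)" using Cons.prems by (intro regseq_power_hd)
  have "elen ideal (Y + prin (x ^ n) + ig (map (\<lambda>x. x ^ n) xs)) UNIV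
      = enat (n ^ length xs) * elen ideal (Y + prin (x ^ n) + ig xs) UNIV"
    using Cons.prems r by (intro Cons.IH ideal_plus) auto
  also have "Y + prin (x ^ n) + ig xs = (Y + ig xs) + prin (x ^ n)" by (simp add: ac_simps)
  also have "elen ideal \<dots> UNIV = enat n * elen ideal (Y + ig xs + prin x) UNIV"
    using Cons.prems regseq_last[OF Cons.prems(1-3)] by (intro elen_pow(2) ideal_plus) auto
  finally show ?case by (simp add: ac_simps mult.assoc[symmetric])
qed

section \<open>One-dimensional socles\<close>

text \<open>The socle of R/Q is one-dimensional, spanned by the class of \<open>u\<close>. For an
  \<open>m\<close>-primary \<open>Q\<close> this says that R/Q is Gorenstein.\<close>

definition type1 :: "'a set \<Rightarrow> bool" where
  "type1 Q \<longleftrightarrow> (\<exists>u. u \<notin> Q \<and> (\<forall>r\<in>m. r * u \<in> Q) \<and> (\<forall>v. (\<forall>r\<in>m. r * v \<in> Q) \<longrightarrow> v \<in> Q + prin u))"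

text \<open>Modulo \<open>Y\<close>, the socles of \<open>R/z\<close> and \<open>R/x\<close> are identified by \<open>u \<mapsto> x u / z\<close>.\<close>
lemma type1_exchange:
  assumes Y: "ideal Y" and nz: "nzd Y z" and nx: "nzd Y x" and zm: "z \<in> m" and xm: "x \<in> m"
    and t: "type1 (Y + prin z)"
  shows "type1 (Y + prin x)"
proof -
  note mem = mem_plus_prin[OF Y]
  obtain u where u: "u \<notin> Y + prin z" "\<And>r. r \<in> m \<Longrightarrow> r * u \<in> Y + prin z"
    "\<And>v. (\<forall>r\<in>m. r * v \<in> Y + prin z) \<Longrightarrow> v \<in> Y + prin z + prin u"
    using t unfolding type1_def by blast
  obtain b where b: "x * u - b * z \<in> Y" using u(2)[OF xm] mem by blast
  show ?thesis
    unfolding type1_def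
  proof (intro exI[of _ b] conjI ballI allI impI)
    show "b \<notin> Y + prin x"
    proof
      assume "b \<in> Y + prin x"
      then obtain t where t: "b - t * x \<in> Y" using mem by blast
      have "x * (u - t * z) \<in> Y"
        by (rule ideal_lin_mem[OF Y b t, where r = 1 and s = z]) (simp add: algebra_simps)
      then have "u - t * z \<in> Y" by (rule nzdD[OF nx])
      then show False using u(1) mem by blast
    qed
  next
    fix r assume "r \<in> m"
    then obtain t where t: "r * u - t * z \<in> Y" using u(2) mem by blast
    have "z * (r * b - t * x) \<in> Y"
      by (rule ideal_lin_mem[OF Y b t, where r = "- r" and s = x]) (simp add: algebra_simps)
    then have "r * b - t * x \<in> Y" by (rule nzdD[OF nz])
    then show "r * b \<in> Y + prin x" using mem by blast
  next
    fix v assume v: "\<forall>r\<in>m. r * v \<in> Y + prin x"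
    then obtain a where a: "z * v - a * x \<in> Y" using mem zm by blast
    have "\<forall>r\<in>m. r * a \<in> Y + prin z"
    proof
      fix r assume "r \<in> m"
      then obtain t where t: "r * v - t * x \<in> Y" using v mem by blast
      have "x * (r * a - t * z) \<in> Y"
        by (rule ideal_lin_mem[OF Y a t, where r = "- r" and s = z]) (simp add: algebra_simps)
      then have "r * a - t * z \<in> Y" by (rule nzdD[OF nx])
      then show "r * a \<in> Y + prin z" using mem by blast
    qed
    then have "a \<in> Y + prin z + prin u" by (rule u(3))
    then obtain s where "a - s * u \<in> Y + prin z"
      using mem_plus_prin[OF ideal_plus[OF Y ideal_prin]] by blast
    then obtain t where t: "a - s * u - t * z \<in> Y" using mem by blast
    have "z * (v - s * b - t * x) \<in> Y"
      by (rule ideal_lin3_mem[OF Y a t b, where r = 1 and s = x and t = s]) (simp add: algebra_simps)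
    then have "v - s * b - t * x \<in> Y" by (rule nzdD[OF nz])
    then have "v - s * b \<in> Y + prin x" using mem by blast
    then show "v \<in> Y + prin x + prin b"
      using mem_plus_prin[OF ideal_plus[OF Y ideal_prin]] by blast
  qed
qed

text \<open>Each entry in turn, seen as the last one, is exchanged for its power; hence R/J^[q] is
  Gorenstein along with R/J.\<close>

lemma type1_powers:
  "ideal Y \<Longrightarrow> set xs \<subseteq> m \<Longrightarrow> regseq Y xs \<Longrightarrow> 0 < n \<Longrightarrow> type1 (Y + ig xs) \<Longrightarrow>
    type1 (Y + ig (map (\<lambda>x. x ^ n) xs))"
proof (induction xs arbitrary: Y)
  case (Cons x xs)
  have nx: "nzd (Y + ig xs) x" using Cons.prems by (intro regseq_last)
  have r: "regseq Y (x ^ n # xs)" using Cons.prems by (intro regseq_power_hd)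
  have "type1 (Y + ig xs + prin (x ^ n))"
    using Cons.prems nx
    by (intro type1_exchange[OF _ nx nzd_power[OF nx]] ideal_plus) (auto intro: power_mem_m simp: ac_simps)
  then have "type1 (Y + prin (x ^ n) + ig xs)" by (simp add: ac_simps)
  then have "type1 (Y + prin (x ^ n) + ig (map (\<lambda>x. x ^ n) xs))"
    using Cons.prems r by (intro Cons.IH ideal_plus) auto
  then show ?case by (simp add: add.assoc)
qed simp

section \<open>Exchanging parameters\<close>

text \<open>Krull's principal ideal theorem in dimension one: the ideals \<open>C n\<close> replace the symbolic powers.\<close>
lemma mprim_exchange:
  assumes Y: "ideal Y" and y: "y \<in> m" and nc: "nzd Y c" and mp: "mprim (Y + prin y)"
  shows "mprim (Y + prin c)"
proof -
  \<comment> \<open>Modulo \<open>Y\<close>, \<open>C n\<close> is the ideal of \<open>c ^ n\<close>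
    contracted from the localisation at \<open>y\<close>.\<close>
  define C where "C n = {a. \<exists>k. y ^ k * a \<in> Y + prin (c ^ n)}" for n
  have idc: "ideal (Y + prin (c ^ n))" for n using Y by (simp add: ideal_plus)
  have C_id: "ideal (C n)" for n
    unfolding ideal_def
  proof (intro conjI ballI allI impI)
    show "0 \<in> C n" using idc by (auto simp: C_def ideal_0)
  next
    fix a b assume "a \<in> C n" "b \<in> C n"
    then obtain k l where k: "y ^ k * a \<in> Y + prin (c ^ n)" and l: "y ^ l * b \<in> Y + prin (c ^ n)"
      by (auto simp: C_def)
    have "y ^ (k + l) * (a + b) \<in> Y + prin (c ^ n)"
      by (rule ideal_lin_mem[OF idc k l, where r = "y ^ l" and s = "y ^ k"]) (simp add: algebra_simps power_add)
    then show "a + b \<in> C n" unfolding C_def by blast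
  next
    fix r a assume "a \<in> C n"
    then obtain k where k: "y ^ k * a \<in> Y + prin (c ^ n)" by (auto simp: C_def)
    have "y ^ k * (r * a) \<in> Y + prin (c ^ n)"
      using ideal_mult_left[OF idc k, of r] by (simp add: mult.left_commute)
    then show "r * a \<in> C n" unfolding C_def by blast
  qed
  have C_mono: "C (Suc n) \<subseteq> C n" for n
  proof -
    have "prin (c ^ Suc n) \<subseteq> prin (c ^ n)" by (simp add: prin_subset)
    then have "Y + prin (c ^ Suc n) \<subseteq> Y + prin (c ^ n)" by (intro set_plus_mono2) auto
    then show ?thesis unfolding C_def by blast
  qed
  have YC: "Y \<subseteq> C n" for n
  proof
    fix a assume "a \<in> Y"
    then have "y ^ 0 * a \<in> Y + prin (c ^ n)" using plus_left_incl[OF ideal_prin, of Y "c ^ n"] by auto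
    then show "a \<in> C n" unfolding C_def by blast
  qed
  define D where "D n = (Y + prin y) + C n" for n
  have idy: "ideal (Y + prin y)" using mp by (rule mprim_ideal)
  have "\<exists>n. D (Suc n) = D n"
  proof (rule IL.dcc_stable[OF ideal_UNIV idy mprim_elen_finite[OF mp]])
    fix n
    show "ideal (D n)" unfolding D_def using idy C_id by (rule ideal_plus)
    show "Y + prin y \<subseteq> D n" unfolding D_def by (rule plus_left_incl[OF C_id])
    show "D n \<subseteq> UNIV" by simp
    show "D (Suc n) \<subseteq> D n" unfolding D_def by (intro set_plus_mono2 C_mono subset_refl)
  qed
  then obtain n where n: "D (Suc n) = D n" by blast
  \<comment> \<open>Stability in the Artinian quotient by \<open>y\<close> writes an element of
    \<open>C n\<close> as one of \<open>C (Suc n)\<close> plus a multiple of \<open>y\<close>; the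
    cofactor is again in \<open>C n\<close>, since \<open>y\<close> acts injectively modulo
    \<open>C n\<close>. Nakayama concludes.\<close>
  have "C n \<subseteq> C (Suc n)"
  proof (rule nakayama_elem[OF C_id C_id y])
    fix a assume a: "a \<in> C n"
    then have "a \<in> D n" unfolding D_def using plus_right_incl[OF idy, of "C n"] by blast
    then have "a \<in> D (Suc n)" using n by simp
    then obtain w b where wb: "a = w + b" "w \<in> Y + prin y" "b \<in> C (Suc n)"
      unfolding D_def by (rule set_plus_elim)
    obtain r where r: "w - r * y \<in> Y" using wb(2) mem_plus_prin[OF Y] by blast
    have 1: "(w - r * y) + b \<in> C (Suc n)" using r YC wb(3) by (intro ideal_add[OF C_id]) auto
    have "a - ((w - r * y) + b) \<in> C n" using 1 a C_mono by (intro ideal_diff[OF C_id]) auto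
    then have "y * r \<in> C n" using wb(1) by (simp add: mult.commute)
    then obtain k where "y ^ k * (y * r) \<in> Y + prin (c ^ n)" by (auto simp: C_def)
    then have "y ^ Suc k * r \<in> Y + prin (c ^ n)" by (simp add: algebra_simps)
    then have "r \<in> C n" unfolding C_def by blast
    moreover have "a - y * r \<in> C (Suc n)" using 1 wb(1) by (simp add: algebra_simps)
    ultimately show "\<exists>b\<in>C n. a - y * b \<in> C (Suc n)" by blast
  qed
  moreover have "y ^ 0 * c ^ n \<in> Y + prin (c ^ n)" using plus_right_incl[OF Y, of "prin (c ^ n)"] by auto
  then have "c ^ n \<in> C n" unfolding C_def by blast
  ultimately have "c ^ n \<in> C (Suc n)" by blast
  then obtain k where "y ^ k * c ^ n \<in> Y + prin (c ^ Suc n)" by (auto simp: C_def)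
  then obtain r where "y ^ k * c ^ n - r * c ^ Suc n \<in> Y" using mem_plus_prin[OF Y] by blast
  then have "c ^ n * (y ^ k - r * c) \<in> Y" by (simp add: algebra_simps)
  \<comment> \<open>Cancelling \<open>c ^ n\<close> leaves a power of \<open>y\<close> in
    \<open>Y + prin c\<close>, which is therefore \<open>m\<close>-primary like
    \<open>Y + prin y\<close>.\<close>
  then have "y ^ k - r * c \<in> Y" by (rule nzdD[OF nzd_power[OF nc]])
  then have yk: "y ^ k \<in> Y + prin c" using mem_plus_prin[OF Y] by blast
  have idW: "ideal (Y + prin c)" using Y by (simp add: ideal_plus)
  show ?thesis
    unfolding mprim_def
  proof (intro conjI ballI idW)
    fix a assume "a \<in> m"
    then obtain j where "a ^ j \<in> Y + prin y" using mp by (auto simp: mprim_def)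
    then obtain t where "a ^ j - t * y \<in> Y" using mem_plus_prin[OF Y] by blast
    then have "a ^ j - t * y \<in> Y + prin c" using plus_left_incl[OF ideal_prin, of Y c] by blast
    then have "(a ^ j) ^ k - (t * y) ^ k \<in> Y + prin c" by (rule power_cong_ideal[OF idW])
    moreover have "(t * y) ^ k \<in> Y + prin c" unfolding power_mult_distrib by (rule ideal_mult_left[OF idW yk])
    ultimately have "(a ^ j) ^ k \<in> Y + prin c" using ideal_cong_mem[OF idW] by blast
    then show "\<exists>n. a ^ n \<in> Y + prin c" by (metis power_mult)
  qed
qed

text \<open>That is, \<open>m\<close> is not associated to \<open>Y\<close>.\<close>
definition saturated :: "'a set \<Rightarrow> bool" where
  "saturated Y \<longleftrightarrow> (\<forall>v. (\<forall>r\<in>m. \<exists>n. r ^ n * v \<in> Y) \<longrightarrow> v \<in> Y)"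

lemma saturatedD: "saturated Y \<Longrightarrow> (\<And>r. r \<in> m \<Longrightarrow> \<exists>n. r ^ n * v \<in> Y) \<Longrightarrow> v \<in> Y"
  unfolding saturated_def by blast

lemma nzd_saturated: "nzd Y y \<Longrightarrow> y \<in> m \<Longrightarrow> saturated Y"
  unfolding saturated_def using nzdD[OF nzd_power] by blast

text \<open>A replacement for primary decomposition. Noetherian induction splits off a maximal
  annihilator \<open>P\<close> of an element \<open>a\<close> modulo \<open>Y\<close>; zero divisors
  outside \<open>P\<close> remain zero divisors modulo the saturation of \<open>Y + prin a\<close>.
  Saturation is carried along so that \<open>m\<close> itself is never produced.\<close>

lemma zero_divisor_primes:
  assumes "ideal Y" "saturated Y"
  shows "\<exists>F. finite F \<and> (\<forall>P\<in>F. prime_ideal P \<and> Y \<subseteq> P \<and> P \<noteq> m) \<and>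
    (\<forall>r b. r * b \<in> Y \<longrightarrow> b \<notin> Y \<longrightarrow> (\<exists>P\<in>F. r \<in> P))"
  using assms
proof (induction Y rule: noeth_induct[consumes 1])
  case (1 Y)
  show ?case
  proof (cases "Y = UNIV")
    case True
    then show ?thesis by (intro exI[of _ "{}"]) auto
  next
    case False
    define G where "G = {{r. r * a \<in> Y} | a. a \<notin> Y}"
    obtain a0 where "a0 \<notin> Y" using False by blast
    then have "{r. r * a0 \<in> Y} \<in> G" unfolding G_def by blast
    moreover have "ideal A" if "A \<in> G" for A using that 1(1) by (auto simp: G_def ideal_colon)
    ultimately obtain P where P: "P \<in> G" "\<And>B. B \<in> G \<Longrightarrow> \<not> P \<subset> B" using noeth_maximal by metis
    then obtain a where a: "P = {r. r * a \<in> Y}" "a \<notin> Y" unfolding G_def by blast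
    have "prime_ideal P"
      unfolding prime_ideal_def
    proof (intro conjI allI impI)
      show "ideal P" using a 1(1) by (simp add: ideal_colon)
      have "1 \<notin> P" using a by simp
      then show "P \<noteq> UNIV" by blast
      fix r s assume rs: "r * s \<in> P"
      show "r \<in> P \<or> s \<in> P"
      proof (rule disjCI)
        assume "s \<notin> P"
        then have "s * a \<notin> Y" using a by simp
        then have "{r. r * (s * a) \<in> Y} \<in> G" unfolding G_def by blast
        moreover have "P \<subseteq> {r. r * (s * a) \<in> Y}"
          using a(1) ideal_mult_left[OF 1(1), of _ s] by (auto simp: mult.left_commute[of _ s])
        ultimately have "P = {r. r * (s * a) \<in> Y}" using P(2) by blast
        moreover have "r * (s * a) \<in> Y" using rs a(1) by (simp add: mult.assoc)
        ultimately show "r \<in> P" by blast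
      qed
    qed
    have "P \<noteq> m"
    proof
      assume "P = m"
      then have "\<exists>n. r ^ n * a \<in> Y" if "r \<in> m" for r using that a by (intro exI[of _ 1]) auto
      then show False using saturatedD[OF 1(3)] a(2) by blast
    qed
    have "Y \<subseteq> P" using a 1(1) by (auto intro: ideal_mult_right)
    \<comment> \<open>The saturation of \<open>Y + prin a\<close> with respect to \<open>m\<close>;
      it restores the hypothesis of the induction.\<close>
    define Y1 where "Y1 = {b. \<forall>r\<in>m. \<exists>n. r ^ n * b \<in> Y + prin a}"
    have Y1D: "\<exists>n. r ^ n * b \<in> Y + prin a" if "b \<in> Y1" "r \<in> m" for b r
      using that unfolding Y1_def by blast
    have Y1I: "b \<in> Y1" if "\<And>r. r \<in> m \<Longrightarrow> \<exists>n. r ^ n * b \<in> Y + prin a" for b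
      using that unfolding Y1_def by blast
    have idYa: "ideal (Y + prin a)" using 1(1) by (simp add: ideal_plus)
    have idY1: "ideal Y1"
      unfolding ideal_def
    proof (intro conjI ballI allI impI)
      show "0 \<in> Y1" unfolding Y1_def using ideal_0[OF idYa] by simp
    next
      fix b c assume bc: "b \<in> Y1" "c \<in> Y1"
      have "\<exists>n. r ^ n * (b + c) \<in> Y + prin a" if rm: "r \<in> m" for r
      proof -
        obtain k where k: "r ^ k * b \<in> Y + prin a" using Y1D[OF bc(1) rm] by blast
        obtain l where l: "r ^ l * c \<in> Y + prin a" using Y1D[OF bc(2) rm] by blast
        have "r ^ (k + l) * (b + c) \<in> Y + prin a"
          by (rule ideal_lin_mem[OF idYa k l, where r = "r ^ l" and s = "r ^ k"]) (simp add: algebra_simps power_add)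
        then show ?thesis by blast
      qed
      then show "b + c \<in> Y1" by (rule Y1I)
    next
      fix s b assume b: "b \<in> Y1"
      have "\<exists>n. r ^ n * (s * b) \<in> Y + prin a" if rm: "r \<in> m" for r
      proof -
        obtain k where k: "r ^ k * b \<in> Y + prin a" using Y1D[OF b rm] by blast
        have "r ^ k * (s * b) \<in> Y + prin a"
          using ideal_mult_left[OF idYa k, of s] by (simp add: mult.left_commute)
        then show ?thesis by blast
      qed
      then show "s * b \<in> Y1" by (rule Y1I)
    qed
    have "saturated Y1"
      unfolding saturated_def
    proof (intro allI impI)
      fix v assume v: "\<forall>r\<in>m. \<exists>n. r ^ n * v \<in> Y1"
      have "\<exists>n. r ^ n * v \<in> Y + prin a" if r: "r \<in> m" for r
      proof -
        obtain n where "r ^ n * v \<in> Y1" using v r by blast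
        then obtain k where "r ^ k * (r ^ n * v) \<in> Y + prin a" using Y1D[OF _ r] by blast
        then have "r ^ (k + n) * v \<in> Y + prin a" by (simp add: power_add mult.assoc)
        then show ?thesis by blast
      qed
      then show "v \<in> Y1" by (rule Y1I)
    qed
    have sub1: "Y + prin a \<subseteq> Y1"
    proof
      fix b assume "b \<in> Y + prin a"
      then have "\<exists>n. r ^ n * b \<in> Y + prin a" for r by (intro exI[of _ 0]) simp
      then show "b \<in> Y1" by (rule Y1I)
    qed
    have "Y \<subset> Y1"
    proof
      show "Y \<subseteq> Y1" using sub1 plus_left_incl[OF ideal_prin, of Y a] by blast
      have "a \<in> Y1" using sub1 plus_right_incl[OF 1(1), of "prin a"] prin_mem(3)[of a] by blast
      then show "Y \<noteq> Y1" using a(2) by blast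
    qed
    then obtain F where F: "finite F" "\<forall>P\<in>F. prime_ideal P \<and> Y1 \<subseteq> P \<and> P \<noteq> m"
      "\<forall>r b. r * b \<in> Y1 \<longrightarrow> b \<notin> Y1 \<longrightarrow> (\<exists>P\<in>F. r \<in> P)"
      using 1(2)[OF idY1 \<open>Y \<subset> Y1\<close> \<open>saturated Y1\<close>] by blast
    show ?thesis
    proof (intro exI[of _ "insert P F"] conjI allI impI)
      show "finite (insert P F)" using F by simp
      show "\<forall>P\<in>insert P F. prime_ideal P \<and> Y \<subseteq> P \<and> P \<noteq> m"
        using F(2) \<open>prime_ideal P\<close> \<open>Y \<subseteq> P\<close> \<open>P \<noteq> m\<close> \<open>Y \<subset> Y1\<close> by blast
      fix r b assume rb: "r * b \<in> Y" "b \<notin> Y"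
      show "\<exists>P\<in>insert P F. r \<in> P"
      proof (cases "b \<in> Y1")
        case False
        then show ?thesis using F(3) rb(1) \<open>Y \<subset> Y1\<close> by blast
      next
        case True
        \<comment> \<open>Some power of \<open>s\<close> moves \<open>b\<close> to a multiple
          \<open>t * a\<close> that is nonzero modulo \<open>Y\<close>. Then \<open>t\<close> avoids
          \<open>P\<close>, while \<open>r * t\<close> annihilates \<open>a\<close>, which forces
          \<open>r \<in> P\<close>.\<close>
        have "\<not> (\<forall>s\<in>m. \<exists>n. s ^ n * b \<in> Y)" using saturatedD[OF 1(3)] rb(2) by blast
        then obtain s where s: "s \<in> m" "\<And>n. s ^ n * b \<notin> Y" by blast
        then obtain n where "s ^ n * b \<in> Y + prin a" using Y1D[OF True s(1)] by blast
        then obtain t where t: "s ^ n * b - t * a \<in> Y" using mem_plus_prin[OF 1(1)] by blast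
        then have "t * a \<notin> Y" using s(2)[of n] ideal_cong_mem[OF 1(1) t] by blast
        then have "t \<notin> P" using a by simp
        have "r * t * a \<in> Y"
          by (rule ideal_lin_mem[OF 1(1) rb(1) t, where r = "s ^ n" and s = "- r"]) (simp add: algebra_simps)
        then have "r * t \<in> P" using a by simp
        then have "r \<in> P" using \<open>prime_ideal P\<close> \<open>t \<notin> P\<close> unfolding prime_ideal_def by blast
        then show ?thesis by blast
      qed
    qed
  qed
qed

end

section \<open>General elements over an infinite residue field\<close>

locale frob_local_inf = frob_local +
  assumes infinite_res: "residue_field_infinite m"
begin

text \<open>If two elements \<open>x + t * y\<close>, with parameters differing by a unit, lie in
  one prime, then so do \<open>x\<close> and \<open>y\<close>. Each prime missing \<open>x\<close>
  or \<open>y\<close> thus excludes at most one residue class of \<open>t\<close>, and there are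
  infinitely many classes.\<close>

lemma prime_avoid_pair:
  fixes x y :: 'a
  assumes "finite F" "\<And>P. P \<in> F \<Longrightarrow> prime_ideal P"
  shows "\<exists>t. \<forall>P\<in>F. (x \<in> P \<and> y \<in> P) \<or> x + t * y \<notin> P"
proof (rule ccontr)
  assume "\<nexists>t. \<forall>P\<in>F. (x \<in> P \<and> y \<in> P) \<or> x + t * y \<notin> P"
  then have H: "\<forall>t. \<exists>P. P \<in> F \<and> \<not> (x \<in> P \<and> y \<in> P) \<and> x + t * y \<in> P" by blast
  define cls where "cls r = {s. r - s \<in> m}" for r
  have cls_eq: "cls r = cls s" if rs: "r - s \<in> m" for r s
  proof -
    have "r - t \<in> m \<longleftrightarrow> s - t \<in> m" for t
      using ideal_cong_mem[OF m_ideal, of "r - t" "s - t"] rs by simp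
    then show ?thesis by (simp add: cls_def)
  qed
  obtain f where f: "\<And>t. f t \<in> F \<and> \<not> (x \<in> f t \<and> y \<in> f t) \<and> x + t * y \<in> f t" using H by metis
  have eqf: "cls t = cls t'" if "f t = f t'" for t t'
  proof (rule ccontr)
    assume "cls t \<noteq> cls t'"
    then have "t - t' \<notin> m" using cls_eq by blast
    have P: "prime_ideal (f t)" and id: "ideal (f t)" using assms(2) f[of t] by (auto simp: prime_ideal_def)
    have "(x + t * y) - (x + t' * y) \<in> f t" using f[of t] f[of t'] that by (intro ideal_diff[OF id]) auto
    then have "(t - t') * y \<in> f t" by (simp add: algebra_simps)
    then have yP: "y \<in> f t" by (rule unit_mult_mem[OF id \<open>t - t' \<notin> m\<close>])
    then have "(x + t * y) - t * y \<in> f t" using f[of t] by (intro ideal_diff[OF id] ideal_mult_left[OF id]) auto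
    then show False using yP f[of t] by simp
  qed
  define g where "g P = cls (SOME t. f t = P)" for P
  have "cls t = g (f t)" for t
    unfolding g_def by (rule eqf) (metis (mono_tags, lifting) someI)
  then have "range cls \<subseteq> g ` F" using f by blast
  then have "finite (range cls)" using assms(1) finite_surj by blast
  then show False using infinite_res unfolding residue_field_infinite_def cls_def by simp
qed

lemma prime_avoid_list:
  fixes x :: 'a
  assumes "finite F" "\<And>P. P \<in> F \<Longrightarrow> prime_ideal P"
  shows "\<exists>w\<in>ig xs. \<forall>P\<in>F. set (x # xs) \<subseteq> P \<or> x + w \<notin> P"
proof (induction xs arbitrary: x)
  case (Cons y ys)
  obtain t where t: "\<forall>P\<in>F. (x \<in> P \<and> y \<in> P) \<or> x + t * y \<notin> P"
    using prime_avoid_pair[OF assms] by blast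
  obtain w where w: "w \<in> ig ys" "\<forall>P\<in>F. set ((x + t * y) # ys) \<subseteq> P \<or> (x + t * y) + w \<notin> P"
    using Cons by blast
  have "t * y + w \<in> ig (y # ys)" using w(1) by (auto intro: set_plus_intro)
  moreover have "\<forall>P\<in>F. set (x # y # ys) \<subseteq> P \<or> x + (t * y + w) \<notin> P"
    using t w(2) by (auto simp: add.assoc)
  ultimately show ?case by blast
qed auto

text \<open>A prime above \<open>Y\<close> containing a general element contains all generators,
  hence a power of every element of \<open>m\<close>, and so equals \<open>m\<close>; the primes
  that carry the zero divisors differ from \<open>m\<close>.\<close>

lemma nzd_avoid:
  assumes Y: "ideal Y" "saturated Y" and mp: "mprim (Y + ig (x # xs))"
  shows "\<exists>w\<in>ig xs. nzd Y (x + w)"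
proof -
  obtain F where F: "finite F" "\<And>P. P \<in> F \<Longrightarrow> prime_ideal P \<and> Y \<subseteq> P \<and> P \<noteq> m"
    "\<And>r b. r * b \<in> Y \<Longrightarrow> b \<notin> Y \<Longrightarrow> \<exists>P\<in>F. r \<in> P"
    using zero_divisor_primes[OF Y] by metis
  obtain w where w: "w \<in> ig xs" "\<forall>P\<in>F. set (x # xs) \<subseteq> P \<or> x + w \<notin> P"
    using prime_avoid_list[OF F(1), of xs x] F(2) by blast
  have "x + w \<notin> P" if P: "P \<in> F" for P
  proof
    assume "x + w \<in> P"
    then have s: "set (x # xs) \<subseteq> P" using w(2) P by blast
    have id: "ideal P" and pr: "\<And>a b. a * b \<in> P \<Longrightarrow> a \<in> P \<or> b \<in> P" and ne: "P \<noteq> UNIV"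
      using F(2)[OF P] by (auto simp: prime_ideal_def)
    have "Y + ig (x # xs) \<subseteq> P" using F(2)[OF P] s by (intro plus_least id ig_least) auto
    then have "mprim P" using mp id mprim_mono by blast
    have "1 \<notin> P" using ne id ideal_eq_UNIV by blast
    have pw: "a \<in> P" if "a ^ n \<in> P" for a n using that
      by (induction n) (use \<open>1 \<notin> P\<close> pr in auto)
    have "m \<subseteq> P" using \<open>mprim P\<close> pw unfolding mprim_def by blast
    then show False using F(2)[OF P] proper_sub_m[OF id ne] by blast
  qed
  then have "nzd Y (x + w)" using F(3) by (intro nzdI) blast
  then show ?thesis using w(1) by blast
qed

text \<open>Induction on the length. The first parameter is moved by the others to some
  \<open>z\<close> that is a nonzerodivisor modulo \<open>c\<close>; then, modulo \<open>z\<close>,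
  \<open>c\<close> is exchanged into the remaining parameters. When a single parameter is left,
  \<open>mprim_exchange\<close> and \<open>type1_exchange\<close> apply.\<close>

lemma exchange:
  assumes "ideal Y" "ys \<noteq> []" "regseq Y ys" "set ys \<subseteq> m" "mprim (Y + ig ys)" "nzd Y c" "c \<in> m"
  shows "\<exists>zs. Suc (length zs) = length ys \<and> set zs \<subseteq> m \<and> regseq Y (c # zs) \<and> mprim (Y + ig (c # zs)) \<and>
    (type1 (Y + ig ys) \<longrightarrow> type1 (Y + ig (c # zs)))"
  using assms
proof (induction ys arbitrary: Y)
  case (Cons y1 rest)
  note Y = Cons.prems(1)
  show ?case
  proof (cases rest)
    case Nil
    then have "mprim (Y + prin c)" "type1 (Y + prin y1) \<longrightarrow> type1 (Y + prin c)"
      using Cons.prems mprim_exchange[of Y y1 c] type1_exchange[of Y y1 c] by auto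
    then show ?thesis using Nil Cons.prems(6) by (intro exI[of _ "[]"]) auto
  next
    case (Cons y2 ys')
    have reg: "regseq Y (y1 # rest)" and sm: "set (y1 # rest) \<subseteq> m" using Cons.prems by auto
    have idc: "ideal (Y + prin c)" using Y by (simp add: ideal_plus)
    note memc = mem_plus_prin[OF Y, of _ c]
    \<comment> \<open>With two parameters left, the quotient by \<open>c\<close> still has positive
      depth: the relations of \<open>v\<close> with powers of \<open>y1\<close> and of
      \<open>y2\<close>, combined, show that \<open>v\<close> is a multiple of \<open>c\<close>
      modulo \<open>Y\<close>.\<close>
    have "saturated (Y + prin c)"
      unfolding saturated_def
    proof (intro allI impI)
      fix v assume v: "\<forall>r\<in>m. \<exists>n. r ^ n * v \<in> Y + prin c"
      have pos: "\<exists>n>0. r ^ n * v \<in> Y + prin c" if r: "r \<in> m" for r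
      proof -
        obtain n where "r ^ n * v \<in> Y + prin c" using v r by blast
        then have "r * (r ^ n * v) \<in> Y + prin c" by (rule ideal_mult_left[OF idc])
        then show ?thesis by (intro exI[of _ "Suc n"]) (simp add: mult.assoc)
      qed
      obtain j where j: "j > 0" "y1 ^ j * v \<in> Y + prin c" using pos sm by auto
      obtain k where k: "k > 0" "y2 ^ k * v \<in> Y + prin c" using pos sm Cons by auto
      define a b where "a = y1 ^ j" and "b = y2 ^ k"
      have "regseq Y (y1 ^ j # rest)" using Y sm reg j(1) by (rule regseq_power_hd)
      then have na: "nzd Y a" and nb: "nzd (Y + prin a) b"
        using Cons nzd_power by (auto simp: a_def b_def)
      obtain s where s: "a * v - s * c \<in> Y" using j(2) memc a_def by blast
      obtain t where t: "b * v - t * c \<in> Y" using k(2) memc b_def by blast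
      have "c * (b * s - t * a) \<in> Y"
        by (rule ideal_lin_mem[OF Y s t, where r = "- b" and s = a]) (simp add: algebra_simps)
      then have "b * s - t * a \<in> Y" by (rule nzdD[OF Cons.prems(6)])
      then have "b * s \<in> Y + prin a" using mem_plus_prin[OF Y] by blast
      then have "s \<in> Y + prin a" by (rule nzdD[OF nb])
      then obtain w where w: "s - w * a \<in> Y" using mem_plus_prin[OF Y] by blast
      have "a * (v - w * c) \<in> Y"
        by (rule ideal_lin_mem[OF Y s w, where r = 1 and s = c]) (simp add: algebra_simps)
      then have "v - w * c \<in> Y" by (rule nzdD[OF na])
      then show "v \<in> Y + prin c" using memc by blast
    qed
    moreover have "mprim (Y + prin c + ig (y1 # rest))"
    proof (rule mprim_mono[OF Cons.prems(5)])
      show "ideal (Y + prin c + ig (y1 # rest))" using idc by (simp add: ideal_plus)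
      show "Y + ig (y1 # rest) \<subseteq> Y + prin c + ig (y1 # rest)"
        by (intro set_plus_mono2 plus_left_incl ideal_prin subset_refl)
    qed
    ultimately obtain w where w: "w \<in> ig rest" "nzd (Y + prin c) (y1 + w)"
      using nzd_avoid[OF idc] by blast
    define z where "z = y1 + w"
    have "w \<in> m" using w(1) ig_least[OF m_ideal, of rest] sm by auto
    then have zm: "z \<in> m" using sm unfolding z_def by (intro ideal_add[OF m_ideal]) auto
    have sw: "nzd Y z" "nzd (Y + prin z) c"
      using nzd_swap[OF Y Cons.prems(7) Cons.prems(6) w(2)] by (auto simp: z_def)
    have eqI: "Y + (prin z + ig rest) = Y + (prin y1 + ig rest)"
      by (rule ig_replace[OF _ Y]) (use w(1) plus_right_incl[OF Y, of "ig rest"] in \<open>auto simp: z_def\<close>)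
    have "regseq Y (z # rest)"
    proof (rule regseq_replace[OF Y sm zm reg])
      assume n: "nzd (Y + ig rest) y1"
      have idr: "ideal (Y + ig rest)" using Y by (simp add: ideal_plus)
      have wr: "w \<in> Y + ig rest" using w(1) plus_right_incl[OF Y, of "ig rest"] by blast
      show "nzd (Y + ig rest) z"
      proof (rule nzdI)
        fix r assume "z * r \<in> Y + ig rest"
        then have "z * r - w * r \<in> Y + ig rest" using ideal_mult_right[OF idr wr] by (intro ideal_diff[OF idr])
        then have "y1 * r \<in> Y + ig rest" by (simp add: z_def algebra_simps)
        then show "r \<in> Y + ig rest" by (rule nzdD[OF n])
      qed
    qed
    then have "regseq (Y + prin z) rest" by simp
    moreover have "mprim (Y + prin z + ig rest)" using Cons.prems(5) eqI by (simp add: add.assoc)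
    moreover have "rest \<noteq> []" "set rest \<subseteq> m" using Cons sm by auto
    ultimately have "\<exists>zs. Suc (length zs) = length rest \<and> set zs \<subseteq> m \<and> regseq (Y + prin z) (c # zs) \<and>
        mprim (Y + prin z + ig (c # zs)) \<and> (type1 (Y + prin z + ig rest) \<longrightarrow> type1 (Y + prin z + ig (c # zs)))"
      using Y sw(2) Cons.prems(7) by (intro Cons.IH ideal_plus) auto
    then obtain zs where zs: "Suc (length zs) = length rest" "set zs \<subseteq> m" "regseq (Y + prin z) (c # zs)"
      "mprim (Y + prin z + ig (c # zs))" "type1 (Y + prin z + ig rest) \<longrightarrow> type1 (Y + prin z + ig (c # zs))"
      by blast
    have eq2: "Y + prin z + ig (c # zs) = Y + ig (c # z # zs)" by (simp add: ac_simps)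
    have "regseq Y (c # z # zs)"
      using zs(3) Cons.prems(6) w(2) by (simp add: z_def ac_simps)
    moreover have "type1 (Y + ig (y1 # rest)) \<longrightarrow> type1 (Y + ig (c # z # zs))"
      using zs(5) eqI unfolding eq2 by (simp add: add.assoc)
    ultimately show ?thesis using zs zm unfolding eq2 by (intro exI[of _ "z # zs"]) auto
  qed
qed simp

text \<open>Each generator is moved to general position by the later ones, and
  \<open>exchange\<close> makes it the first entry of a regular sequence of unchanged length. Equal
  lengths make both lists run out together, and the type follows the exchanged sequences.\<close>

lemma regular_generators:
  assumes "ideal Y" "length ys = length xs" "regseq Y ys" "set ys \<subseteq> m" "mprim (Y + ig ys)" "type1 (Y + ig ys)"
    and "set xs \<subseteq> m" "mprim (Y + ig xs)"
  shows "\<exists>xs'. length xs' = length xs \<and> set xs' \<subseteq> m \<and> regseq Y xs' \<and> Y + ig xs' = Y + ig xs \<and> type1 (Y + ig xs')"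
  using assms
proof (induction xs arbitrary: Y ys)
  case (Cons x xs)
  note Y = Cons.prems(1)
  obtain y1 ys0 where ys: "ys = y1 # ys0" using Cons.prems(2) by (cases ys) auto
  have "saturated Y" using Cons.prems ys by (intro nzd_saturated[of Y y1]) auto
  then obtain w where w: "w \<in> ig xs" "nzd Y (x + w)" using nzd_avoid[OF Y] Cons.prems(8) by blast
  define z where "z = x + w"
  have "w \<in> m" using w(1) ig_least[OF m_ideal, of xs] Cons.prems(7) by auto
  then have zm: "z \<in> m" using Cons.prems(7) unfolding z_def by (intro ideal_add[OF m_ideal]) auto
  have eqI: "Y + (prin z + ig xs) = Y + (prin x + ig xs)"
    by (rule ig_replace[OF _ Y]) (use w(1) plus_right_incl[OF Y, of "ig xs"] in \<open>auto simp: z_def\<close>)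
  obtain zs where zs: "Suc (length zs) = length ys" "set zs \<subseteq> m" "regseq Y (z # zs)" "mprim (Y + ig (z # zs))"
    "type1 (Y + ig (z # zs))"
    using exchange[OF Y _ Cons.prems(3,4,5) w(2)] zm Cons.prems(6) ys unfolding z_def by blast
  have "\<exists>xs'. length xs' = length xs \<and> set xs' \<subseteq> m \<and> regseq (Y + prin z) xs' \<and>
      Y + prin z + ig xs' = Y + prin z + ig xs \<and> type1 (Y + prin z + ig xs')"
  proof (rule Cons.IH[of _ zs])
    show "mprim (Y + prin z + ig xs)" using Cons.prems(8) eqI by (simp add: add.assoc)
  qed (use Y zs Cons.prems in \<open>auto simp: add.assoc ideal_plus\<close>)
  then obtain xs' where xs': "length xs' = length xs" "set xs' \<subseteq> m" "regseq (Y + prin z) xs'"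
      "Y + prin z + ig xs' = Y + prin z + ig xs" "type1 (Y + prin z + ig xs')" by blast
  have "Y + ig (z # xs') = Y + ig (x # xs)" using xs'(4) eqI by (simp add: add.assoc)
  then show ?case using xs' zm w(2) by (intro exI[of _ "z # xs'"]) (auto simp: add.assoc z_def)
qed auto

end

section \<open>Duality in Artinian Gorenstein quotients\<close>

lemma colon_antimono: "K \<subseteq> K' \<Longrightarrow> colon Q K' \<subseteq> colon Q K"
  unfolding colon_def by blast

lemma colon_UNIV: "ideal Q \<Longrightarrow> colon Q UNIV = Q"
  unfolding colon_def by (auto intro: ideal_mult_right) (metis mult.right_neutral)

lemma colon_self: "ideal Q \<Longrightarrow> colon Q Q = UNIV"
  unfolding colon_def by (auto intro: ideal_mult_left)

lemma colon_alt_def: "colon Q K = {r. \<forall>k\<in>K. k * r \<in> Q}"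
  by (simp add: colon_def mult.commute)

lemma colon_colon_incl: "K \<subseteq> colon Q (colon Q K)"
  by (auto simp: colon_def mult.commute)

lemma colon_prin: "ideal Q \<Longrightarrow> colon Q (prin a) = {r. r * a \<in> Q}"
proof -
  assume Q: "ideal Q"
  have "x * (k * a) \<in> Q" if "x * a \<in> Q" for x k
    using ideal_mult_left[OF Q that, of k] by (simp add: mult.left_commute)
  then show ?thesis unfolding colon_def prin_def by auto (metis mult_1)
qed

lemma colon_plus:
  assumes "ideal Q" "0 \<in> K" "0 \<in> K'"
  shows "colon Q (K + K') = colon Q K \<inter> colon Q K'"
proof
  show "colon Q (K + K') \<subseteq> colon Q K \<inter> colon Q K'"
    using assms colon_antimono set_zero_plus2 by (metis add.commute le_inf_iff)
  show "colon Q K \<inter> colon Q K' \<subseteq> colon Q (K + K')"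
  proof
    fix x assume x: "x \<in> colon Q K \<inter> colon Q K'"
    have "x * k \<in> Q" if "k \<in> K + K'" for k
      using that
    proof (rule set_plus_elim)
      fix a b assume "k = a + b" "a \<in> K" "b \<in> K'"
      then show ?thesis using x ideal_add[OF assms(1), of "x * a" "x * b"] by (simp add: colon_def distrib_left)
    qed
    then show "x \<in> colon Q (K + K')" unfolding colon_def by blast
  qed
qed

lemma colon_absorb: "ideal Q \<Longrightarrow> 0 \<in> K \<Longrightarrow> colon Q (Q + K) = colon Q K"
  by (simp add: colon_plus colon_self ideal_0)

lemma ideal_image_mult: "ideal A \<Longrightarrow> ideal ((\<lambda>a. a * t) ` A)"
  unfolding ideal_def
proof (intro conjI ballI allI impI)
  assume A: "0 \<in> A \<and> (\<forall>x\<in>A. \<forall>y\<in>A. x + y \<in> A) \<and> (\<forall>r x. x \<in> A \<longrightarrow> r * x \<in> A)"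
  show "0 \<in> (\<lambda>a. a * t) ` A" using A by (intro image_eqI[of _ _ 0]) auto
  fix x assume "x \<in> (\<lambda>a. a * t) ` A"
  then obtain a where a: "x = a * t" "a \<in> A" by blast
  show "r * x \<in> (\<lambda>a. a * t) ` A" for r using A a by (intro image_eqI[of _ _ "r * a"]) (auto simp: mult.assoc)
  fix y assume "y \<in> (\<lambda>a. a * t) ` A"
  then obtain b where "y = b * t" "b \<in> A" by blast
  then show "x + y \<in> (\<lambda>a. a * t) ` A" using A a by (intro image_eqI[of _ _ "a + b"]) (auto simp: distrib_right)
qed

context frob_local
begin

lemma elen_m_quot_le_1:
  assumes "ideal E" "\<And>r. r \<in> m \<Longrightarrow> r * v \<in> E"
  shows "elen ideal E (E + prin v) \<le> 1"
proof -
  have "elen ideal {r. r * v \<in> E} UNIV \<le> elen ideal m UNIV"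
    by (rule IL.elen_mono) (use assms ideal_colon in auto)
  then show ?thesis using elen_prin[OF assms(1)] elen_m by simp
qed

text \<open>Multiplication by \<open>a\<close> maps \<open>colon Q K\<close> into the socle of R/Q
  modulo \<open>Q\<close>, with kernel \<open>colon Q (K + prin a)\<close>. The one-dimensional
  socle bounds the quotient.\<close>

lemma colon_simple_step:
  assumes Q: "ideal Q" "type1 Q" and K: "ideal K" "Q \<subseteq> K" and a: "\<And>r. r \<in> m \<Longrightarrow> r * a \<in> K"
  shows "elen ideal (colon Q (K + prin a)) (colon Q K) \<le> 1"
proof -
  let ?E = "colon Q K" and ?E' = "colon Q (K + prin a)"
  have E: "ideal ?E" "ideal ?E'" using Q by (auto intro: ideal_colon_set)
  have mem: "v \<in> ?E' \<longleftrightarrow> v \<in> ?E \<and> v * a \<in> Q" for v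
    using colon_plus[OF Q(1) ideal_0[OF K(1)] ideal_0[OF ideal_prin], of a] by (simp add: colon_prin[OF Q(1)])
  show ?thesis
  proof (cases "?E' = ?E")
    case True
    then show ?thesis by (simp add: elen_refl)
  next
    case False
    then obtain v where v: "v \<in> ?E" "v * a \<notin> Q" using mem by blast
    obtain u where u: "u \<notin> Q" "\<And>r. r \<in> m \<Longrightarrow> r * u \<in> Q"
      "\<And>v. (\<forall>r\<in>m. r * v \<in> Q) \<Longrightarrow> v \<in> Q + prin u"
      using Q(2) unfolding type1_def by blast
    have soc: "r * (w * a) \<in> Q" if "w \<in> ?E" "r \<in> m" for w r
    proof -
      have "w * (r * a) \<in> Q" using that a unfolding colon_def by blast
      then show ?thesis by (simp add: mult.left_commute)
    qed
    have "\<exists>s. w * a - s * u \<in> Q" if "w \<in> ?E" for w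
      using u(3)[of "w * a"] soc[OF that] mem_plus_prin[OF Q(1)] by blast
    note su = this
    obtain s where s: "v * a - s * u \<in> Q" using su[OF v(1)] by blast
    have "s \<notin> m" using u(2) s v(2) ideal_cong_mem[OF Q(1) s] by blast
    then obtain s' where s': "s' * s = 1" using unit_ex by blast
    have "?E \<subseteq> ?E' + prin v"
    proof
      fix w assume w: "w \<in> ?E"
      obtain t where t: "w * a - t * u \<in> Q" using su[OF w] by blast
      have "(w - t * s' * v) * a = 1 * (w * a - t * u) + (- (t * s')) * (v * a - s * u)"
        using s' by (simp add: algebra_simps) (metis mult.assoc mult.left_commute mult_1)
      then have "(w - t * s' * v) * a \<in> Q" using ideal_lin_mem[OF Q(1) t s] by blast
      moreover have "w - t * s' * v \<in> ?E" using w v(1) by (intro ideal_diff ideal_mult_left E)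
      ultimately have "w - t * s' * v \<in> ?E'" using mem by blast
      then show "w \<in> ?E' + prin v" using mem_plus_prin[OF E(2)] by blast
    qed
    moreover have "r * v \<in> ?E'" if "r \<in> m" for r
      using mem soc[OF v(1) that] ideal_mult_left[OF E(1) v(1)] by (simp add: mult.assoc)
    then have "elen ideal ?E' (?E' + prin v) \<le> 1" by (intro elen_m_quot_le_1 E)
    moreover have "elen ideal ?E' ?E \<le> elen ideal ?E' (?E' + prin v)"
      using calculation(1) mem E by (intro IL.elen_mono ideal_plus) auto
    ultimately show ?thesis by simp
  qed
qed

lemma colon_len_le:
  assumes Q: "ideal Q" "type1 Q" and "ideal K" "ideal K'" "Q \<subseteq> K" "K \<subseteq> K'" "elen ideal K K' = enat n"
  shows "elen ideal (colon Q K') (colon Q K) \<le> enat n"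
  using assms(3-)
proof (induction n arbitrary: K)
  case 0
  then have "K = K'" using elen_ge_1[of ideal K' K] by (auto simp: zero_enat_def[symmetric])
  then show ?case by (simp add: elen_refl)
next
  case (Suc n)
  obtain a where a: "a \<in> K'" "\<And>r. r \<in> m \<Longrightarrow> r * a \<in> K" "elen ideal (K + prin a) K' = enat n"
    using simple_step[OF Suc.prems(1,2,4,5)] by blast
  have id: "ideal (K + prin a)" using Suc.prems by (simp add: ideal_plus)
  have s1: "K \<subseteq> K + prin a" by (rule plus_left_incl) simp
  have s2: "K + prin a \<subseteq> K'" using Suc.prems a(1) by (intro plus_least) (auto simp: prin_subset)
  have "elen ideal (colon Q K') (colon Q K)
      = elen ideal (colon Q K') (colon Q (K + prin a)) + elen ideal (colon Q (K + prin a)) (colon Q K)"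
    using s1 s2 Q by (intro IL.elen_add ideal_colon_set colon_antimono)
  also have "\<dots> \<le> enat n + 1"
    using Suc.IH[OF id Suc.prems(2) _ s2 a(3)] s1 Suc.prems colon_simple_step[OF Q Suc.prems(1,3) a(2)]
    by (intro add_mono) auto
  finally show ?case by (simp add: one_enat_def)
qed

text \<open>\<open>colon_len_le\<close> bounds the duals of K/Q and of R/K. Both the lengths and the
  bounds add up to the length of R/Q, so neither inequality is strict.\<close>

lemma dual_len:
  assumes Q: "mprim Q" "type1 Q" and K: "ideal K" "Q \<subseteq> K"
  shows "elen ideal (colon Q K) UNIV = elen ideal Q K"
proof -
  have id: "ideal Q" using Q by (simp add: mprim_ideal)
  obtain L where L: "elen ideal Q UNIV = enat L" using mprim_elen_finite[OF Q(1)] by auto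
  have a1: "elen ideal Q UNIV = elen ideal Q K + elen ideal K UNIV" using id K by (intro IL.elen_add) auto
  then obtain i j where ij: "elen ideal Q K = enat i" "elen ideal K UNIV = enat j"
    using L by (cases "elen ideal Q K"; cases "elen ideal K UNIV") auto
  have QE: "Q \<subseteq> colon Q K" using colon_antimono[of K UNIV Q] colon_UNIV[OF id] by auto
  have a2: "elen ideal Q UNIV = elen ideal Q (colon Q K) + elen ideal (colon Q K) UNIV"
    using id QE by (intro IL.elen_add ideal_colon_set) auto
  then obtain i' j' where ij': "elen ideal Q (colon Q K) = enat j'" "elen ideal (colon Q K) UNIV = enat i'"
    using L by (cases "elen ideal Q (colon Q K)"; cases "elen ideal (colon Q K) UNIV") auto
  have "i' \<le> i" using colon_len_le[OF id Q(2) id K(1) _ K(2) ij(1)] ij'(2) colon_self[OF id] by simp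
  moreover have "j' \<le> j" using colon_len_le[OF id Q(2) K(1) ideal_UNIV K(2) _ ij(2)] ij'(1) colon_UNIV[OF id] by simp
  moreover have "i + j = j' + i'" using a1 a2 ij ij' by simp
  ultimately show ?thesis using ij ij' by simp
qed

lemma elen_eq_imp_eq:
  assumes "ideal A" "ideal B" "A \<subseteq> B" "elen ideal A UNIV = elen ideal B UNIV" "elen ideal B UNIV \<noteq> \<infinity>"
  shows "A = B"
proof (rule ccontr)
  assume "A \<noteq> B"
  then have "1 \<le> elen ideal A B" using assms by (intro elen_ge_1) auto
  moreover have "elen ideal A UNIV = elen ideal A B + elen ideal B UNIV" using assms by (intro IL.elen_add) auto
  ultimately show False using assms(4,5) by (cases "elen ideal B UNIV"; cases "elen ideal A B") (auto simp: one_enat_def)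
qed

text \<open>\<open>K\<close> is contained in its double colon and, by \<open>dual_len\<close>
  applied twice, has the same finite colength.\<close>

lemma double_colon:
  assumes Q: "mprim Q" "type1 Q" and K: "ideal K" "Q \<subseteq> K"
  shows "colon Q (colon Q K) = K"
proof -
  let ?E = "colon Q K"
  have id: "ideal Q" using Q by (simp add: mprim_ideal)
  obtain L where L: "elen ideal Q UNIV = enat L" using mprim_elen_finite[OF Q(1)] by auto
  have E: "ideal ?E" using id by (rule ideal_colon_set)
  have QE: "Q \<subseteq> ?E" using colon_antimono[of K UNIV Q] colon_UNIV[OF id] by auto
  have "elen ideal (colon Q ?E) UNIV = elen ideal Q ?E" using dual_len[OF Q E QE] .
  moreover have "elen ideal Q UNIV = elen ideal Q K + elen ideal K UNIV" using id K by (intro IL.elen_add) auto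
  moreover have "elen ideal Q UNIV = elen ideal Q ?E + elen ideal ?E UNIV" using id QE E by (intro IL.elen_add) auto
  moreover note dual_len[OF Q K]
  ultimately have eq: "elen ideal K UNIV = elen ideal (colon Q ?E) UNIV" and fin: "elen ideal K UNIV \<noteq> \<infinity>"
    using L by (cases "elen ideal K UNIV"; cases "elen ideal Q K"; cases "elen ideal Q ?E"; auto)+
  show ?thesis
    using elen_eq_imp_eq[OF K(1) ideal_colon_set[OF id, of ?E] colon_colon_incl eq] eq fin by simp
qed

text \<open>Baer's criterion for R/Q, with a homomorphism given by representatives \<open>g\<close>.
  Generators of \<open>D\<close> are added one at a time; the correction for a new generator must
  annihilate the ideal treated so far, and the double colon shows that such a correction
  exists.\<close>

lemma self_injective:
  assumes Q: "mprim Q" "type1 Q" and D: "ideal D" "Q \<subseteq> D"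
    and add: "\<And>s t. s \<in> D \<Longrightarrow> t \<in> D \<Longrightarrow> g (s + t) - g s - g t \<in> Q"
    and scale: "\<And>r t. t \<in> D \<Longrightarrow> g (r * t) - r * g t \<in> Q"
    and zero: "\<And>t. t \<in> Q \<Longrightarrow> g t \<in> Q"
  shows "\<exists>w. \<forall>t\<in>D. g t - t * w \<in> Q"
proof -
  have id: "ideal Q" using Q by (simp add: mprim_ideal)
  obtain ts where ts: "D = ig ts" using ideal_fg[OF D(1)] .
  have "\<exists>w. \<forall>t\<in>Q + ig ts. g t - t * w \<in> Q" if "set ts \<subseteq> D" for ts
    using that
  proof (induction ts)
    case Nil
    show ?case using zero by (intro exI[of _ 0]) auto
  next
    case (Cons t ts)
    let ?D = "Q + ig ts"
    obtain w where w: "\<And>s. s \<in> ?D \<Longrightarrow> g s - s * w \<in> Q" using Cons by auto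
    have tD: "t \<in> D" and "set ts \<subseteq> D" using Cons.prems by auto
    then have sub: "?D \<subseteq> D" by (intro plus_least[OF D(1) D(2)] ig_least[OF D(1)])
    have idD: "ideal ?D" using id by (simp add: ideal_plus)
    define A where "A = colon Q ?D"
    have A: "ideal A" unfolding A_def using id by (rule ideal_colon_set)
    have DA: "colon Q A = ?D" unfolding A_def by (rule double_colon[OF Q idD plus_left_incl]) simp
    \<comment> \<open>Modulo \<open>Q\<close>, these are the values at \<open>t\<close> of the
      multiplications that vanish on the previous ideal.\<close>
    let ?T = "Q + (\<lambda>a. a * t) ` A"
    have T: "ideal ?T" using id ideal_image_mult[OF A] by (rule ideal_plus)
    have QT: "Q \<subseteq> ?T" by (rule plus_left_incl[OF ideal_image_mult[OF A]])
    have "colon Q ?T = {r. r * t \<in> ?D}"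
    proof -
      have "colon Q ?T = colon Q ((\<lambda>a. a * t) ` A)" by (rule colon_absorb[OF id ideal_0[OF ideal_image_mult[OF A]]])
      also have "\<dots> = {r. r * t \<in> colon Q A}" unfolding colon_def by (auto simp: ac_simps)
      finally show ?thesis unfolding DA .
    qed
    then have T2: "colon Q {r. r * t \<in> ?D} = ?T" using double_colon[OF Q T QT] by simp
    have "g t - t * w \<in> colon Q {r. r * t \<in> ?D}"
      unfolding colon_alt_def
    proof (intro CollectI ballI)
      fix r assume "r \<in> {r. r * t \<in> ?D}"
      then have "g (r * t) - r * t * w \<in> Q" using w by blast
      from ideal_lin_mem[OF id this scale[OF tD, of r], where r = 1 and s = "- 1"]
      show "r * (g t - t * w) \<in> Q" by (simp add: algebra_simps)
    qed
    then have "g t - t * w \<in> ?T" unfolding T2 .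
    then obtain qq a where qa: "g t - t * w = qq + a * t" "qq \<in> Q" "a \<in> A" by (auto elim!: set_plus_elim)
    show ?case
    proof (intro exI[of _ "w + a"] ballI)
      fix x assume "x \<in> Q + ig (t # ts)"
      then have "x \<in> ?D + prin t" by (simp add: ac_simps)
      then obtain r where r: "x - r * t \<in> ?D" using mem_plus_prin[OF idD] by blast
      define d where "d = x - r * t"
      have x: "x = d + r * t" and d: "d \<in> ?D" using r by (auto simp: d_def)
      have e1: "g x - g d - g (r * t) \<in> Q" unfolding x using d sub tD by (intro add ideal_mult_left[OF D(1)]) auto
      have e2: "g (r * t) - r * g t \<in> Q" by (rule scale[OF tD])
      have e3: "g d - d * w \<in> Q" by (rule w[OF d])
      have e4: "a * d \<in> Q" using qa(3) d unfolding A_def colon_def by blast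
      have "g x - x * (w + a) = ((g x - g d - g (r * t)) + (g (r * t) - r * g t)) + (g d - d * w) - a * d + r * qq"
        using qa(1) unfolding x by (simp add: algebra_simps)
      also have "\<dots> \<in> Q"
        by (intro ideal_add[OF id] ideal_diff[OF id _ e4] e1 e2 e3 ideal_mult_left[OF id qa(2)])
      finally show "g x - x * (w + a) \<in> Q" .
    qed
  qed
  from this[of ts] have "\<exists>w. \<forall>t\<in>Q + ig ts. g t - t * w \<in> Q" using ts ig_incl[of ts] by simp
  moreover have "D \<subseteq> Q + ig ts" using ts plus_right_incl[OF id] by simp
  ultimately show ?thesis by blast
qed

end

section \<open>The Hilbert-Samuel multiplicity\<close>

text \<open>In a product of \<open>n + 1\<close> factors from \<open>prin x + J\<close>, either some
  factor contributes \<open>x\<close> or all of them come from \<open>J\<close>.\<close>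

lemma ideal_pow_plus_subset:
  assumes J: "ideal J"
  shows "ideal_pow (prin x + J) (Suc n) \<subseteq> (\<lambda>a. a * x) ` ideal_pow (prin x + J) n + ideal_pow J (Suc n)"
proof (induction n)
  case 0
  show ?case unfolding ideal_pow.simps(2)
  proof (rule ideal_mult_least)
    show "ideal ((\<lambda>a. a * x) ` ideal_pow (prin x + J) 0 + ideal_mult J (ideal_pow J 0))"
      by (intro ideal_plus ideal_image_mult ideal_mult_ideal ideal_pow_ideal)
    fix a b assume "a \<in> prin x + J"
    then obtain r j where a: "a = r * x + j" "j \<in> J" by (auto elim!: set_plus_elim simp: prin_def)
    have "a * b = (r * b) * x + j * b" using a by (simp add: algebra_simps)
    also have "\<dots> \<in> (\<lambda>a. a * x) ` ideal_pow (prin x + J) 0 + ideal_mult J (ideal_pow J 0)"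
      using a(2) by (intro set_plus_intro ideal_mult_mem) auto
    finally show "a * b \<in> (\<lambda>a. a * x) ` ideal_pow (prin x + J) 0 + ideal_mult J (ideal_pow J 0)" .
  qed
next
  case (Suc n)
  let ?P = "ideal_pow (prin x + J)"
  let ?R = "(\<lambda>a. a * x) ` ?P (Suc n) + ideal_pow J (Suc (Suc n))"
  have "ideal_mult (prin x + J) (?P (Suc n)) \<subseteq> ?R"
  proof (rule ideal_mult_least)
    show "ideal ?R" by (intro ideal_plus ideal_image_mult ideal_pow_ideal)
    fix a b assume "a \<in> prin x + J" and b: "b \<in> ?P (Suc n)"
    then obtain r j where a: "a = r * x + j" "j \<in> J" by (auto elim!: set_plus_elim simp: prin_def)
    obtain c b' where c: "b = c * x + b'" "c \<in> ?P n" "b' \<in> ideal_pow J (Suc n)"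
      using b Suc by (auto elim!: set_plus_elim dest!: subsetD)
    have "j \<in> prin x + J" using a(2) plus_right_incl[OF ideal_prin, of J x] by blast
    then have "j * c \<in> ?P (Suc n)" using c(2) by (simp add: ideal_mult_mem)
    then have "r * b + j * c \<in> ?P (Suc n)"
      using ideal_mult_left[OF ideal_pow_ideal b, of r] by (intro ideal_add ideal_pow_ideal)
    moreover have "j * b' \<in> ideal_pow J (Suc (Suc n))" using a(2) c(3) by (simp add: ideal_mult_mem)
    ultimately have "(r * b + j * c) * x + j * b' \<in> ?R" by (intro set_plus_intro) auto
    moreover have "a * b = (r * b + j * c) * x + j * b'" using a c by (simp add: algebra_simps)
    ultimately show "a * b \<in> ?R" by simp
  qed
  then show ?case by simp
qed

lemma ideal_pow_zero: "ideal_pow {0} (Suc n) = {0}"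
proof -
  have "ideal_mult {0} (ideal_pow {0} n) \<subseteq> {0}" by (rule ideal_mult_least) auto
  then show ?thesis using ideal_0[OF ideal_mult_ideal] by auto
qed

lemma ideal_pow_1: "ideal J \<Longrightarrow> ideal_pow J (Suc 0) = J"
proof -
  assume J: "ideal J"
  have "ideal_mult J UNIV \<subseteq> J" using J by (intro ideal_mult_least) (auto intro: ideal_mult_right)
  moreover have "J \<subseteq> ideal_mult J UNIV" using ideal_mult_mem[of _ J 1 UNIV] by auto
  ultimately show ?thesis by simp
qed

context frob_local
begin

text \<open>Multiplication by \<open>w\<close> raises the order with respect to powers of the ideal
  by one and no more, like multiplication by a variable on the associated graded ring.\<close>

lemma colon_pow_aux:
  assumes Y: "ideal Y" and n: "nzd (Y + ideal_pow (ig ws) (Suc n)) w"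
    and s: "w * s \<in> Y + ideal_pow (ig (w # ws)) (Suc n)"
  shows "s \<in> Y + ideal_pow (ig (w # ws)) n"
proof -
  let ?J = "ig (w # ws)"
  have idn: "ideal (Y + ideal_pow (ig ws) (Suc n))" "ideal (Y + ideal_pow ?J n)"
    using Y by (auto intro!: ideal_plus ideal_mult_ideal ideal_pow_ideal)
  obtain y j where "w * s = y + j" "y \<in> Y" "j \<in> ideal_pow ?J (Suc n)" using s by (rule set_plus_elim)
  then obtain c b where c: "w * s = y + (c * w + b)" "y \<in> Y" "c \<in> ideal_pow ?J n" "b \<in> ideal_pow (ig ws) (Suc n)"
    using ideal_pow_plus_subset[OF ideal_ig, of w ws n] by (auto elim!: set_plus_elim dest!: subsetD)
  have "w * (s - c) = y + b" using c(1) by (simp add: algebra_simps)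
  then have "w * (s - c) \<in> Y + ideal_pow (ig ws) (Suc n)" using c by (simp add: set_plus_intro)
  then have "s - c \<in> Y + ideal_pow (ig ws) (Suc n)" by (rule nzdD[OF n])
  moreover have "ideal_pow (ig ws) (Suc n) \<subseteq> ideal_pow ?J n"
    using ideal_pow_antimono[of n "Suc n" "ig ws"] ideal_pow_mono[of "ig ws" ?J n] plus_right_incl[OF ideal_prin, of "ig ws" w] by auto
  then have "Y + ideal_pow (ig ws) (Suc n) \<subseteq> Y + ideal_pow ?J n" by (intro set_plus_mono2 subset_refl)
  ultimately have "s - c \<in> Y + ideal_pow ?J n" by blast
  moreover have "c \<in> Y + ideal_pow ?J n" using c(3) plus_right_incl[OF Y] by blast
  ultimately have "(s - c) + c \<in> Y + ideal_pow ?J n" by (rule ideal_add[OF idn(2)])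
  then show ?thesis by simp
qed

text \<open>Quasi-regularity without the associated graded ring. Working modulo \<open>w\<close>
  reduces \<open>r\<close> to a multiple \<open>a * w\<close>; cancelling \<open>w\<close> in
  \<open>x * a * w\<close> lowers the exponent by one, where the induction on \<open>n\<close>
  applies.\<close>

lemma nzd_ideal_pow:
  assumes "ideal Y" "set xs \<subseteq> m" "regseq Y xs" "nzd (Y + ig xs) x"
  shows "nzd (Y + ideal_pow (ig xs) n) x"
  using assms
proof (induction xs arbitrary: Y x n)
  case Nil
  have "Y + UNIV = UNIV" using plus_right_incl[OF Nil(1), of UNIV] by auto
  then show ?case
  proof (cases n)
    case (Suc k)
    then show ?thesis using Nil by (simp add: ideal_pow_zero del: ideal_pow.simps(2))
  qed (auto intro: nzdI)
next
  case (Cons w ws)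
  note Y = Cons.prems(1)
  let ?J = "ig (w # ws)"
  have sub: "ig ws \<subseteq> ?J" using plus_right_incl[OF ideal_prin, of "ig ws" w] by simp
  have Yw: "ideal (Y + prin w)" using Y by (simp add: ideal_plus)
  have rot: "regseq Y ws" "nzd (Y + ig ws) w"
    using regseq_rotate[OF Y Cons.prems(2)] Cons.prems(3) regseq_snoc by auto
  have nw: "nzd (Y + ideal_pow (ig ws) k) w" for k
    using Cons.IH[OF Y _ rot] Cons.prems(2) by auto
  have nx: "nzd (Y + prin w + ideal_pow (ig ws) k) x" for k
    by (rule Cons.IH[OF Yw]) (use Cons.prems in \<open>auto simp: add.assoc\<close>)
  show ?case
  proof (induction n)
    case 0
    have "Y + UNIV = UNIV" using plus_right_incl[OF Y, of UNIV] by auto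
    then show ?case by (auto intro: nzdI)
  next
    case (Suc n)
    have idn: "ideal (Y + ideal_pow ?J k)" for k using Y by (intro ideal_plus ideal_pow_ideal)
    show ?case
    proof (rule nzdI)
      fix r assume r: "x * r \<in> Y + ideal_pow ?J (Suc n)"
      have "Y + ideal_pow ?J (Suc n) \<subseteq> Y + (prin w + ideal_pow (ig ws) (Suc n))"
      proof (intro set_plus_mono2 subset_refl)
        have "(\<lambda>a. a * w) ` ideal_pow ?J n + ideal_pow (ig ws) (Suc n) \<subseteq> prin w + ideal_pow (ig ws) (Suc n)"
          by (intro set_plus_mono2 subset_refl) auto
        then show "ideal_pow ?J (Suc n) \<subseteq> prin w + ideal_pow (ig ws) (Suc n)"
          using ideal_pow_plus_subset[OF ideal_ig, of w ws n] by (simp del: ideal_pow.simps)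
      qed
      then have "x * r \<in> Y + prin w + ideal_pow (ig ws) (Suc n)" using r by (auto simp: add.assoc simp del: ideal_pow.simps)
      then have "r \<in> Y + prin w + ideal_pow (ig ws) (Suc n)" by (rule nzdD[OF nx])
      then obtain y a b where y: "r = y + a * w + b" "y \<in> Y" "b \<in> ideal_pow (ig ws) (Suc n)"
        by (auto elim!: set_plus_elim simp: prin_def simp del: ideal_pow.simps)
      have yb: "y + b \<in> Y + ideal_pow ?J (Suc n)"
        using y ideal_pow_mono[OF sub, of "Suc n"] by (intro set_plus_intro) blast+
      have "x * r - x * (y + b) \<in> Y + ideal_pow ?J (Suc n)"
        by (rule ideal_diff[OF idn r ideal_mult_left[OF idn yb]])
      then have "w * (x * a) \<in> Y + ideal_pow ?J (Suc n)" using y(1) by (simp add: algebra_simps del: ideal_pow.simps)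
      then have "x * a \<in> Y + ideal_pow ?J n" by (rule colon_pow_aux[OF Y nw])
      then have "a \<in> Y + ideal_pow ?J n" by (rule nzdD[OF Suc])
      then obtain y' c where c: "a = y' + c" "y' \<in> Y" "c \<in> ideal_pow ?J n" by (rule set_plus_elim)
      have "w \<in> ?J" using ig_incl[of "w # ws"] by simp
      then have "w * c \<in> ideal_pow ?J (Suc n)" using c(3) unfolding ideal_pow.simps by (rule ideal_mult_mem)
      then have "y' * w + w * c \<in> Y + ideal_pow ?J (Suc n)" using ideal_mult_right[OF Y c(2)] by (intro set_plus_intro)
      then have "(y + b) + (y' * w + w * c) \<in> Y + ideal_pow ?J (Suc n)" by (rule ideal_add[OF idn yb])
      moreover have "r = (y + b) + (y' * w + w * c)" using y(1) c(1) by (simp add: algebra_simps)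
      ultimately show "r \<in> Y + ideal_pow ?J (Suc n)" by simp
    qed
  qed
qed

text \<open>The colon by \<open>x\<close> lowers the exponent by one, adding \<open>x\<close>
  removes it from the sequence, and the two lengths combine by Pascal's rule. At exponent
  \<open>Suc n\<close> the degrees 0 to \<open>n\<close> contribute.\<close>

lemma elen_ideal_pow:
  assumes "ideal Y" "set xs \<subseteq> m" "regseq Y xs"
  shows "elen ideal (Y + ideal_pow (ig xs) (Suc n)) UNIV
    = enat ((n + length xs) choose length xs) * elen ideal (Y + ig xs) UNIV"
  using assms
proof (induction xs arbitrary: Y n)
  case Nil
  then show ?case by (simp add: ideal_pow_zero one_enat_def[symmetric] del: ideal_pow.simps flip: One_nat_def)
next
  case (Cons x xs)
  note Y = Cons.prems(1)
  let ?J = "ig (x # xs)" and ?d = "length xs"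
  let ?L = "elen ideal (Y + ?J) UNIV"
  have Yx: "ideal (Y + prin x)" using Y by (simp add: ideal_plus)
  have rot: "regseq Y xs" "nzd (Y + ig xs) x"
    using regseq_rotate[OF Y Cons.prems(2)] Cons.prems(3) regseq_snoc by auto
  have nx: "nzd (Y + ideal_pow (ig xs) k) x" for k
    by (rule nzd_ideal_pow[OF Y _ rot]) (use Cons.prems in auto)
  show ?case
  proof (induction n)
    case 0
    have "ideal_pow ?J (Suc 0) = ?J" by (rule ideal_pow_1[OF ideal_ig])
    then show ?case by (simp only: add_0 binomial_n_n one_enat_def[symmetric] mult_1)
  next
    case (Suc n)
    let ?A = "Y + ideal_pow ?J (Suc (Suc n))"
    have idA: "ideal ?A" using Y by (intro ideal_plus ideal_pow_ideal)
    have col: "{r. r * x \<in> ?A} = Y + ideal_pow ?J (Suc n)"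
    proof
      show "{r. r * x \<in> ?A} \<subseteq> Y + ideal_pow ?J (Suc n)"
        using colon_pow_aux[OF Y nx] by (auto simp: mult.commute simp del: ideal_pow.simps ig.simps)
      have xJ: "x \<in> ?J" using ig_incl[of "x # xs"] by simp
      show "Y + ideal_pow ?J (Suc n) \<subseteq> {r. r * x \<in> ?A}"
      proof
        fix r assume "r \<in> Y + ideal_pow ?J (Suc n)"
        then obtain y c where c: "r = y + c" "y \<in> Y" "c \<in> ideal_pow ?J (Suc n)" by (rule set_plus_elim)
        have "x * c \<in> ideal_pow ?J (Suc (Suc n))"
          using xJ c(3) unfolding ideal_pow.simps(2)[of _ "Suc n"] by (rule ideal_mult_mem)
        then have "y * x + x * c \<in> ?A" using ideal_mult_right[OF Y c(2)] by (intro set_plus_intro)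
        then show "r \<in> {r. r * x \<in> ?A}" using c(1) by (simp add: algebra_simps del: ideal_pow.simps ig.simps)
      qed
    qed
    have Ax: "?A + prin x = Y + prin x + ideal_pow (ig xs) (Suc (Suc n))"
    proof
      have "ideal_pow ?J (Suc (Suc n)) \<subseteq> (\<lambda>a. a * x) ` ideal_pow ?J (Suc n) + ideal_pow (ig xs) (Suc (Suc n))"
        using ideal_pow_plus_subset[OF ideal_ig, of x xs "Suc n"] by (simp del: ideal_pow.simps)
      also have "\<dots> \<subseteq> prin x + ideal_pow (ig xs) (Suc (Suc n))" by (intro set_plus_mono2 subset_refl) auto
      finally have s: "ideal_pow ?J (Suc (Suc n)) \<subseteq> prin x + ideal_pow (ig xs) (Suc (Suc n))" .
      have id: "ideal (Y + prin x + ideal_pow (ig xs) (Suc (Suc n)))" by (rule ideal_plus[OF Yx ideal_pow_ideal])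
      have "Y \<subseteq> Y + (prin x + ideal_pow (ig xs) (Suc (Suc n)))"
        by (intro plus_left_incl ideal_plus ideal_pow_ideal) simp
      moreover have "prin x + ideal_pow (ig xs) (Suc (Suc n)) \<subseteq> Y + (prin x + ideal_pow (ig xs) (Suc (Suc n)))"
        by (rule plus_right_incl[OF Y])
      moreover have "prin x \<subseteq> prin x + ideal_pow (ig xs) (Suc (Suc n))" by (rule plus_left_incl[OF ideal_pow_ideal])
      ultimately show "?A + prin x \<subseteq> Y + prin x + ideal_pow (ig xs) (Suc (Suc n))"
        using s id unfolding add.assoc[of Y "prin x"] by (intro plus_least) auto
      have "ideal_pow (ig xs) (Suc (Suc n)) \<subseteq> ideal_pow ?J (Suc (Suc n))"
        by (rule ideal_pow_mono) (simp add: plus_right_incl)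
      then have "Y + prin x + ideal_pow (ig xs) (Suc (Suc n)) \<subseteq> Y + prin x + ideal_pow ?J (Suc (Suc n))"
        by (intro set_plus_mono2 subset_refl)
      then show "Y + prin x + ideal_pow (ig xs) (Suc (Suc n)) \<subseteq> ?A + prin x"
        by (simp only: ac_simps)
    qed
    have "elen ideal ?A UNIV = elen ideal ?A (?A + prin x) + elen ideal (?A + prin x) UNIV"
      by (intro IL.elen_add ideal_plus[OF idA] plus_left_incl idA) auto
    also have "elen ideal ?A (?A + prin x) = enat ((n + Suc ?d) choose Suc ?d) * ?L"
      unfolding elen_prin[OF idA] col using Suc by (simp del: ideal_pow.simps ig.simps)
    also have "elen ideal (?A + prin x) UNIV = enat ((Suc n + ?d) choose ?d) * ?L"
      unfolding Ax using Cons.IH[OF Yx, of "Suc n"] Cons.prems by (simp add: add.assoc del: ideal_pow.simps)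
    also have "enat ((n + Suc ?d) choose Suc ?d) * ?L + enat ((Suc n + ?d) choose ?d) * ?L
        = enat (((n + Suc ?d) choose Suc ?d) + ((Suc n + ?d) choose ?d)) * ?L"
      by (simp add: distrib_right plus_enat_simps(1)[symmetric] del: plus_enat_simps binomial_Suc_Suc)
    also have "((n + Suc ?d) choose Suc ?d) + ((Suc n + ?d) choose ?d) = (Suc n + Suc ?d) choose Suc ?d"
      by simp
    finally show ?case by (simp del: ideal_pow.simps ig.simps binomial_Suc_Suc)
  qed
qed

end

text \<open>The integral equation trades \<open>a ^ n\<close> for lower powers of \<open>a\<close>
  with coefficients in matching powers of \<open>J\<close>. Subtraction is truncated, so the claim
  is trivial for small \<open>j\<close>.\<close>

lemma integral_power_mem:
  assumes "integral_over_ideal J a"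
  shows "\<exists>N. \<forall>j. a ^ j \<in> ideal_pow J (j - N)"
proof -
  obtain n c where n: "n \<ge> 1" "\<And>i. i \<in> {1..n} \<Longrightarrow> c i \<in> ideal_pow J i"
    "a ^ n + (\<Sum>i=1..n. c i * a ^ (n - i)) = 0"
    using assms unfolding integral_over_ideal_def by blast
  have "a ^ j \<in> ideal_pow J (j - n)" for j
  proof (induction j rule: less_induct)
    case (less j)
    show ?case
    proof (cases "j < n")
      case False
      have an: "a ^ n = - (\<Sum>i=1..n. c i * a ^ (n - i))" using n(3) by (simp add: eq_neg_iff_add_eq_0)
      have "a ^ j = a ^ (j - n) * a ^ n" using False by (simp add: power_add[symmetric])
      also have "\<dots> = - (\<Sum>i=1..n. c i * (a ^ (j - n) * a ^ (n - i)))"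
        unfolding an by (simp add: sum_distrib_left mult.left_commute)
      also have "\<dots> = - (\<Sum>i=1..n. c i * a ^ (j - i))"
        using False by (simp add: power_add[symmetric])
      also have "\<dots> \<in> ideal_pow J (j - n)"
      proof (intro ideal_uminus ideal_sum ideal_pow_ideal)
        fix i assume i: "i \<in> {1..n}"
        have "c i * a ^ (j - i) \<in> ideal_pow J (i + (j - i - n))"
          using n(2)[OF i] less[of "j - i"] i False by (intro ideal_pow_mult_mem) auto
        moreover have "j - n \<le> i + (j - i - n)" by simp
        ultimately show "c i * a ^ (j - i) \<in> ideal_pow J (j - n)" using ideal_pow_antimono by blast
      qed
      finally show ?thesis .
    qed simp
  qed
  then show ?thesis by blast
qed

text \<open>For finitely many generators the delays add up to a constant, so the powers of the
  larger ideal lag behind those of \<open>J\<close> by a bounded amount.\<close>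

lemma integral_ideal_pow_subset:
  assumes "\<And>a. a \<in> set as \<Longrightarrow> integral_over_ideal J a"
  shows "\<exists>c. \<forall>n. ideal_pow (ig as) (n + c) \<subseteq> ideal_pow J n"
  using assms
proof (induction as)
  case Nil
  then show ?case
    by (intro exI[of _ 1]) (simp add: ideal_pow_zero ideal_0[OF ideal_pow_ideal] del: ideal_pow.simps)
next
  case (Cons a as)
  obtain c where c: "\<And>n. ideal_pow (ig as) (n + c) \<subseteq> ideal_pow J n" using Cons by auto
  obtain N where N: "\<And>j. a ^ j \<in> ideal_pow J (j - N)" using integral_power_mem Cons.prems by force
  have K: "ideal_pow (ig as) T \<subseteq> ideal_pow J (T - c)" for T
    using c[of "T - c"] by (cases "c \<le> T") auto
  \<comment> \<open>The extra factor \<open>a ^ k\<close> makes the induction work: each step either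
    converts one factor of the ideal into \<open>a\<close>, or leaves factors from the other
    generators only.\<close>
  have *: "x * a ^ k \<in> ideal_pow J (T + k - (c + N))" if "x \<in> ideal_pow (ig (a # as)) T" for x T k
    using that
  proof (induction T arbitrary: x k)
    case 0
    have "x * a ^ k \<in> ideal_pow J (k - N)" using N by (intro ideal_mult_left ideal_pow_ideal)
    moreover have "0 + k - (c + N) \<le> k - N" by simp
    ultimately show ?case using ideal_pow_antimono by blast
  next
    case (Suc T)
    obtain y z where yz: "x = y * a + z" "y \<in> ideal_pow (ig (a # as)) T" "z \<in> ideal_pow (ig as) (Suc T)"
      using Suc.prems ideal_pow_plus_subset[OF ideal_ig, of a as T]
      by (auto elim!: set_plus_elim dest!: subsetD simp del: ideal_pow.simps)
    have "y * a ^ Suc k \<in> ideal_pow J (Suc T + k - (c + N))" using Suc.IH[OF yz(2), of "Suc k"] by simp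
    moreover have "z * a ^ k \<in> ideal_pow J (Suc T + k - (c + N))"
    proof -
      have "z * a ^ k \<in> ideal_pow J ((Suc T - c) + (k - N))"
        using yz(3) K N by (intro ideal_pow_mult_mem) blast+
      moreover have "Suc T + k - (c + N) \<le> (Suc T - c) + (k - N)" by simp
      ultimately show ?thesis using ideal_pow_antimono by blast
    qed
    ultimately have "y * a ^ Suc k + z * a ^ k \<in> ideal_pow J (Suc T + k - (c + N))"
      by (intro ideal_add ideal_pow_ideal)
    then show ?case using yz(1) by (simp add: algebra_simps)
  qed
  have "ideal_pow (ig (a # as)) (n + (c + N)) \<subseteq> ideal_pow J n" for n
    using *[of _ "n + (c + N)" 0] by auto
  then show ?case by blast
qed

text \<open>The shifts \<open>a\<close> and \<open>b\<close> absorb the bounded delay between powers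
  of \<open>m\<close> and of \<open>J\<close>; \<open>Suc b\<close> keeps the denominator
  positive.\<close>

lemma binomial_ratio_tendsto:
  "(\<lambda>n. fact d * real ((n + a + d) choose d) / real (n + Suc b) ^ d) \<longlonglongrightarrow> 1"
proof (induction d)
  case (Suc d)
  have 1: "(\<lambda>n. real (n + a + Suc d) / real (n + Suc b)) \<longlonglongrightarrow> 1"
  proof -
    have "(\<lambda>n. (real a + real d - real b) / real (n + Suc b)) \<longlonglongrightarrow> 0"
      by (intro tendsto_divide_0[OF tendsto_const] filterlim_at_top_imp_at_infinity
          filterlim_compose[OF filterlim_real_sequentially] filterlim_add_const_nat_at_top)
    then have "(\<lambda>n. 1 + (real a + real d - real b) / real (n + Suc b)) \<longlonglongrightarrow> 1 + 0" by (intro tendsto_intros)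
    moreover have "1 + (real a + real d - real b) / real (n + Suc b) = real (n + a + Suc d) / real (n + Suc b)" for n
      by (simp add: field_simps)
    ultimately show ?thesis by simp
  qed
  have "fact (Suc d) * real ((n + a + Suc d) choose Suc d) / real (n + Suc b) ^ Suc d
      = (fact d * real ((n + a + d) choose d) / real (n + Suc b) ^ d) * (real (n + a + Suc d) / real (n + Suc b))" for n
  proof -
    have "real (Suc d) * real ((n + a + Suc d) choose Suc d) = real (n + a + Suc d) * real ((n + a + d) choose d)"
      using Suc_times_binomial_eq[of "n + a + d" d] by (metis add_Suc_right mult.commute of_nat_mult)
    then have "fact (Suc d) * real ((n + a + Suc d) choose Suc d) = fact d * (real (n + a + Suc d) * real ((n + a + d) choose d))"
      by (simp only: fact_Suc of_nat_mult mult.assoc mult.left_commute[of _ "fact d"])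
    then show ?thesis by (simp only: power_Suc times_divide_times_eq ac_simps)
  qed
  then show ?case using tendsto_mult[OF Suc 1] by simp
qed simp

section \<open>Frobenius powers of ideals\<close>

context frob_local
begin

lemma frob_pow_root_ideal: "frobq q \<Longrightarrow> ideal K \<Longrightarrow> ideal {r. r ^ q \<in> K}" for K :: "'a set"
  using ideal_twisted_colon[OF _ ideal_submod, of q K 1] by simp

lemma frob_pow_plus:
  fixes I J :: "'a set"
  assumes q: "frobq q" and I: "ideal I" and J: "ideal J"
  shows "frob_pow (I + J) q = frob_pow I q + frob_pow J q"
proof
  have id: "ideal (frob_pow I q + frob_pow J q)" by (intro ideal_plus frob_pow_ideal)
  show "frob_pow (I + J) q \<subseteq> frob_pow I q + frob_pow J q"
  proof (rule frob_pow_least[OF id])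
    fix a assume "a \<in> I + J"
    then obtain x y where "a = x + y" "x \<in> I" "y \<in> J" by (rule set_plus_elim)
    then show "a ^ q \<in> frob_pow I q + frob_pow J q" by (simp add: frob_add[OF q] set_plus_intro frob_pow_mem)
  qed
  show "frob_pow I q + frob_pow J q \<subseteq> frob_pow (I + J) q"
    by (intro plus_least frob_pow_ideal frob_pow_mono plus_left_incl[OF J] plus_right_incl[OF I])
qed

lemma frob_pow_prin:
  fixes a :: 'a
  assumes "frobq q"
  shows "frob_pow (prin a) q = prin (a ^ q)"
proof
  show "frob_pow (prin a) q \<subseteq> prin (a ^ q)"
  proof (rule frob_pow_least)
    fix b assume "b \<in> prin a"
    then obtain r where "b = r * a" unfolding prin_def by blast
    then show "b ^ q \<in> prin (a ^ q)" by (simp add: power_mult_distrib)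
  qed simp
  show "prin (a ^ q) \<subseteq> frob_pow (prin a) q"
    by (simp add: prin_subset frob_pow_ideal frob_pow_mem)
qed

lemma frob_pow_zero: "frobq q \<Longrightarrow> frob_pow {0 :: 'a} q = {0}"
  using frob_pow_prin[of q 0] by (simp add: frob_zero)

lemma frob_pow_ig: "frobq q \<Longrightarrow> frob_pow (ig (xs :: 'a list)) q = ig (map (\<lambda>x. x ^ q) xs)"
  by (induction xs) (auto simp: frob_pow_zero frob_pow_plus frob_pow_prin)

lemma frob_pow_power_mem:
  fixes K :: "'a set"
  assumes "frobq q'" "r \<in> frob_pow K q"
  shows "r ^ q' \<in> frob_pow K (q * q')"
proof -
  have "frob_pow K q \<subseteq> {r. r ^ q' \<in> frob_pow K (q * q')}"
    by (intro frob_pow_least frob_pow_root_ideal assms frob_pow_ideal)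
      (auto simp: power_mult[symmetric] intro: frob_pow_mem)
  then show ?thesis using assms by blast
qed

lemma mprim_frob:
  assumes "mprim K" "frobq q"
  shows "mprim (frob_pow K q)"
  unfolding mprim_def
proof (intro conjI ballI frob_pow_ideal)
  fix a assume "a \<in> m"
  then obtain n where "a ^ n \<in> K" using assms(1) unfolding mprim_def by blast
  then have "(a ^ n) ^ q \<in> frob_pow K q" by (rule frob_pow_mem)
  then show "\<exists>n. a ^ n \<in> frob_pow K q" by (metis power_mult)
qed

lemma mprim_m: "mprim m"
  unfolding mprim_def by (auto intro: exI[of _ 1])

lemma qspan_sum:
  fixes ss :: "'a list"
  assumes q: "frobq q" and "x \<in> qspan q ss"
  shows "\<exists>d. x = (\<Sum>y\<in>set ss. d y ^ q * y)"
proof -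
  let ?W = "{x. \<exists>d. x = (\<Sum>y\<in>set ss. d y ^ q * y)}"
  have W: "submod q ?W"
    unfolding submod_def
  proof (intro conjI ballI allI impI)
    show "0 \<in> ?W" by (intro CollectI exI[of _ "\<lambda>_. 0"]) (simp add: frob_zero[OF q])
  next
    fix x y assume "x \<in> ?W" "y \<in> ?W"
    then obtain d e where "x = (\<Sum>y\<in>set ss. d y ^ q * y)" "y = (\<Sum>y\<in>set ss. e y ^ q * y)" by blast
    then have "x + y = (\<Sum>y\<in>set ss. (\<lambda>y. d y + e y) y ^ q * y)"
      by (simp add: frob_add[OF q] distrib_right sum.distrib)
    then have "\<exists>d. x + y = (\<Sum>y\<in>set ss. d y ^ q * y)" by (intro exI[of _ "\<lambda>y. d y + e y"])
    then show "x + y \<in> ?W" by simp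
  next
    fix r x assume "x \<in> ?W"
    then obtain d where "x = (\<Sum>y\<in>set ss. d y ^ q * y)" by blast
    then have "r ^ q * x = (\<Sum>y\<in>set ss. (\<lambda>y. r * d y) y ^ q * y)"
      by (simp add: power_mult_distrib mult.assoc sum_distrib_left)
    then have "\<exists>d. r ^ q * x = (\<Sum>y\<in>set ss. d y ^ q * y)" by (intro exI[of _ "\<lambda>y. r * d y"])
    then show "r ^ q * x \<in> ?W" by simp
  qed
  have "s \<in> ?W" if "s \<in> set ss" for s
  proof -
    have "(\<Sum>y\<in>set ss. (if y = s then 1 else 0) ^ q * y) = (\<Sum>y\<in>set ss. if y = s then y else 0)"
      by (rule sum.cong) (auto simp: frob_zero[OF q])
    also have "\<dots> = s" using that by simp
    finally show ?thesis by (intro CollectI exI[of _ "\<lambda>y. if y = s then 1 else 0"]) simp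
  qed
  then have "qspan q ss \<subseteq> ?W" by (intro qspan_subset[OF W]) blast
  then show ?thesis using assms(2) by blast
qed

lemma submod_sum: "submod q S \<Longrightarrow> (\<And>i. i \<in> A \<Longrightarrow> f i \<in> S) \<Longrightarrow> sum f A \<in> S"
  by (induction A rule: infinite_finite_induct) (auto intro: submod_0 submod_add)

lemma submod_vimage: "submod q W \<Longrightarrow> submod q {r. c * r \<in> W}" for c :: 'a
  unfolding submod_def by (auto simp: distrib_left) (metis mult.left_commute)

end

section \<open>Generators of iterated Frobenius pushforwards\<close>

locale frob_finite = frob_local_inf +
  assumes F_fin: "F_finite p TYPE('a)"
begin

text \<open>If the \<open>s\<close> generate over \<open>p\<close>-th powers and the
  \<open>t\<close> over \<open>p ^ e\<close>-th powers, then the products \<open>t ^ p * s\<close>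
  generate over \<open>p ^ Suc e\<close>-th powers.\<close>

lemma finite_gens:
  assumes "frobq q"
  obtains ss :: "'a list" where "UNIV = qspan q ss"
proof -
  obtain S :: "'a set" where S: "finite S" "\<And>r. \<exists>c. r = (\<Sum>s\<in>S. c s ^ p * s)"
    using F_fin unfolding F_finite_def by blast
  obtain sl where sl: "set sl = S" using S(1) finite_list by blast
  have "\<exists>ss :: 'a list. UNIV = qspan (p ^ e) ss" for e
  proof (induction e)
    case 0
    have "UNIV = qspan (Suc 0) [1 :: 'a]" by (simp add: cyc_one)
    then show ?case by (metis power_0 One_nat_def)
  next
    case (Suc e)
    then obtain ss :: "'a list" where ss: "UNIV = qspan (p ^ e) ss" by blast
    let ?l = "[t ^ p * s. s \<leftarrow> sl, t \<leftarrow> ss]"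
    let ?W = "qspan (p ^ Suc e) ?l"
    have W: "submod (p ^ Suc e) ?W" by (rule submod_qspan[OF frobq_power])
    have lW: "set ?l \<subseteq> ?W" by (rule qspan_incl[OF frobq_power])
    have "c ^ p * s \<in> ?W" if s: "s \<in> S" for c s
    proof -
      have "submod (p ^ e) {c. c ^ p * s \<in> ?W}"
        unfolding submod_def
      proof (intro conjI ballI allI impI)
        show "0 \<in> {c. c ^ p * s \<in> ?W}" using submod_0[OF W] frob_zero[OF frobq_p] by simp
      next
        fix x y assume "x \<in> {c. c ^ p * s \<in> ?W}" "y \<in> {c. c ^ p * s \<in> ?W}"
        then show "x + y \<in> {c. c ^ p * s \<in> ?W}"
          using submod_add[OF W, of "x ^ p * s" "y ^ p * s"] by (simp add: frob_add distrib_right)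
      next
        fix r x assume "x \<in> {c. c ^ p * s \<in> ?W}"
        then have "r ^ (p ^ Suc e) * (x ^ p * s) \<in> ?W" using submod_scale[OF W] by blast
        then show "r ^ (p ^ e) * x \<in> {c. c ^ p * s \<in> ?W}"
          by (simp add: power_mult_distrib power_mult[symmetric] mult.assoc mult.commute[of p])
      qed
      moreover have "set ss \<subseteq> {c. c ^ p * s \<in> ?W}" using lW s sl by auto
      ultimately have "qspan (p ^ e) ss \<subseteq> {c. c ^ p * s \<in> ?W}" by (rule qspan_subset)
      then show ?thesis using ss by blast
    qed
    then have "r \<in> ?W" for r
    proof -
      obtain c where c: "r = (\<Sum>s\<in>S. c s ^ p * s)" using S(2) by blast
      show ?thesis unfolding c by (rule submod_sum[OF W]) fact
    qed
    then show ?case by (intro exI[of _ ?l]) blast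
  qed
  then show ?thesis using assms that by (auto simp: frobq_def)
qed

text \<open>Inside F_*R the submodule generated by \<open>m\<close> is the ideal m^[q], so Nakayama
  lifts generators modulo m^[q]. The finite generating set it starts from comes from
  F-finiteness.\<close>

lemma nakayama_gens:
  fixes bs :: "'a list"
  assumes q: "frobq q" and "UNIV = frob_pow m q + qspan q bs"
  shows "UNIV = qspan q bs"
proof -
  obtain ss :: "'a list" where ss: "UNIV = qspan q ss" using finite_gens[OF q] .
  have rep: "\<exists>d. x = (\<Sum>y\<in>set ss. d y ^ q * y)" for x using qspan_sum[OF q, of x ss] ss by blast
  \<comment> \<open>The submodule generated by \<open>m\<close>, written in coefficients. That it
    contains m^[q] is seen through the largest ideal inside it.\<close>
  let ?V = "{w. \<exists>c. (\<forall>y\<in>set ss. c y \<in> m) \<and> w = (\<Sum>y\<in>set ss. c y ^ q * y)}"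
  have V0: "0 \<in> ?V" by (intro CollectI exI[of _ "\<lambda>_. 0"]) (simp add: frob_zero[OF q] ideal_0)
  have Vadd: "v + w \<in> ?V" if vw: "v \<in> ?V" "w \<in> ?V" for v w
  proof -
    obtain c c' where c: "\<forall>y\<in>set ss. c y \<in> m" "v = (\<Sum>y\<in>set ss. c y ^ q * y)"
      and c': "\<forall>y\<in>set ss. c' y \<in> m" "w = (\<Sum>y\<in>set ss. c' y ^ q * y)" using vw by blast
    have "v + w = (\<Sum>y\<in>set ss. (c y + c' y) ^ q * y)"
      unfolding c(2) c'(2) by (simp add: frob_add[OF q] distrib_right sum.distrib)
    moreover have "\<forall>y\<in>set ss. c y + c' y \<in> m" using c(1) c'(1) ideal_add[OF m_ideal] by blast
    ultimately show ?thesis by (intro CollectI exI[of _ "\<lambda>y. c y + c' y"] conjI)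
  qed
  have aV: "a ^ q * r \<in> ?V" if a: "a \<in> m" for a r
  proof -
    obtain d where d: "r = (\<Sum>y\<in>set ss. d y ^ q * y)" using rep by blast
    have "a ^ q * r = (\<Sum>y\<in>set ss. (a * d y) ^ q * y)"
      unfolding d by (simp add: power_mult_distrib mult.assoc sum_distrib_left)
    moreover have "\<forall>y\<in>set ss. a * d y \<in> m" using ideal_mult_right[OF m_ideal a] by blast
    ultimately show ?thesis by (intro CollectI exI[of _ "\<lambda>y. a * d y"] conjI)
  qed
  have "ideal {w. \<forall>r. r * w \<in> ?V}"
    unfolding ideal_def
  proof (intro conjI ballI allI impI)
    show "0 \<in> {w. \<forall>r. r * w \<in> ?V}" using V0 by simp
  next
    fix x y assume "x \<in> {w. \<forall>r. r * w \<in> ?V}" "y \<in> {w. \<forall>r. r * w \<in> ?V}"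
    then have "r * x + r * y \<in> ?V" for r by (intro Vadd) blast+
    then show "x + y \<in> {w. \<forall>r. r * w \<in> ?V}" by (simp add: distrib_left)
  next
    fix s x assume "x \<in> {w. \<forall>r. r * w \<in> ?V}"
    then have "(r * s) * x \<in> ?V" for r by blast
    then show "s * x \<in> {w. \<forall>r. r * w \<in> ?V}" by (simp add: mult.assoc)
  qed
  then have "frob_pow m q \<subseteq> {w. \<forall>r. r * w \<in> ?V}"
    using aV by (intro frob_pow_least) (auto simp: mult.commute)
  then have FV: "w \<in> ?V" if "w \<in> frob_pow m q" for w
    using that by (metis (no_types, lifting) mem_Collect_eq mult_1 subsetD)
  interpret M: module "\<lambda>r x :: 'a. r ^ q * x"
    by standard (simp_all add: frob_add[OF q] distrib_left distrib_right power_mult_distrib mult.assoc)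
  have sub: "M.subspace (qspan q bs)"
    unfolding M.subspace_def using submod_qspan[OF q, of bs] by (simp add: submod_def)
  have "set ss \<subseteq> qspan q bs"
  proof (rule nakayama[OF M.module_axioms sub finite_set], intro ballI)
    fix x assume "x \<in> set ss"
    have "x \<in> frob_pow m q + qspan q bs" using assms(2) by blast
    then obtain w n where wn: "x = w + n" "w \<in> frob_pow m q" "n \<in> qspan q bs" by (rule set_plus_elim)
    obtain c where "\<forall>y\<in>set ss. c y \<in> m" "w = (\<Sum>y\<in>set ss. c y ^ q * y)" using FV[OF wn(2)] by blast
    then show "\<exists>c. (\<forall>y\<in>set ss. c y \<in> m) \<and> x - (\<Sum>y\<in>set ss. c y ^ q * y) \<in> qspan q bs"
      using wn by (intro exI[of _ c]) simp
  qed
  then have "qspan q ss \<subseteq> qspan q bs" by (rule qspan_subset[OF submod_qspan[OF q]])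
  then show ?thesis using ss by blast
qed

lemma gens_colength:
  assumes "frobq q" "elen ideal (frob_pow m q) UNIV = enat h"
  obtains bs :: "'a list" where "length bs = h" "UNIV = qspan q bs"
  using finite_len_qspan[OF assms(1) frob_pow_ideal ideal_UNIV subset_UNIV assms(2)]
    nakayama_gens[OF assms(1)] by metis

section \<open>Generic rank of the Frobenius\<close>

text \<open>Linear independence over the domain R/P of the classes of the \<open>f i\<close> in the
  Frobenius pushforward of R/P.\<close>

definition indep :: "nat \<Rightarrow> 'a set \<Rightarrow> 'i set \<Rightarrow> ('i \<Rightarrow> 'a) \<Rightarrow> bool" where
  "indep q P I f \<longleftrightarrow> (\<forall>c. (\<Sum>i\<in>I. c i ^ q * f i) \<in> P \<longrightarrow> (\<forall>i\<in>I. c i \<in> P))"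

text \<open>Gaussian elimination over the domain R/P, by cross-multiplication with a pivot and
  without passing to the fraction field.\<close>

lemma prime_linear_dependence:
  fixes a :: "'i \<Rightarrow> 'k \<Rightarrow> 'a"
  assumes P: "prime_ideal P" and "finite K" "finite I" "card K < card I"
  shows "\<exists>r. (\<forall>k\<in>K. (\<Sum>i\<in>I. r i * a i k) \<in> P) \<and> (\<exists>i\<in>I. r i \<notin> P)"
  using assms(2-)
proof (induction K arbitrary: I a rule: finite_induct)
  case empty
  then obtain i where "i \<in> I" by fastforce
  moreover have "1 \<notin> P" using P ideal_eq_UNIV unfolding prime_ideal_def by blast
  ultimately show ?case by (intro exI[of _ "\<lambda>_. 1"]) auto
next
  case (insert k K)
  have id: "ideal P" and pr: "\<And>x y. x * y \<in> P \<Longrightarrow> x \<in> P \<or> y \<in> P" using P by (auto simp: prime_ideal_def)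
  show ?case
  proof (cases "\<forall>i\<in>I. a i k \<in> P")
    case True
    obtain r where r: "\<forall>k\<in>K. (\<Sum>i\<in>I. r i * a i k) \<in> P" "\<exists>i\<in>I. r i \<notin> P"
      using insert.IH[of I a] insert.prems insert.hyps by auto
    have "(\<Sum>i\<in>I. r i * a i k) \<in> P" using True by (intro ideal_sum[OF id] ideal_mult_left[OF id]) blast
    then show ?thesis using r by (intro exI[of _ r]) blast
  next
    case False
    then obtain i0 where i0: "i0 \<in> I" "a i0 k \<notin> P" by blast
    let ?I = "I - {i0}"
    define a' where "a' i k' = a i0 k * a i k' - a i k * a i0 k'" for i k'
    have "card K < card ?I" using insert.prems insert.hyps i0 by simp
    then obtain r where r: "\<And>k. k \<in> K \<Longrightarrow> (\<Sum>i\<in>?I. r i * a' i k) \<in> P" "\<exists>i\<in>?I. r i \<notin> P"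
      using insert.IH[of ?I a'] insert.prems by auto
    \<comment> \<open>Back substitution: the factor \<open>a i0 k\<close> is outside the prime
      \<open>P\<close>, so a coefficient outside \<open>P\<close> stays outside.\<close>
    define R where "R i = (if i = i0 then - (\<Sum>i\<in>?I. r i * a i k) else a i0 k * r i)" for i
    have S: "(\<Sum>i\<in>I. R i * a i k') = (\<Sum>i\<in>?I. r i * a' i k')" for k'
    proof -
      have "(\<Sum>i\<in>I. R i * a i k') = R i0 * a i0 k' + (\<Sum>i\<in>?I. R i * a i k')"
        using i0 insert.prems by (intro sum.remove) auto
      also have "(\<Sum>i\<in>?I. R i * a i k') = (\<Sum>i\<in>?I. a i0 k * r i * a i k')"
        by (rule sum.cong) (auto simp: R_def)
      also have "R i0 * a i0 k' = - (\<Sum>i\<in>?I. r i * a i k * a i0 k')" by (simp add: R_def sum_distrib_right)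
      finally show ?thesis
        unfolding a'_def by (simp add: algebra_simps sum_subtractf)
    qed
    have "(\<Sum>i\<in>?I. r i * a' i k) = 0" by (simp add: a'_def mult.commute)
    then have "\<forall>k'\<in>insert k K. (\<Sum>i\<in>I. R i * a i k') \<in> P" using S r(1) ideal_0[OF id] by auto
    moreover obtain i where "i \<in> ?I" "r i \<notin> P" using r(2) by blast
    then have "R i \<notin> P" "i \<in> I" using pr i0 by (auto simp: R_def)
    ultimately show ?thesis by blast
  qed
qed

lemma indep_card_le:
  fixes bs :: "'a list"
  assumes P: "prime_ideal P" and q: "frobq q" and "finite I" "indep q P I f" and bs: "UNIV = qspan q bs"
  shows "card I \<le> length bs"
proof (rule ccontr)
  assume "\<not> card I \<le> length bs"
  then have lt: "card (set bs) < card I" using card_length[of bs] by linarith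
  have id: "ideal P" using P by (simp add: prime_ideal_def)
  have "\<forall>i. \<exists>d. f i = (\<Sum>y\<in>set bs. d y ^ q * y)" using qspan_sum[OF q, of _ bs] bs by blast
  then obtain a where a: "\<And>i. f i = (\<Sum>y\<in>set bs. a i y ^ q * y)" by metis
  obtain r where r: "\<And>k. k \<in> set bs \<Longrightarrow> (\<Sum>i\<in>I. r i * a i k) \<in> P" "\<exists>i\<in>I. r i \<notin> P"
    using prime_linear_dependence[OF P finite_set assms(3) lt, of a] by blast
  have "(\<Sum>i\<in>I. r i ^ q * f i) = (\<Sum>i\<in>I. \<Sum>y\<in>set bs. (r i * a i y) ^ q * y)"
    by (simp add: a sum_distrib_left power_mult_distrib mult.assoc)
  also have "\<dots> = (\<Sum>y\<in>set bs. (\<Sum>i\<in>I. r i * a i y) ^ q * y)"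
    by (subst sum.swap) (simp add: frob_sum[OF q] sum_distrib_right)
  also have "\<dots> \<in> P"
  proof (intro ideal_sum[OF id] ideal_mult_right[OF id])
    fix y assume "y \<in> set bs"
    then show "(\<Sum>i\<in>I. r i * a i y) ^ q \<in> P"
      using ideal_pow_mem[OF id, of _ 1 q] r(1) frobq_pos[OF q] by simp
  qed
  finally show False using assms(4) r(2) unfolding indep_def by blast
qed

text \<open>A word \<open>[i, j, k]\<close> stands for \<open>f i * f j ^ p * f k ^ (p ^ 2)\<close>:
  the usual product basis in a tower of Frobenius extensions.\<close>

fun word_prod :: "(nat \<Rightarrow> 'a) \<Rightarrow> nat list \<Rightarrow> 'a" where
  "word_prod f [] = 1"
| "word_prod f (i # is) = f i * word_prod f is ^ p"

text \<open>Multiplicativity of degrees in a tower: grouping words by their first letter turns a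
  relation into one among the \<open>f i\<close> over \<open>p\<close>-th powers, whose coefficients
  are relations among shorter words.\<close>

lemma indep_words:
  assumes "indep p P {..<n} f"
  shows "indep (p ^ e) P {is. set is \<subseteq> {..<n} \<and> length is = e} (word_prod f)"
proof (induction e)
  case 0
  have "{is. set is \<subseteq> {..<n} \<and> length is = 0} = {[]}" by auto
  then show ?case unfolding indep_def by simp
next
  case (Suc e)
  let ?L = "\<lambda>e. {is. set is \<subseteq> {..<n} \<and> length is = e}"
  show ?case
    unfolding indep_def
  proof (intro allI impI)
    fix c assume c: "(\<Sum>is\<in>?L (Suc e). c is ^ p ^ Suc e * word_prod f is) \<in> P"
    have img: "?L (Suc e) = (\<lambda>(i, is). i # is) ` ({..<n} \<times> ?L e)"
      by (auto simp: length_Suc_conv image_iff)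
    have "(\<Sum>is\<in>?L (Suc e). c is ^ p ^ Suc e * word_prod f is)
        = (\<Sum>(i, is)\<in>{..<n} \<times> ?L e. c (i # is) ^ p ^ Suc e * word_prod f (i # is))"
      unfolding img by (subst sum.reindex) (auto simp: inj_on_def case_prod_unfold o_def)
    also have "\<dots> = (\<Sum>i<n. \<Sum>is\<in>?L e. c (i # is) ^ p ^ Suc e * word_prod f (i # is))"
      by (simp add: sum.cartesian_product)
    also have "\<dots> = (\<Sum>i<n. (\<Sum>is\<in>?L e. c (i # is) ^ p ^ e * word_prod f is) ^ p * f i)"
    proof (rule sum.cong[OF refl])
      fix i
      have cp: "x ^ p ^ Suc e = (x ^ p ^ e) ^ p" for x :: 'a
        by (simp only: power_Suc mult.commute[of p] power_mult)
      have "c (i # is) ^ p ^ Suc e * word_prod f (i # is) = (c (i # is) ^ p ^ e * word_prod f is) ^ p * f i" for "is"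
        unfolding cp by (simp add: power_mult_distrib ac_simps)
      then show "(\<Sum>is\<in>?L e. c (i # is) ^ p ^ Suc e * word_prod f (i # is))
          = (\<Sum>is\<in>?L e. c (i # is) ^ p ^ e * word_prod f is) ^ p * f i"
        by (simp only: frob_sum[OF frobq_p] sum_distrib_right)
    qed
    finally have "(\<Sum>i<n. (\<Sum>is\<in>?L e. c (i # is) ^ p ^ e * word_prod f is) ^ p * f i) \<in> P" using c by simp
    then have i: "(\<Sum>is\<in>?L e. c (i # is) ^ p ^ e * word_prod f is) \<in> P" if "i < n" for i
      using assms[unfolded indep_def, rule_format, of "\<lambda>i. \<Sum>is\<in>?L e. c (i # is) ^ p ^ e * word_prod f is" i] that
      by simp
    have "c (i # is) \<in> P" if "i < n" "is \<in> ?L e" for i "is"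
      using Suc[unfolded indep_def, rule_format, OF i[OF that(1)] that(2)] .
    then show "\<forall>is\<in>?L (Suc e). c is \<in> P" unfolding img by auto
  qed
qed

end

text \<open>The setting of the main argument: \<open>xs\<close> is a regular sequence generating an
  \<open>m\<close>-primary ideal with one-dimensional socle, and its length takes the role of the
  dimension.\<close>

locale gorenstein_frob = frob_finite +
  fixes xs
  assumes xs_m: "set xs \<subseteq> m" and xs_reg: "regseq {0} xs" and xs_prim: "mprim (ig xs)" and xs_type1: "type1 (ig xs)"
    and reduced: "reduced_ring TYPE('a)"
begin

abbreviation "J \<equiv> ig xs"
abbreviation "d \<equiv> length xs"

abbreviation len :: "'a set \<Rightarrow> nat" where
  "len \<equiv> len_quot"

lemma elen_eq_len: "mprim Q \<Longrightarrow> elen ideal Q UNIV = enat (len Q)"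
  using len_quot_eq_elen[of Q] mprim_elen_finite[of Q] mprim_ideal[of Q] by simp

lemma len_mono: "mprim Q \<Longrightarrow> ideal Q' \<Longrightarrow> Q \<subseteq> Q' \<Longrightarrow> len Q' \<le> len Q"
  using elen_eq_len[of Q] elen_eq_len[of Q'] mprim_mono[of Q Q'] IL.elen_mono[of UNIV Q UNIV Q'] mprim_ideal[of Q]
  by simp

lemma len_frob_J: "frobq q \<Longrightarrow> len (frob_pow J q) = q ^ d * len J"
proof -
  assume q: "frobq q"
  have "elen ideal (ig (map (\<lambda>x. x ^ q) xs)) UNIV = enat (q ^ d) * elen ideal J UNIV"
    using elen_regseq_powers[OF ideal_zero xs_m xs_reg frobq_pos[OF q]] by simp
  then show ?thesis
    using elen_eq_len[OF mprim_frob[OF xs_prim q]] elen_eq_len[OF xs_prim] by (simp add: frob_pow_ig[OF q])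
qed

lemma J_m: "J \<subseteq> m" using xs_m by (rule ig_least[OF m_ideal])

lemma len_frob_m_le: "frobq q \<Longrightarrow> len (frob_pow m q) \<le> q ^ d * len J"
  using len_mono[OF mprim_frob[OF xs_prim] frob_pow_ideal frob_pow_mono[OF J_m], of q] len_frob_J[of q] by simp

text \<open>A growth argument: \<open>n\<close> independent elements yield \<open>n ^ e\<close>
  independent ones for \<open>p ^ e\<close>, while \<open>(p ^ e) ^ d * len J\<close> elements
  suffice to generate. For large \<open>e\<close> this excludes \<open>n > p ^ d\<close>.\<close>

lemma indep_le:
  fixes P :: "'a set"
  assumes P: "prime_ideal P" and f: "indep p P {..<n} f"
  shows "n \<le> p ^ d"
proof (rule ccontr)
  assume "\<not> n \<le> p ^ d"
  then have gt: "1 < real n / real (p ^ d)" using p_gt_1 by (simp add: field_simps)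
  then obtain e where e: "real (len J) < (real n / real (p ^ d)) ^ e" using real_arch_pow by blast
  have q: "frobq (p ^ e)" by simp
  obtain bs :: "'a list" where bs: "length bs = len (frob_pow m (p ^ e))" "UNIV = qspan (p ^ e) bs"
    using gens_colength[OF q elen_eq_len[OF mprim_frob[OF mprim_m q]]] .
  let ?L = "{is. set is \<subseteq> {..<n} \<and> length is = e}"
  have "card ?L = n ^ e" using card_lists_length_eq[of "{..<n}" e] by simp
  moreover have "finite ?L" using finite_lists_length_eq[of "{..<n}" e] by simp
  ultimately have "n ^ e \<le> len (frob_pow m (p ^ e))"
    using indep_card_le[OF P q _ indep_words[OF f, of e] bs(2)] bs(1) by simp
  also have "\<dots> \<le> (p ^ e) ^ d * len J" by (rule len_frob_m_le[OF q])
  finally have "real (n ^ e) \<le> real ((p ^ e) ^ d * len J)" by (simp only: of_nat_le_iff)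
  then have "real n ^ e \<le> real (p ^ d) ^ e * real (len J)"
    by (simp add: power_mult[symmetric] mult.commute)
  then show False using e p_gt_1 by (simp add: power_divide field_simps)
qed

text \<open>A largest independent family exists by \<open>indep_le\<close>; every element,
  multiplied by a suitable scalar outside \<open>P\<close>, lies in its span modulo
  \<open>P\<close>. As F_*R is finitely generated, a product of finitely many such scalars serves
  all elements.\<close>

lemma generic_gens:
  fixes P :: "'a set"
  assumes P: "prime_ideal P"
  shows "\<exists>bs c. length bs = p ^ d \<and> c \<notin> P \<and> (\<forall>r. c ^ p * r \<in> P + qspan p bs)"
proof -
  have id: "ideal P" and pr: "\<And>x y. x * y \<in> P \<Longrightarrow> x \<in> P \<or> y \<in> P" and ne: "P \<noteq> UNIV"
    using P by (auto simp: prime_ideal_def)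
  have one: "1 \<notin> P" using ideal_eq_UNIV[OF id] ne by blast
  let ?S = "{n :: nat. \<exists>f. indep p P {..<n} f}"
  have "indep p P {..<0 :: nat} (\<lambda>_. 0)" by (simp add: indep_def)
  then have "0 \<in> ?S" by blast
  moreover have bd: "?S \<subseteq> {..p ^ d}" using indep_le[OF P] by auto
  then have fin: "finite ?S" using finite_subset by blast
  ultimately have mx: "Max ?S \<in> ?S" by (intro Max_in) blast+
  define n where "n = Max ?S"
  obtain f where f: "indep p P {..<n} f" using mx unfolding n_def by blast
  have "Suc n \<notin> ?S" using Max_ge[OF fin, of "Suc n"] unfolding n_def by auto
  then have nf: "\<not> indep p P {..<Suc n} g" for g by blast
  let ?bs = "map f [0..<n]"
  let ?W = "P + qspan p ?bs"
  have W: "submod p ?W" using ideal_submod[OF id] submod_qspan[OF frobq_p] by (rule submod_plus)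
  have PW: "P \<subseteq> ?W"
    using set_zero_plus2[OF submod_0[OF submod_qspan[OF frobq_p]], of P ?bs] by (simp add: add.commute)
  have bW: "f i \<in> ?W" if "i < n" for i
    using qspan_incl[OF frobq_p, of ?bs] that set_zero_plus2[OF ideal_0[OF id], of "qspan p ?bs"] by fastforce
  have ex: "\<exists>c. c \<notin> P \<and> c ^ p * s \<in> ?W" for s
  proof -
    let ?g = "f(n := s)"
    obtain c i where c: "(\<Sum>i<Suc n. c i ^ p * ?g i) \<in> P" and i: "i < Suc n" "c i \<notin> P"
      using nf[of ?g] unfolding indep_def by (metis lessThan_iff)
    have eq: "(\<Sum>i<Suc n. c i ^ p * ?g i) = (\<Sum>i<n. c i ^ p * f i) + c n ^ p * s" by simp
    have "c n \<notin> P"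
    proof
      assume cn: "c n \<in> P"
      then have "c n ^ p \<in> P" using ideal_pow_mem[OF id, of "c n" 1 p] p_gt_1 by simp
      then have "c n ^ p * s \<in> P" by (rule ideal_mult_right[OF id])
      then have "(\<Sum>i<n. c i ^ p * f i) \<in> P" using c ideal_diff[OF id c, of "c n ^ p * s"] unfolding eq by simp
      then have "\<forall>i<n. c i \<in> P" using f unfolding indep_def by blast
      then show False using i cn by (auto simp: less_Suc_eq)
    qed
    moreover have "(\<Sum>i<n. c i ^ p * f i) \<in> ?W" by (rule submod_sum[OF W]) (auto intro: submod_scale[OF W] bW)
    then have "(\<Sum>i<Suc n. c i ^ p * ?g i) - (\<Sum>i<n. c i ^ p * f i) \<in> ?W"
      using c PW by (intro submod_diff[OF frobq_p W]) auto
    then have "c n ^ p * s \<in> ?W" unfolding eq by simp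
    ultimately show ?thesis by blast
  qed
  then obtain cc where cc: "\<And>s. cc s \<notin> P" "\<And>s. cc s ^ p * s \<in> ?W" by metis
  obtain ss :: "'a list" where ss: "UNIV = qspan p ss" using finite_gens[OF frobq_p] .
  define c where "c = (\<Prod>s\<in>set ss. cc s)"
  have "(\<Prod>s\<in>A. cc s) \<notin> P" if "finite A" for A using that
    by (induction A rule: finite_induct) (use one pr cc in auto)
  then have cP: "c \<notin> P" by (simp add: c_def)
  have "set ss \<subseteq> {r. c ^ p * r \<in> ?W}"
  proof
    fix s assume s: "s \<in> set ss"
    have "c = cc s * (\<Prod>s\<in>set ss - {s}. cc s)" unfolding c_def using s by (simp add: prod.remove)
    then have "c ^ p * s = (\<Prod>s\<in>set ss - {s}. cc s) ^ p * (cc s ^ p * s)" by (simp add: power_mult_distrib ac_simps)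
    then show "s \<in> {r. c ^ p * r \<in> ?W}" using submod_scale[OF W cc(2)] by simp
  qed
  then have "qspan p ss \<subseteq> {r. c ^ p * r \<in> ?W}" by (rule qspan_subset[OF submod_vimage[OF W]])
  then have all: "c ^ p * r \<in> ?W" for r using ss by blast
  \<comment> \<open>Padding with zeros gives length exactly \<open>p ^ d\<close>, so that the lists
    for different primes can later be added entrywise.\<close>
  define bs' where "bs' = ?bs @ replicate (p ^ d - n) 0"
  have nle: "n \<le> p ^ d" using indep_le[OF P f] .
  have "qspan p ?bs \<subseteq> qspan p bs'"
    unfolding bs'_def qspan_append
    using set_zero_plus2[OF submod_0[OF submod_qspan[OF frobq_p, of "replicate (p ^ d - n) 0"]], of "qspan p ?bs"]
    by (simp only: add.commute)
  then have "?W \<subseteq> P + qspan p bs'" by (intro set_plus_mono2 subset_refl)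
  then have "\<forall>r. c ^ p * r \<in> P + qspan p bs'" using all by blast
  moreover have "length bs' = p ^ d" using nle by (simp add: bs'_def)
  ultimately show ?thesis using cP by blast
qed

text \<open>Noetherian induction: if \<open>a * b \<in> Y\<close> with neither factor in
  \<open>Y\<close>, the primes found for \<open>Y + prin a\<close> and \<open>Y + prin b\<close>
  together serve for \<open>Y\<close>.\<close>

lemma finite_primes_radical:
  fixes Y :: "'a set"
  assumes "ideal Y"
  shows "\<exists>F. finite F \<and> (\<forall>P\<in>F. prime_ideal P) \<and> (\<forall>a\<in>\<Inter>F. \<exists>n. a ^ n \<in> Y)"
  using assms
proof (induction Y rule: noeth_induct[consumes 1])
  case (1 Y)
  note id = 1(1)
  show ?case
  proof (cases "Y = UNIV \<or> prime_ideal Y")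
    case True
    then show ?thesis
    proof
      assume "prime_ideal Y"
      then show ?thesis by (intro exI[of _ "{Y}"]) (auto intro: exI[of _ 1])
    qed (intro exI[of _ "{}"], auto)
  next
    case False
    then obtain a b where ab: "a * b \<in> Y" "a \<notin> Y" "b \<notin> Y" unfolding prime_ideal_def using id by blast
    have big: "ideal (Y + prin a)" "Y \<subset> Y + prin a" if "a \<notin> Y" for a
      subgoal using id by (intro ideal_plus) auto
      subgoal using that plus_left_incl[OF ideal_prin, of Y a] plus_right_incl[OF id, of "prin a"] prin_mem(3)[of a] by blast
      done
    obtain F where "finite F \<and> (\<forall>P\<in>F. prime_ideal P) \<and> (\<forall>c\<in>\<Inter>F. \<exists>n. c ^ n \<in> Y + prin a)"
      using 1(2)[OF big[OF ab(2)]] by (rule exE)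
    then have F: "finite F" "\<forall>P\<in>F. prime_ideal P" "\<forall>c\<in>\<Inter>F. \<exists>n. c ^ n \<in> Y + prin a"
      by blast+
    obtain G where "finite G \<and> (\<forall>P\<in>G. prime_ideal P) \<and> (\<forall>c\<in>\<Inter>G. \<exists>n. c ^ n \<in> Y + prin b)"
      using 1(2)[OF big[OF ab(3)]] by (rule exE)
    then have G: "finite G" "\<forall>P\<in>G. prime_ideal P" "\<forall>c\<in>\<Inter>G. \<exists>n. c ^ n \<in> Y + prin b"
      by blast+
    have "\<exists>n. c ^ n \<in> Y" if c: "c \<in> \<Inter>(F \<union> G)" for c
    proof -
      obtain n where "c ^ n \<in> Y + prin a" using F(3)[rule_format, of c] c by auto
      then obtain s where s: "c ^ n - s * a \<in> Y" using mem_plus_prin[OF id] by blast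
      obtain k where "c ^ k \<in> Y + prin b" using G(3)[rule_format, of c] c by auto
      then obtain t where t: "c ^ k - t * b \<in> Y" using mem_plus_prin[OF id] by blast
      have "c ^ (n + k) \<in> Y"
        by (rule ideal_lin3_mem[OF id s t ab(1), where r = "c ^ k" and s = "s * a" and t = "s * t"])
          (simp add: algebra_simps power_add)
      then show ?thesis by blast
    qed
    then have "\<forall>c\<in>\<Inter>(F \<union> G). \<exists>n. c ^ n \<in> Y" by (intro ballI)
    moreover have "finite (F \<union> G)" "\<forall>P\<in>F \<union> G. prime_ideal P" using F(1,2) G(1,2) by auto
    ultimately show ?thesis by (intro exI[of _ "F \<union> G"] conjI)
  qed
qed

text \<open>Reducedness makes the radical of zero vanish. A family of least size among the finite
  families of primes with zero intersection is irredundant, which yields elements lying in all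
  members but one.\<close>

lemma minimal_primes:
  obtains F :: "'a set set" where "finite F" "\<And>P. P \<in> F \<Longrightarrow> prime_ideal P" "\<Inter>F = {0}"
    "\<And>P. P \<in> F \<Longrightarrow> \<exists>e. e \<notin> P \<and> (\<forall>Q\<in>F - {P}. e \<in> Q)"
proof -
  let ?S = "\<lambda>F. finite F \<and> (\<forall>P\<in>F. prime_ideal P) \<and> \<Inter>F = {0 :: 'a}"
  obtain F0 where F0: "finite F0" "\<forall>P\<in>F0. prime_ideal P" "\<forall>a\<in>\<Inter>F0. \<exists>n. a ^ n \<in> {0 :: 'a}"
    using finite_primes_radical[OF ideal_zero] by (elim exE conjE)
  have "a = 0" if a0: "a \<in> \<Inter>F0" for a
  proof -
    obtain n where "a ^ n = 0" using bspec[OF F0(3) a0] by auto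
    then show ?thesis using reduced[unfolded reduced_ring_def, rule_format, of a n] by blast
  qed
  moreover have "0 \<in> \<Inter>F0" using F0(2) by (auto simp: prime_ideal_def ideal_0)
  ultimately have "\<Inter>F0 = {0}" by blast
  then have "?S F0" using F0 by blast
  then have am: "?S (arg_min card ?S) \<and> (\<forall>G. ?S G \<longrightarrow> card (arg_min card ?S) \<le> card G)"
    by (rule arg_min_nat_lemma)
  define F where "F = arg_min card ?S"
  have F: "?S F" "\<And>G. ?S G \<Longrightarrow> card F \<le> card G" using am unfolding F_def by blast+
  show ?thesis
  proof (rule that[of F])
    fix P assume P: "P \<in> F"
    show "\<exists>e. e \<notin> P \<and> (\<forall>Q\<in>F - {P}. e \<in> Q)"
    proof (rule ccontr)
      assume "\<nexists>e. e \<notin> P \<and> (\<forall>Q\<in>F - {P}. e \<in> Q)"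
      then have "\<Inter>(F - {P}) = \<Inter>F" by blast
      then have "?S (F - {P})" using F(1) by simp
      then have "card F \<le> card (F - {P})" by (rule F(2))
      then show False using card_Diff1_less[of F P] F(1) P by simp
    qed
  qed (use F(1) in simp_all)
qed

text \<open>Elements \<open>E P\<close> that lie in all the primes except \<open>P\<close> are
  pairwise orthogonal and annihilate \<open>P\<close>; with them the lists of
  \<open>generic_gens\<close> are glued into one. Adding the lists entrywise keeps the length at
  \<open>p ^ d\<close>.\<close>

lemma frob_generic_surjection:
  "\<exists>bs c. length bs = p ^ d \<and> nzd {0} c \<and> (\<forall>r. c ^ p * r \<in> qspan p bs)"
proof -
  obtain F :: "'a set set" where F: "finite F" "\<And>P. P \<in> F \<Longrightarrow> prime_ideal P" "\<Inter>F = {0}"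
    "\<And>P. P \<in> F \<Longrightarrow> \<exists>e. e \<notin> P \<and> (\<forall>Q\<in>F - {P}. e \<in> Q)" by (rule minimal_primes) (rule that)
  have id: "ideal P" and pr: "\<And>x y. x * y \<in> P \<Longrightarrow> x \<in> P \<or> y \<in> P" if "P \<in> F" for P
    using F(2)[OF that] by (auto simp: prime_ideal_def)
  obtain E where E: "\<And>P. P \<in> F \<Longrightarrow> E P \<notin> P" "\<And>P Q. P \<in> F \<Longrightarrow> Q \<in> F \<Longrightarrow> Q \<noteq> P \<Longrightarrow> E P \<in> Q"
    using F(4) by (metis Diff_iff singletonD)
  have ex: "\<forall>P\<in>F. \<exists>bc. length (fst bc) = p ^ d \<and> snd bc \<notin> P \<and> (\<forall>r. snd bc ^ p * r \<in> P + qspan p (fst bc))"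
    using generic_gens F(2) by (metis fst_conv snd_conv)
  obtain bc where bc: "\<And>P. P \<in> F \<Longrightarrow> length (fst (bc P)) = p ^ d \<and> snd (bc P) \<notin> P \<and>
      (\<forall>r. snd (bc P) ^ p * r \<in> P + qspan p (fst (bc P)))"
    using bchoice[OF ex] by blast
  define B where "B P = fst (bc P)" for P
  define C where "C P = snd (bc P)" for P
  have B: "length (B P) = p ^ d" and C: "C P \<notin> P" and BC: "C P ^ p * r \<in> P + qspan p (B P)" if "P \<in> F" for P r
    using bc[OF that] by (auto simp: B_def C_def)
  have zero: "a = 0" if "\<And>P. P \<in> F \<Longrightarrow> a \<in> P" for a using F(3) that by blast
  have EE: "E P * E Q = 0" if PQ: "P \<in> F" "Q \<in> F" "P \<noteq> Q" for P Q
  proof (rule zero)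
    fix P' assume P': "P' \<in> F"
    then show "E P * E Q \<in> P'"
      using E(2)[OF PQ(1) P'] E(2)[OF PQ(2) P'] PQ(3) ideal_mult_left[OF id[OF P']] ideal_mult_right[OF id[OF P']]
      by (cases "P' = P") auto
  qed
  have EP: "E P * x = 0" if P: "P \<in> F" and x: "x \<in> P" for P x
  proof (rule zero)
    fix P' assume P': "P' \<in> F"
    then show "E P * x \<in> P'"
      using E(2)[OF P P'] x ideal_mult_left[OF id[OF P']] ideal_mult_right[OF id[OF P']] by (cases "P' = P") auto
  qed
  define bs where "bs = map (\<lambda>j. \<Sum>P\<in>F. E P ^ p * B P ! j) [0..<p ^ d]"
  \<comment> \<open>One factor \<open>E P\<close> is already built into the glued generators, and a
    second one isolates the summand of \<open>P\<close>; hence the square.\<close>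
  define c where "c = (\<Sum>P\<in>F. E P ^ 2 * C P)"
  let ?W = "qspan p bs"
  have W: "submod p ?W" by (rule submod_qspan[OF frobq_p])
  have bW: "E P ^ (2 * p) * b \<in> ?W" if P: "P \<in> F" and b: "b \<in> set (B P)" for P b
  proof -
    obtain j where j: "j < p ^ d" "b = B P ! j" using b B[OF P] by (metis in_set_conv_nth)
    let ?bj = "\<Sum>P\<in>F. E P ^ p * B P ! j"
    have "?bj \<in> set bs" using j(1) unfolding bs_def set_map by (intro image_eqI[of _ _ j]) simp_all
    then have bj: "?bj \<in> ?W" using qspan_incl[OF frobq_p] by blast
    have "E P ^ p * ?bj = (\<Sum>Q\<in>F. (E P * E Q) ^ p * B Q ! j)"
      by (simp add: sum_distrib_left power_mult_distrib mult.assoc)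
    also have "\<dots> = (\<Sum>Q\<in>F. if Q = P then E P ^ (2 * p) * B P ! j else 0)"
      by (rule sum.cong) (use EE[OF P] P in \<open>auto simp: frob_zero power_mult power2_eq_square\<close>)
    also have "\<dots> = E P ^ (2 * p) * b" using P F(1) j by simp
    finally show ?thesis using submod_scale[OF W bj, of "E P"] by simp
  qed
  have "(E P ^ 2 * C P) ^ p * r \<in> ?W" if P: "P \<in> F" for P r
  proof -
    obtain y v where v: "C P ^ p * r = y + v" "y \<in> P" "v \<in> qspan p (B P)" using BC[OF P, of r] by (rule set_plus_elim)
    have "set (B P) \<subseteq> {v. E P ^ (2 * p) * v \<in> ?W}" using bW[OF P] by blast
    then have "qspan p (B P) \<subseteq> {v. E P ^ (2 * p) * v \<in> ?W}" by (rule qspan_subset[OF submod_vimage[OF W]])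
    then have vW: "E P ^ (2 * p) * v \<in> ?W" using v(3) by blast
    have "E P ^ Suc (2 * p - 1) * y = 0" using EP[OF P v(2)] by (simp add: mult.assoc mult.left_commute[of "E P"])
    then have y0: "E P ^ (2 * p) * y = 0" using p_gt_1 by simp
    have "(E P ^ 2 * C P) ^ p * r = E P ^ (2 * p) * (C P ^ p * r)" by (simp add: power_mult_distrib power_mult mult.assoc)
    also have "\<dots> = E P ^ (2 * p) * v" unfolding v(1) distrib_left y0 by simp
    finally show ?thesis using vW by simp
  qed
  then have all: "c ^ p * r \<in> ?W" for r
    unfolding c_def frob_sum[OF frobq_p] sum_distrib_right by (intro submod_sum[OF W])
  have cP: "c \<notin> P" if P: "P \<in> F" for P
  proof
    assume "c \<in> P"
    have "c = E P ^ 2 * C P + (\<Sum>Q\<in>F - {P}. E Q ^ 2 * C Q)" unfolding c_def using P F(1) by (rule sum.remove[rotated])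
    moreover have "(\<Sum>Q\<in>F - {P}. E Q ^ 2 * C Q) \<in> P"
    proof (rule ideal_sum[OF id[OF P]])
      fix Q assume "Q \<in> F - {P}"
      then have "E Q \<in> P" using E(2)[of Q P] P by blast
      then show "E Q ^ 2 * C Q \<in> P"
        unfolding power2_eq_square by (intro ideal_mult_right[OF id[OF P]])
    qed
    ultimately have "E P ^ 2 * C P \<in> P" using \<open>c \<in> P\<close> ideal_diff[OF id[OF P], of c "\<Sum>Q\<in>F - {P}. E Q ^ 2 * C Q"] by simp
    then show False using pr[OF P] E(1)[OF P] C[OF P] unfolding power2_eq_square by blast
  qed
  have "nzd {0} c"
  proof (rule nzdI)
    fix r assume "c * r \<in> {0}"
    then have "c * r \<in> P" if "P \<in> F" for P using ideal_0[OF id[OF that]] by simp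
    then have "r \<in> P" if "P \<in> F" for P using pr[OF that] cP[OF that] that by blast
    then show "r \<in> {0}" using zero by blast
  qed
  then show ?thesis using all by (intro exI[of _ bs] exI[of _ c]) (simp add: bs_def)
qed

end

section \<open>Existence of Hilbert-Kunz multiplicities\<close>

text \<open>Adding the tail of the geometric series, \<open>2 * B * (1 / 2) ^ e\<close>, makes the
  sequence decreasing.\<close>

lemma quasi_decreasing_convergent:
  fixes u :: "nat \<Rightarrow> real"
  assumes pos: "\<And>e. 0 \<le> u e" and step: "\<And>e. u (Suc e) \<le> u e + B * (1 / 2) ^ e" and "0 \<le> B"
  shows "convergent u"
proof -
  define v where "v e = u e + 2 * B * (1 / 2) ^ e" for e
  have "decseq v"
  proof (rule decseq_SucI)
    fix e
    have "v (Suc e) = u (Suc e) + B * (1 / 2) ^ e" by (simp add: v_def)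
    then show "v (Suc e) \<le> v e" using step[of e] by (simp add: v_def)
  qed
  moreover have "0 \<le> v e" for e using pos assms(3) by (simp add: v_def)
  ultimately have "convergent v" using decseq_convergent[of v 0] by (metis convergentI)
  moreover have "(\<lambda>e. 2 * B * (1 / 2) ^ e) \<longlonglongrightarrow> 2 * B * 0"
    by (intro tendsto_mult_left LIMSEQ_power_zero) simp
  then have "convergent (\<lambda>e. 2 * B * (1 / 2) ^ e)" by (rule convergentI)
  ultimately have "convergent (\<lambda>e. v e - 2 * B * (1 / 2) ^ e)" by (rule convergent_diff)
  then show ?thesis by (simp add: v_def)
qed

context gorenstein_frob
begin

lemma len_UNIV: "len UNIV = 0"
proof -
  have "mprim UNIV" by (simp add: mprim_def)
  then have "enat (len UNIV) = 0" using elen_eq_len[of UNIV] by (simp add: elen_refl)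
  then show ?thesis by (simp add: zero_enat_def)
qed

text \<open>If \<open>c\<close> lies in \<open>m\<close>, it extends to \<open>d\<close> parameters,
  and K^[q] contains the powers of exponent \<open>M * q\<close> of the other \<open>d - 1\<close>
  for a fixed \<open>M\<close>. This bounds the length by a multiple of q^(d-1); the factor
  \<open>p ^ e\<close> on the left avoids the exponent \<open>d - 1\<close>.\<close>

lemma nzd_len_bound:
  assumes K: "mprim K" and c: "nzd {0} c"
  shows "\<exists>C. \<forall>e. p ^ e * len (prin c + frob_pow K (p ^ e)) \<le> C * (p ^ e) ^ d"
proof (cases "c \<in> m")
  case False
  then obtain s where "s * c = 1" using unit_ex by blast
  then have "1 \<in> prin c" unfolding prin_def by (metis rangeI)
  then have "prin c = UNIV" by (rule ideal_eq_UNIV[OF ideal_prin])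
  then have "prin c + frob_pow K q = UNIV" for q using plus_left_incl[OF frob_pow_ideal, of "prin c" K q] by auto
  then show ?thesis by (simp add: len_UNIV)
next
  case True
  \<comment> \<open>With no parameters \<open>c\<close> would be both nilpotent and a
    nonzerodivisor.\<close>
  have "xs \<noteq> []"
  proof
    assume "xs = []"
    then obtain n where "c ^ n \<in> {0}" using xs_prim True unfolding mprim_def by auto
    then have "c ^ n * 1 \<in> {0}" by simp
    then have "1 \<in> {0 :: 'a}" by (rule nzdD[OF nzd_power[OF c]])
    then show False using one_notin_m ideal_0[OF m_ideal] by simp
  qed
  then obtain zs where zs: "Suc (length zs) = d" "set zs \<subseteq> m" "mprim ({0} + ig (c # zs))"
    using exchange[OF ideal_zero _ xs_reg xs_m _ c True] xs_prim by auto
  have "\<exists>M. \<forall>z\<in>set zs. z ^ M \<in> K"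
  proof -
    have "\<forall>z\<in>set zs. \<exists>n. z ^ n \<in> K" using K zs(2) unfolding mprim_def by blast
    then obtain f where f: "\<And>z. z \<in> set zs \<Longrightarrow> z ^ f z \<in> K" by metis
    have "z ^ (sum f (set zs)) \<in> K" if "z \<in> set zs" for z
      using ideal_pow_mem[OF mprim_ideal[OF K] f[OF that]] member_le_sum[of z "set zs" f] that by simp
    then show ?thesis by blast
  qed
  then obtain M where M: "\<And>z. z \<in> set zs \<Longrightarrow> z ^ M \<in> K" by blast
  define L where "L = len (prin c + ig zs)"
  have prim: "mprim (prin c + ig zs)" using zs(3) by simp
  have "p ^ e * len (prin c + frob_pow K (p ^ e)) \<le> (M ^ length zs * L) * (p ^ e) ^ d" for e
  proof -
    let ?q = "p ^ e"
    let ?Q = "prin c + frob_pow K ?q" and ?Z = "prin c + ig (map (\<lambda>z. z ^ (M * ?q)) zs)"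
    have FK: "mprim (frob_pow K ?q)" using mprim_frob[OF K] by simp
    have idQ: "ideal ?Q" by (intro ideal_plus frob_pow_ideal ideal_prin)
    have pQ: "mprim ?Q" by (rule mprim_mono[OF FK idQ plus_right_incl]) simp
    have "ig (map (\<lambda>z. z ^ (M * ?q)) zs) \<subseteq> frob_pow K ?q"
      using M by (intro ig_least frob_pow_ideal) (auto simp: power_mult intro: frob_pow_mem)
    then have "?Z \<subseteq> ?Q" by (intro set_plus_mono2 subset_refl)
    then have "elen ideal ?Q UNIV \<le> elen ideal ?Z UNIV"
      by (intro IL.elen_mono idQ ideal_plus[OF ideal_prin ideal_ig]) auto
    also have "\<dots> \<le> enat ((M * ?q) ^ length zs) * elen ideal (prin c + ig zs) UNIV"
      by (rule elen_ig_pow) simp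
    finally have "len ?Q \<le> (M * ?q) ^ length zs * L"
      using elen_eq_len[OF pQ] elen_eq_len[OF prim] by (simp add: L_def)
    then have "?q * len ?Q \<le> ?q * ((M * ?q) ^ length zs * L)" by (rule mult_le_mono2)
    also have "\<dots> = (M ^ length zs * L) * ?q ^ Suc (length zs)" by (simp add: power_mult_distrib)
    finally show ?thesis unfolding zs(1) .
  qed
  then show ?thesis by blast
qed

text \<open>The span of the \<open>p ^ d\<close> generic generators accounts for at most that many
  copies of R/K^[q]. What is left is generated by a fixed finite list and killed by
  \<open>c\<close>, whence the second term.\<close>

lemma frob_len_step:
  assumes K: "mprim K"
  shows "\<exists>c A. nzd {0} c \<and> (\<forall>e. len (frob_pow K (p ^ Suc e))
    \<le> p ^ d * len (frob_pow K (p ^ e)) + A * len (prin c + frob_pow K (p ^ e)))"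
proof -
  obtain bs c where bc: "length bs = p ^ d" "nzd {0} c" "\<And>r. c ^ p * r \<in> qspan p bs"
    using frob_generic_surjection by blast
  obtain ss :: "'a list" where ss: "UNIV = qspan p ss" using finite_gens[OF frobq_p] .
  have "len (frob_pow K (p ^ Suc e)) \<le> p ^ d * len (frob_pow K (p ^ e)) + length ss * len (prin c + frob_pow K (p ^ e))" for e
  proof -
    let ?q = "p ^ e"
    let ?B = "frob_pow K (?q * p)"
    let ?W = "?B + qspan p bs" and ?Q = "prin c + frob_pow K ?q"
    have q: "frobq (?q * p)" using frobq_mult[OF frobq_power frobq_p] .
    have kB: "r ^ p \<in> ?B" if "r \<in> frob_pow K ?q" for r using frob_pow_power_mem[OF frobq_p that] .
    have subB: "submod p ?B" by (rule ideal_submod[OF frob_pow_ideal])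
    have W: "submod p ?W" using subB submod_qspan[OF frobq_p] by (rule submod_plus)
    have BW: "?B \<subseteq> ?W"
      using set_zero_plus2[OF submod_0[OF submod_qspan[OF frobq_p, of bs]], of ?B] by (simp only: add.commute)
    have bW: "qspan p bs \<subseteq> ?W" using set_zero_plus2[OF submod_0[OF subB], of "qspan p bs"] .
    have idQ: "ideal ?Q" by (intro ideal_plus frob_pow_ideal ideal_prin)
    have pB: "mprim ?B" using mprim_frob[OF K q] .
    have pK: "mprim (frob_pow K ?q)" using mprim_frob[OF K] by simp
    have pQ: "mprim ?Q" by (rule mprim_mono[OF pK idQ plus_right_incl]) simp
    have "elen (submod p) ?B UNIV = enat (len ?B)"
      using finite_len_qspan[OF frobq_p frob_pow_ideal ideal_UNIV subset_UNIV elen_eq_len[OF pB]] by blast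
    moreover have "elen (submod p) ?B UNIV = elen (submod p) ?B ?W + elen (submod p) ?W UNIV"
      using subB W BW by (intro elen_submod_add[OF frobq_p]) auto
    moreover have "elen (submod p) ?B ?W \<le> enat (p ^ d) * elen ideal (frob_pow K ?q) UNIV"
      using elen_qspan_le[OF frobq_p subB frob_pow_ideal, of bs K ?q] ideal_mult_right[OF frob_pow_ideal kB] bc(1) by simp
    moreover have "elen (submod p) ?W UNIV \<le> enat (length ss) * elen ideal ?Q UNIV"
    proof -
      have "r ^ p * s \<in> ?W" if r: "r \<in> ?Q" for r s
      proof -
        obtain t k where tk: "r = t * c + k" "k \<in> frob_pow K ?q" using r by (auto elim!: set_plus_elim simp: prin_def)
        have "r ^ p * s = k ^ p * s + c ^ p * (t ^ p * s)"
          unfolding tk(1) frob_add[OF frobq_p] by (simp add: power_mult_distrib algebra_simps)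
        also have "\<dots> \<in> ?W" by (intro set_plus_intro bc(3) ideal_mult_right[OF frob_pow_ideal kB[OF tk(2)]])
        finally show ?thesis .
      qed
      then have "elen (submod p) ?W (?W + qspan p ss) \<le> enat (length ss) * elen ideal ?Q UNIV"
        by (intro elen_qspan_le[OF frobq_p W idQ])
      moreover have "?W + qspan p ss = UNIV"
        using set_zero_plus2[OF submod_0[OF W], of "qspan p ss"] ss by blast
      ultimately show ?thesis by simp
    qed
    ultimately have "enat (len ?B) \<le> enat (p ^ d) * elen ideal (frob_pow K ?q) UNIV + enat (length ss) * elen ideal ?Q UNIV"
      by (metis add_mono)
    then have "len ?B \<le> p ^ d * len (frob_pow K ?q) + length ss * len ?Q"
      unfolding elen_eq_len[OF pK] elen_eq_len[OF pQ] by simp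
    then show ?thesis by (simp add: mult.commute[of _ p])
  qed
  then show ?thesis using bc(2) by blast
qed

text \<open>After division by q^d the error in \<open>frob_len_step\<close> is at most a constant
  times 1/q, which is summable since \<open>p \<ge> 2\<close>.\<close>

lemma hk_convergent:
  assumes K: "mprim K"
  shows "convergent (\<lambda>e. real (len (frob_pow K (p ^ e))) / real (p ^ e) ^ d)"
proof -
  obtain c A where c: "nzd {0} c" and st: "\<And>e. len (frob_pow K (p ^ Suc e))
    \<le> p ^ d * len (frob_pow K (p ^ e)) + A * len (prin c + frob_pow K (p ^ e))"
    using frob_len_step[OF K] by blast
  obtain C where C: "\<And>e. p ^ e * len (prin c + frob_pow K (p ^ e)) \<le> C * (p ^ e) ^ d"
    using nzd_len_bound[OF K c] by blast
  define l where "l e = real (len (prin c + frob_pow K (p ^ e)))" for e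
  define h where "h e = real (len (frob_pow K (p ^ e)))" for e
  define P where "P = real p"
  have P: "2 \<le> P" using p_gt_1 unfolding P_def by simp
  have hs: "h (Suc e) \<le> P ^ d * h e + real A * l e" for e
  proof -
    have "real (len (frob_pow K (p ^ Suc e))) \<le> real (p ^ d * len (frob_pow K (p ^ e)) + A * len (prin c + frob_pow K (p ^ e)))"
      using st[of e] by (simp only: of_nat_le_iff)
    then show ?thesis by (simp add: h_def l_def P_def)
  qed
  have ls: "P ^ e * l e \<le> real C * (P ^ e) ^ d" for e
  proof -
    have "real (p ^ e * len (prin c + frob_pow K (p ^ e))) \<le> real (C * (p ^ e) ^ d)"
      using C[of e] by (simp only: of_nat_le_iff)
    then show ?thesis by (simp add: l_def P_def)
  qed
  have "convergent (\<lambda>e. h e / (P ^ e) ^ d)"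
  proof (rule quasi_decreasing_convergent[where B = "real A * real C"])
    fix e
    show "0 \<le> h e / (P ^ e) ^ d" using P by (simp add: h_def)
    have pos: "0 < P ^ d" "0 < (P ^ e) ^ d" "0 < P ^ e" "1 \<le> P ^ d" using P by (auto intro: one_le_power)
    have le: "l e / (P ^ e) ^ d \<le> real C * (1 / 2) ^ e"
    proof -
      have "l e / (P ^ e) ^ d \<le> real C / P ^ e" using ls[of e] pos by (simp add: field_simps)
      also have "\<dots> = real C * (1 / P) ^ e" by (simp add: power_divide)
      also have "\<dots> \<le> real C * (1 / 2) ^ e"
        using P by (intro mult_left_mono power_mono) (auto simp: field_simps)
      finally show ?thesis .
    qed
    have "h (Suc e) / (P ^ Suc e) ^ d = h (Suc e) / (P ^ d * (P ^ e) ^ d)" by (simp add: power_mult_distrib)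
    also have "\<dots> \<le> (P ^ d * h e + real A * l e) / (P ^ d * (P ^ e) ^ d)"
      using hs[of e] pos by (intro divide_right_mono) auto
    also have "\<dots> = h e / (P ^ e) ^ d + real A * (l e / (P ^ e) ^ d) / P ^ d"
    proof -
      have nz: "P \<noteq> 0" using P by simp
      show ?thesis using nz by (simp add: add_divide_distrib mult.commute)
    qed
    also have "\<dots> \<le> h e / (P ^ e) ^ d + real A * (l e / (P ^ e) ^ d)"
    proof -
      have "0 \<le> real A * (l e / (P ^ e) ^ d)" using pos by (simp add: l_def)
      then show ?thesis using pos(4) divide_left_mono[of 1 "P ^ d" "real A * (l e / (P ^ e) ^ d)"] pos(1) by simp
    qed
    also have "\<dots> \<le> h e / (P ^ e) ^ d + real A * (real C * (1 / 2) ^ e)"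
      using le by (intro add_left_mono mult_left_mono) auto
    finally show "h (Suc e) / (P ^ Suc e) ^ d \<le> h e / (P ^ e) ^ d + real A * real C * (1 / 2) ^ e"
      by (simp add: mult.assoc)
  qed simp
  then show ?thesis by (simp add: h_def P_def)
qed

lemma hk_mult_lim: "mprim K \<Longrightarrow> (\<lambda>e. real (len (frob_pow K (p ^ e))) / real (p ^ e) ^ d) \<longlonglongrightarrow> hk_mult p K d"
  using hk_convergent[of K] unfolding hk_mult_def by (simp add: convergent_LIMSEQ_iff)

text \<open>The power of \<open>m\<close> of exponent n + c + 1 lies between those of
  \<open>J\<close> of exponents n + c + 1 and n + 1. The colengths of the latter are known exactly
  from \<open>elen_ideal_pow\<close>, and both bounds have the same leading term.\<close>

lemma hs_mult_eq:
  assumes int: "\<And>a. a \<in> m \<Longrightarrow> integral_over_ideal J a"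
  shows "hs_mult m d = real (len J)"
proof -
  obtain as where as: "m = ig as" using ideal_fg[OF m_ideal] .
  have "\<exists>c. \<forall>n. ideal_pow (ig as) (n + c) \<subseteq> ideal_pow J n"
    by (rule integral_ideal_pow_subset) (use int ig_incl[of as] as in blast)
  then obtain c where c: "\<And>n. ideal_pow m (n + c) \<subseteq> ideal_pow J n" unfolding as[symmetric] by blast
  have Jlen: "elen ideal (ideal_pow J (Suc n)) UNIV = enat (((n + d) choose d) * len J)" for n
    using elen_ideal_pow[OF ideal_zero xs_m xs_reg, of n] elen_eq_len[OF xs_prim] by (simp del: ideal_pow.simps)
  have prim: "mprim (ideal_pow m n)" for n
    unfolding mprim_def using power_mem_ideal_pow by (blast intro: ideal_pow_ideal)
  have primJ: "mprim (ideal_pow J n)" for n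
    using mprim_mono[OF prim ideal_pow_ideal c] .
  have lenJ: "len (ideal_pow J (Suc n)) = ((n + d) choose d) * len J" for n
    using Jlen[of n] elen_eq_len[OF primJ[of "Suc n"]] by (simp del: ideal_pow.simps)
  define X where "X n = fact d * real (len (ideal_pow m n)) / real n ^ d" for n
  have up: "len (ideal_pow m (n + Suc c)) \<le> ((n + c + d) choose d) * len J" for n
    using len_mono[OF primJ ideal_pow_ideal ideal_pow_mono[OF J_m], of "n + Suc c"] lenJ[of "n + c"]
    by (simp del: ideal_pow.simps)
  have lo: "((n + d) choose d) * len J \<le> len (ideal_pow m (n + Suc c))" for n
  proof -
    have "ideal_pow m (n + Suc c) \<subseteq> ideal_pow J (Suc n)" using c[of "Suc n"] by (simp del: ideal_pow.simps)
    then show ?thesis using len_mono[OF prim ideal_pow_ideal] lenJ[of n] by metis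
  qed
  have "(\<lambda>n. X (n + Suc c)) \<longlonglongrightarrow> real (len J)"
  proof (rule real_tendsto_sandwich[where
        f = "\<lambda>n. (fact d * real ((n + 0 + d) choose d) / real (n + Suc c) ^ d) * real (len J)" and
        h = "\<lambda>n. (fact d * real ((n + c + d) choose d) / real (n + Suc c) ^ d) * real (len J)"])
    show "\<forall>\<^sub>F n in sequentially. (fact d * real ((n + 0 + d) choose d) / real (n + Suc c) ^ d) * real (len J) \<le> X (n + Suc c)"
    proof (rule always_eventually, rule allI)
      fix n
      have "real ((n + d) choose d) * real (len J) \<le> real (len (ideal_pow m (n + Suc c)))"
        using lo[of n] by (simp only: of_nat_mult[symmetric] of_nat_le_iff)
      then have "fact d * (real ((n + d) choose d) * real (len J)) \<le> fact d * real (len (ideal_pow m (n + Suc c)))"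
        by (intro mult_left_mono) auto
      then have "fact d * (real ((n + d) choose d) * real (len J)) / real (n + Suc c) ^ d
          \<le> fact d * real (len (ideal_pow m (n + Suc c))) / real (n + Suc c) ^ d"
        by (intro divide_right_mono) auto
      then show "(fact d * real ((n + 0 + d) choose d) / real (n + Suc c) ^ d) * real (len J) \<le> X (n + Suc c)"
        unfolding X_def by (simp only: add_0_right times_divide_eq_left mult.assoc)
    qed
    show "\<forall>\<^sub>F n in sequentially. X (n + Suc c) \<le> (fact d * real ((n + c + d) choose d) / real (n + Suc c) ^ d) * real (len J)"
    proof (rule always_eventually, rule allI)
      fix n
      have "real (len (ideal_pow m (n + Suc c))) \<le> real ((n + c + d) choose d) * real (len J)"
        using up[of n] by (simp only: of_nat_mult[symmetric] of_nat_le_iff)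
      then have "fact d * real (len (ideal_pow m (n + Suc c))) \<le> fact d * (real ((n + c + d) choose d) * real (len J))"
        by (intro mult_left_mono) auto
      then have "fact d * real (len (ideal_pow m (n + Suc c))) / real (n + Suc c) ^ d
          \<le> fact d * (real ((n + c + d) choose d) * real (len J)) / real (n + Suc c) ^ d"
        by (intro divide_right_mono) auto
      then show "X (n + Suc c) \<le> (fact d * real ((n + c + d) choose d) / real (n + Suc c) ^ d) * real (len J)"
        unfolding X_def by (simp only: times_divide_eq_left mult.assoc)
    qed
    show "(\<lambda>n. (fact d * real ((n + 0 + d) choose d) / real (n + Suc c) ^ d) * real (len J)) \<longlonglongrightarrow> real (len J)"
      using tendsto_mult_right[OF binomial_ratio_tendsto[of d 0 c], of "real (len J)"] by simp
    show "(\<lambda>n. (fact d * real ((n + c + d) choose d) / real (n + Suc c) ^ d) * real (len J)) \<longlonglongrightarrow> real (len J)"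
      using tendsto_mult_right[OF binomial_ratio_tendsto[of d c c], of "real (len J)"] by simp
  qed
  then have "X \<longlonglongrightarrow> real (len J)" by (rule LIMSEQ_offset)
  then show ?thesis unfolding hs_mult_def X_def[abs_def] by (rule limI)
qed

section \<open>The inequality at finite level\<close>

lemma qspan_one: "qspan (Suc 0) as = ig as"
  by (induction as) (auto simp: cyc_one)

text \<open>Lifts of a basis of I/(J + mI) generate \<open>I\<close> modulo \<open>J\<close> by
  Nakayama; they come from the twisted result at \<open>q = 1\<close>.\<close>

lemma mu_quot_le:
  fixes I :: "'a set"
  assumes I: "ideal I" and JI: "J \<subseteq> I" and el: "elen ideal (J + ideal_mult m I) I = enat n"
  shows "mu_quot I J \<le> n"
proof -
  have id: "ideal (J + ideal_mult m I)" by (intro ideal_plus ideal_mult_ideal ideal_ig)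
  have "ideal_mult m I \<subseteq> I" using I by (intro ideal_mult_least) (auto intro: ideal_mult_left)
  then have "J + ideal_mult m I \<subseteq> I" using JI by (intro plus_least I)
  then obtain as where as: "length as = n" "set as \<subseteq> I" "I = (J + ideal_mult m I) + ig as"
    using finite_len_qspan[OF frobq_1 id I _ el] unfolding qspan_one by blast
  have idN: "ideal (J + ig as)" by (intro ideal_plus ideal_ig)
  have "I \<subseteq> (J + ig as) + ideal_mult m I" using as(3) by (simp only: ac_simps)
  then have "I \<subseteq> J + ig as" by (rule nakayama_ideal[OF idN I])
  moreover have "J + ig as \<subseteq> I" by (rule plus_least[OF I JI ig_least[OF I as(2)]])
  ultimately have eq: "I = J + ig as" by blast
  have "gen_ideal (J \<union> set as) = I"
  proof (rule gen_ideal_eqI[OF I])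
    show "J \<union> set as \<subseteq> I" using JI as(2) by blast
    fix K assume K: "ideal K" "J \<union> set as \<subseteq> K"
    then have JK: "J \<subseteq> K" and "ig as \<subseteq> K" using ig_least[OF K(1)] by auto
    then show "I \<subseteq> K" unfolding eq by (rule plus_least[OF K(1)])
  qed
  moreover have "(\<lambda>i. as ! i) ` {..<n} = set as" using as(1) by (auto simp: set_conv_nth)
  ultimately have "I = gen_ideal (J \<union> (\<lambda>i. as ! i) ` {..<n})" by simp
  then show ?thesis unfolding mu_quot_def by (intro Least_le) blast
qed

definition Iq :: "'a \<Rightarrow> nat \<Rightarrow> 'a set" where
  "Iq u q = {r. r * u ^ q \<in> frob_pow J q}"

lemma ideal_Iq: "ideal (Iq u q)"
  unfolding Iq_def by (rule ideal_colon[OF frob_pow_ideal])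

lemma mprim_Iq: "frobq q \<Longrightarrow> mprim (Iq u q)"
  using mprim_mono[OF mprim_frob[OF xs_prim] ideal_Iq, of q u] unfolding Iq_def
  by (auto intro: ideal_mult_right[OF frob_pow_ideal])

lemma frob_m_Iq:
  assumes q: "frobq q" and u: "\<And>r. r \<in> m \<Longrightarrow> r * u \<in> J"
  shows "frob_pow m q \<subseteq> Iq u q"
proof (rule frob_pow_least[OF ideal_Iq])
  fix a assume "a \<in> m"
  then have "(a * u) ^ q \<in> frob_pow J q" using u by (intro frob_pow_mem)
  then show "a ^ q \<in> Iq u q" by (simp add: Iq_def power_mult_distrib)
qed

text \<open>R/I_q is isomorphic to the kernel of the map from R/J^[q] onto the quotient by the
  Frobenius power of \<open>J + prin u\<close>. Its length is thus a difference of two Hilbert-Kunz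
  functions, and its normalised limit exists.\<close>

lemma len_Iq:
  assumes q: "frobq q"
  shows "len (Iq u q) + len (frob_pow (J + prin u) q) = len (frob_pow J q)"
proof -
  have e: "frob_pow (J + prin u) q = frob_pow J q + prin (u ^ q)"
    by (simp add: frob_pow_plus[OF q] frob_pow_prin[OF q])
  have pJ: "mprim (frob_pow J q)" by (rule mprim_frob[OF xs_prim q])
  have pU: "mprim (frob_pow (J + prin u) q)"
    by (rule mprim_mono[OF pJ frob_pow_ideal frob_pow_mono[OF plus_left_incl]]) simp
  have "elen ideal (frob_pow J q) (frob_pow J q + prin (u ^ q)) = enat (len (Iq u q))"
    using elen_prin[OF frob_pow_ideal, of J q "u ^ q"] elen_eq_len[OF mprim_Iq[OF q, of u]] by (simp add: Iq_def)
  moreover have "elen ideal (frob_pow J q) UNIV = elen ideal (frob_pow J q) (frob_pow J q + prin (u ^ q))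
      + elen ideal (frob_pow J q + prin (u ^ q)) UNIV"
    by (intro IL.elen_add ideal_plus frob_pow_ideal plus_left_incl ideal_prin) auto
  ultimately show ?thesis using elen_eq_len[OF pJ] elen_eq_len[OF pU] unfolding e by simp
qed

text \<open>The counting argument itself. All quantities are naturals, so the inequality is arranged
  without subtraction; in return the bound \<open>mu_quot I J \<le> len J\<close> is recorded
  separately.\<close>

lemma finite_level_inequality:
  fixes I :: "'a set"
  assumes q: "frobq q" and I: "ideal I" and JI: "J \<subseteq> I"
    and u: "\<And>r. r \<in> m \<Longrightarrow> r * u \<in> J" "\<And>v. (\<forall>r\<in>m. r * v \<in> J) \<Longrightarrow> v \<in> J + prin u"
  shows "len J * q ^ d + mu_quot I J * len (frob_pow m q) \<le> len J * len (frob_pow m q) + mu_quot I J * len (Iq u q)"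
    and "len (Iq u q) \<le> len (frob_pow m q)" and "mu_quot I J \<le> len J"
proof -
  let ?Jq = "frob_pow J q" and ?Iq = "frob_pow I q" and ?mq = "frob_pow m q"
  let ?mI = "ideal_mult m I"
  define h where "h = len ?mq"
  define a where "a = len (Iq u q)"
  have pm: "mprim ?mq" by (rule mprim_frob[OF mprim_m q])
  have pJq: "mprim ?Jq" by (rule mprim_frob[OF xs_prim q])
  have pI: "mprim I" by (rule mprim_mono[OF xs_prim I JI])
  have pIq: "mprim ?Iq" by (rule mprim_frob[OF pI q])
  have mIq: "?mq \<subseteq> Iq u q" by (rule frob_m_Iq[OF q u(1)])
  show ah: "len (Iq u q) \<le> len (frob_pow m q)" by (rule len_mono[OF pm ideal_Iq mIq])
  have eh: "enat h = elen ideal ?mq (Iq u q) + enat a"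
    using IL.elen_add[OF ideal_UNIV frob_pow_ideal ideal_Iq mIq subset_UNIV] elen_eq_len[OF pm] elen_eq_len[OF mprim_Iq[OF q, of u]]
    by (simp add: h_def a_def)
  then have e2: "elen ideal ?mq (Iq u q) = enat (h - a)" by (cases "elen ideal ?mq (Iq u q)") auto
  \<comment> \<open>\<open>bs2\<close> generates I_q modulo m^[q] and \<open>bs1\<close> generates
    everything modulo I_q; together they have \<open>h\<close> members and generate F_*R by
    Nakayama.\<close>
  obtain bs2 where bs2: "length bs2 = h - a" "set bs2 \<subseteq> Iq u q" "Iq u q = ?mq + qspan q bs2"
    using finite_len_qspan[OF q frob_pow_ideal ideal_Iq mIq e2] by blast
  obtain bs1 where bs1: "length bs1 = a" "UNIV = Iq u q + qspan q bs1"
    using finite_len_qspan[OF q ideal_Iq ideal_UNIV subset_UNIV elen_eq_len[OF mprim_Iq[OF q, of u]]] unfolding a_def by blast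
  have "UNIV = ?mq + qspan q (bs2 @ bs1)" using bs1(2) unfolding bs2(3) qspan_append by (simp only: add.assoc)
  then have gens: "UNIV = qspan q (bs2 @ bs1)" by (rule nakayama_gens[OF q])
  have absorb: "X + qspan q (bs2 @ bs1) = UNIV" if "0 \<in> X" for X :: "'a set"
    using set_zero_plus2[OF that, of "qspan q (bs2 @ bs1)"] gens by blast
  have hlen: "length (bs2 @ bs1) = h" using bs1(1) bs2(1) ah by (simp add: h_def a_def)

  \<comment> \<open>Modulo I^[q] every generator is killed by \<open>I\<close>, so the colength of
    I^[q] is at most \<open>h * len I\<close>.\<close>
  have "elen (submod q) ?Iq (?Iq + qspan q (bs2 @ bs1)) \<le> enat (length (bs2 @ bs1)) * elen ideal I UNIV"
    by (rule elen_qspan_le[OF q ideal_submod[OF frob_pow_ideal] I]) (intro ideal_mult_right[OF frob_pow_ideal] frob_pow_mem)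
  moreover have "elen (submod q) ?Iq UNIV = enat (len ?Iq)"
    using finite_len_qspan[OF q frob_pow_ideal ideal_UNIV subset_UNIV elen_eq_len[OF pIq]] by blast
  ultimately have 1: "len ?Iq \<le> h * len I"
    using absorb[OF ideal_0[OF frob_pow_ideal]] elen_eq_len[OF pI] hlen by simp

  let ?X = "colon ?Jq ?Iq"
  have X: "ideal ?X" by (rule ideal_colon_set[OF frob_pow_ideal])
  have XI: "w ^ q * b \<in> ?X" if wb: "\<And>i. i \<in> I \<Longrightarrow> (w * i) ^ q * b \<in> ?Jq" for w b
  proof -
    have "?Iq \<subseteq> {k. k * (w ^ q * b) \<in> ?Jq}"
    proof (rule frob_pow_least[OF ideal_colon[OF frob_pow_ideal]])
      fix i assume "i \<in> I"
      then show "i ^ q \<in> {k. k * (w ^ q * b) \<in> ?Jq}" using wb[of i] by (simp add: power_mult_distrib ac_simps)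
    qed
    then show ?thesis unfolding colon_def by (auto simp: mult.commute)
  qed
  let ?X2 = "?X + qspan q bs2"
  have subX: "submod q ?X" by (rule ideal_submod[OF X])
  have X2: "submod q ?X2" using subX submod_qspan[OF q] by (rule submod_plus)
  have XX2: "?X \<subseteq> ?X2"
    using set_zero_plus2[OF submod_0[OF submod_qspan[OF q, of bs2]], of ?X] by (simp only: add.commute)
  have mIJ: "ideal (J + ?mI)" by (intro ideal_plus ideal_mult_ideal ideal_ig)
  have A: "elen (submod q) ?X ?X2 \<le> enat (length bs2) * elen ideal (colon J (J + ?mI)) UNIV"
  proof (rule elen_qspan_le[OF q subX ideal_colon_set[OF ideal_ig]])
    fix b w assume b: "b \<in> set bs2" and w: "w \<in> colon J (J + ?mI)"
    show "w ^ q * b \<in> ?X"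
    proof (rule XI)
      fix i assume i: "i \<in> I"
      \<comment> \<open>As \<open>r * i\<close> lies in mI, \<open>w * i\<close> is a socle element
        modulo \<open>J\<close>, hence a multiple of \<open>u\<close>. Its \<open>q\<close>-th power
        is then a multiple of \<open>u ^ q\<close> modulo J^[q], which elements of I_q kill.\<close>
      have "r * (w * i) \<in> J" if "r \<in> m" for r
      proof -
        have "r * i \<in> J + ?mI" using ideal_mult_mem[OF that i] plus_right_incl[OF ideal_ig, of ?mI xs] by blast
        then have "w * (r * i) \<in> J" using w unfolding colon_def by blast
        then show ?thesis by (simp add: mult.left_commute)
      qed
      then have "w * i \<in> J + prin u" using u(2) by blast
      then have "(w * i) ^ q \<in> frob_pow (J + prin u) q" by (rule frob_pow_mem)
      then have "(w * i) ^ q \<in> ?Jq + prin (u ^ q)" by (simp add: frob_pow_plus[OF q] frob_pow_prin[OF q])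
      then obtain t where t: "(w * i) ^ q - t * u ^ q \<in> ?Jq" using mem_plus_prin[OF frob_pow_ideal] by blast
      have bu: "b * u ^ q \<in> ?Jq" using b bs2(2) unfolding Iq_def by blast
      show "(w * i) ^ q * b \<in> ?Jq"
        by (rule ideal_lin_mem[OF frob_pow_ideal t bu, where r = b and s = t]) (simp add: algebra_simps)
    qed
  qed
  have B: "elen (submod q) ?X2 (?X2 + qspan q bs1) \<le> enat (length bs1) * elen ideal (colon J I) UNIV"
  proof (rule elen_qspan_le[OF q X2 ideal_colon_set[OF ideal_ig]])
    fix b w assume w: "w \<in> colon J I"
    have "w ^ q * b \<in> ?X"
    proof (rule XI)
      fix i assume "i \<in> I"
      then have "w * i \<in> J" using w unfolding colon_def by blast
      then show "(w * i) ^ q * b \<in> ?Jq" by (intro ideal_mult_right[OF frob_pow_ideal] frob_pow_mem)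
    qed
    then show "w ^ q * b \<in> ?X2" using XX2 by blast
  qed
  have all: "?X2 + qspan q bs1 = UNIV"
    using absorb[OF ideal_0[OF X]] unfolding qspan_append by (simp only: add.assoc)
  have t1q: "type1 ?Jq"
    using type1_powers[OF ideal_zero xs_m xs_reg frobq_pos[OF q]] xs_type1 by (simp add: frob_pow_ig[OF q])
  have JIq: "?Jq \<subseteq> ?Iq" by (rule frob_pow_mono[OF JI])
  have pX: "mprim ?X"
  proof (rule mprim_mono[OF pJq X])
    show "?Jq \<subseteq> ?X" using colon_antimono[of ?Iq UNIV ?Jq] colon_UNIV[OF frob_pow_ideal] by blast
  qed
  have "elen (submod q) ?X UNIV = enat (len ?X)"
    using finite_len_qspan[OF q X ideal_UNIV subset_UNIV elen_eq_len[OF pX]] by blast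
  moreover have "elen (submod q) ?X UNIV = elen (submod q) ?X ?X2 + elen (submod q) ?X2 UNIV"
    using subX X2 XX2 by (intro elen_submod_add[OF q]) auto
  ultimately have 2: "enat (len ?X) \<le> enat (length bs2) * elen ideal (colon J (J + ?mI)) UNIV + enat (length bs1) * elen ideal (colon J I) UNIV"
    using add_mono[OF A B] all by simp
  \<comment> \<open>Duality modulo J^[q] turns the colength just bounded into the length of
    I^[q]/J^[q]; duality modulo \<open>J\<close> turns the two annihilators into I/J and (J +
    mI)/J.\<close>
  have dX: "enat (len ?X) = elen ideal ?Jq ?Iq"
    using dual_len[OF pJq t1q frob_pow_ideal JIq] elen_eq_len[OF pX] by simp
  have JmI: "J \<subseteq> J + ?mI" by (rule plus_left_incl[OF ideal_mult_ideal])
  have d1: "elen ideal (colon J (J + ?mI)) UNIV = elen ideal J (J + ?mI)"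
    by (rule dual_len[OF xs_prim xs_type1 mIJ JmI])
  have d2: "elen ideal (colon J I) UNIV = elen ideal J I" by (rule dual_len[OF xs_prim xs_type1 I JI])
  have "?mI \<subseteq> I" using I by (intro ideal_mult_least) (auto intro: ideal_mult_left)
  then have mII: "J + ?mI \<subseteq> I" using JI by (intro plus_least I)
  have s1: "enat (len J) = elen ideal J I + enat (len I)"
    using IL.elen_add[OF ideal_UNIV ideal_ig I JI] elen_eq_len[OF xs_prim] elen_eq_len[OF pI] by simp
  have s2: "elen ideal J I = elen ideal J (J + ?mI) + elen ideal (J + ?mI) I"
    by (rule IL.elen_add[OF I ideal_ig mIJ JmI mII])
  obtain l where l: "elen ideal J I = enat l" using s1 by (cases "elen ideal J I") auto
  obtain l' n where l': "elen ideal J (J + ?mI) = enat l'" "elen ideal (J + ?mI) I = enat n"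
    using s2 l by (cases "elen ideal J (J + ?mI)"; cases "elen ideal (J + ?mI) I") auto
  have mu: "mu_quot I J \<le> n" by (rule mu_quot_le[OF I JI l'(2)])
  have ll: "l = l' + n" using s2 l l' by simp
  have Ll: "len J = l + len I" using s1 l by simp
  show "mu_quot I J \<le> len J" using mu ll Ll by simp
  have lenX: "len ?X \<le> (h - a) * l' + a * l" using 2 bs1(1) bs2(1) d1 d2 l l' by simp
  have "elen ideal ?Jq UNIV = elen ideal ?Jq ?Iq + elen ideal ?Iq UNIV"
    by (rule IL.elen_add[OF ideal_UNIV frob_pow_ideal frob_pow_ideal JIq subset_UNIV])
  then have tot: "q ^ d * len J = len ?X + len ?Iq"
    using dX elen_eq_len[OF pJq] elen_eq_len[OF pIq] len_frob_J[OF q] by (metis plus_enat_simps(1) enat.inject)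
  define \<mu> where "\<mu> = mu_quot I J"
  have ah': "a \<le> h" using ah by (simp add: a_def h_def)
  have "q ^ d * len J \<le> (h - a) * l' + a * l + h * len I" using tot lenX 1 by simp
  then have "q ^ d * len J + \<mu> * h \<le> (h - a) * l' + a * l + h * len I + \<mu> * (h - a) + \<mu> * a"
  proof -
    have "\<mu> * h = \<mu> * (h - a) + \<mu> * a" using ah' by (metis add_mult_distrib2 le_add_diff_inverse2)
    then show ?thesis using \<open>q ^ d * len J \<le> (h - a) * l' + a * l + h * len I\<close> by linarith
  qed
  \<comment> \<open>Here \<open>\<mu> \<le> n\<close> is spent: each of the \<open>h - a\<close>
    generators in I_q has room for \<open>n\<close> more before reaching
    \<open>l = l' + n\<close>.\<close>
  also have "\<dots> \<le> (h - a) * (l' + n) + a * l + h * len I + \<mu> * a"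
    using mu mult_le_mono2[of \<mu> n "h - a"] unfolding \<mu>_def by (simp add: algebra_simps)
  also have "\<dots> = ((h - a) + a) * l + h * len I + \<mu> * a" unfolding ll by (simp only: algebra_simps)
  also have "\<dots> = h * (l + len I) + \<mu> * a" using ah' by (simp add: algebra_simps)
  finally show "len J * q ^ d + mu_quot I J * len (frob_pow m q) \<le> len J * len (frob_pow m q) + mu_quot I J * len (Iq u q)"
    unfolding Ll[symmetric] \<mu>_def h_def a_def by (simp add: ac_simps)
qed

end

section \<open>Lifting homomorphisms along a regular sequence\<close>

text \<open>Vectors are total functions of which only finitely many leading values are looked at, so
  vectors of all lengths share one module.\<close>

definition vscale :: "'a::comm_ring_1 \<Rightarrow> (nat \<Rightarrow> 'a) \<Rightarrow> nat \<Rightarrow> 'a" where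
  "vscale r v = (\<lambda>j. r * v j)"

lemma vscale_apply: "vscale r v j = r * v j"
  by (simp add: vscale_def)

interpretation V: module vscale
  by standard (auto simp: vscale_def fun_eq_iff algebra_simps)

definition dot :: "nat \<Rightarrow> (nat \<Rightarrow> 'a::comm_ring_1) \<Rightarrow> (nat \<Rightarrow> 'a) \<Rightarrow> 'a" where
  "dot n g c = (\<Sum>j<n. g j * c j)"

lemma dot_add: "dot n g (c + c') = dot n g c + dot n g c'"
  by (simp add: dot_def distrib_left sum.distrib)

lemma dot_scale: "dot n g (vscale r c) = r * dot n g c"
  by (simp add: dot_def vscale_apply sum_distrib_left mult.left_commute)

lemma dot_diff: "dot n g (c - c') = dot n g c - dot n g c'"
  by (simp add: dot_def right_diff_distrib sum_subtractf)

lemma dot_add_left: "dot n (\<lambda>j. g j + h j) c = dot n g c + dot n h c"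
  by (simp add: dot_def distrib_right sum.distrib)

lemma dot_scale_left: "dot n (\<lambda>j. r * g j) c = r * dot n g c"
  by (simp add: dot_def sum_distrib_left mult.assoc)

lemma dot_mem: "ideal Y \<Longrightarrow> (\<And>j. j < n \<Longrightarrow> c j \<in> Y) \<Longrightarrow> dot n g c \<in> Y"
  unfolding dot_def by (intro ideal_sum ideal_mult_left) auto

lemma sum_fun_apply: "(\<Sum>i\<in>A. f i) x = (\<Sum>i\<in>A. f i x)"
  by (induction A rule: infinite_finite_induct) auto

text \<open>A homomorphism from \<open>N\<close> to R/Q given by representatives. At
  \<open>Q = {0}\<close> it is a genuine homomorphism on \<open>N\<close>.\<close>

definition lin_mod :: "'a::comm_ring_1 set \<Rightarrow> ('a \<Rightarrow> 'b \<Rightarrow> 'b) \<Rightarrow> 'b::ab_group_add set \<Rightarrow> ('b \<Rightarrow> 'a) \<Rightarrow> bool" where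
  "lin_mod Q s N f \<longleftrightarrow> (\<forall>x\<in>N. \<forall>y\<in>N. f (x + y) - f x - f y \<in> Q) \<and> (\<forall>r. \<forall>x\<in>N. f (s r x) - r * f x \<in> Q)"

lemma lin_modD:
  assumes "lin_mod Q s N f"
  shows "x \<in> N \<Longrightarrow> y \<in> N \<Longrightarrow> f (x + y) - f x - f y \<in> Q" "x \<in> N \<Longrightarrow> f (s r x) - r * f x \<in> Q"
  using assms unfolding lin_mod_def by blast+

lemma lin_mod_0:
  assumes "lin_mod Q s N f" "ideal Q" "0 \<in> N"
  shows "f 0 \<in> Q"
proof -
  have "f (0 + 0) - f 0 - f 0 \<in> Q" using lin_modD(1)[OF assms(1) assms(3) assms(3)] .
  then show ?thesis using ideal_uminus[OF assms(2)] by fastforce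
qed

lemma lin_mod_sum:
  assumes f: "lin_mod Q s N f" and Q: "ideal Q" and M: "module s" and N: "module.subspace s N"
    and v: "\<And>i. i \<in> A \<Longrightarrow> v i \<in> N"
  shows "f (\<Sum>i\<in>A. s (r i) (v i)) - (\<Sum>i\<in>A. r i * f (v i)) \<in> Q"
proof -
  interpret M: module s by fact
  have N0: "0 \<in> N" using M.subspace_0[OF N] .
  show ?thesis
    using v
  proof (induction A rule: infinite_finite_induct)
    case (insert i A)
    have vi: "s (r i) (v i) \<in> N" using insert.prems by (intro M.subspace_scale[OF N]) auto
    have vA: "(\<Sum>i\<in>A. s (r i) (v i)) \<in> N" using insert.prems by (intro M.subspace_sum[OF N] M.subspace_scale[OF N]) auto
    have "f (s (r i) (v i) + (\<Sum>i\<in>A. s (r i) (v i))) - f (s (r i) (v i)) - f (\<Sum>i\<in>A. s (r i) (v i)) \<in> Q"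
      by (rule lin_modD(1)[OF f vi vA])
    moreover have "f (s (r i) (v i)) - r i * f (v i) \<in> Q" using insert.prems by (intro lin_modD(2)[OF f]) auto
    moreover have "f (\<Sum>i\<in>A. s (r i) (v i)) - (\<Sum>i\<in>A. r i * f (v i)) \<in> Q" using insert by auto
    ultimately have "(f (s (r i) (v i) + (\<Sum>i\<in>A. s (r i) (v i))) - f (s (r i) (v i)) - f (\<Sum>i\<in>A. s (r i) (v i)))
       + (f (s (r i) (v i)) - r i * f (v i)) + (f (\<Sum>i\<in>A. s (r i) (v i)) - (\<Sum>i\<in>A. r i * f (v i))) \<in> Q"
      by (intro ideal_add[OF Q])
    then show ?case using insert.hyps by (simp add: algebra_simps)
  qed (use lin_mod_0[OF f Q N0] in auto)
qed

context frob_local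
begin

text \<open>On the ideal of scalars that carry \<open>v\<close> into \<open>N\<close> the map is
  multiplication by some \<open>w\<close>, by self-injectivity; \<open>w\<close> becomes the value
  at \<open>v\<close>. The last hypothesis says that \<open>f\<close> is defined on and kills
  \<open>Q\<close> times the whole module, so that the situation is one over R/Q.\<close>

lemma injective_extend_one:
  fixes s :: "'a \<Rightarrow> 'b::ab_group_add \<Rightarrow> 'b"
  assumes Q: "mprim Q" "type1 Q" and M: "module s" and N: "module.subspace s N" and f: "lin_mod Q s N f"
    and QN: "\<And>t x. t \<in> Q \<Longrightarrow> s t x \<in> N \<and> f (s t x) \<in> Q"
  shows "\<exists>f' N'. module.subspace s N' \<and> N \<subseteq> N' \<and> v \<in> N' \<and> lin_mod Q s N' f' \<and> (\<forall>x\<in>N. f' x - f x \<in> Q)"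
proof -
  interpret M: module s by fact
  have id: "ideal Q" using Q by (simp add: mprim_ideal)
  let ?D = "{t. s t v \<in> N}"
  have D: "ideal ?D"
    unfolding ideal_def
    using M.subspace_0[OF N] M.subspace_add[OF N] M.subspace_scale[OF N] by (auto simp: M.scale_left_distrib M.scale_scale[symmetric] simp del: M.scale_scale)
  have "\<exists>w. \<forall>t\<in>?D. f (s t v) - t * w \<in> Q"
  proof (rule self_injective[OF Q D])
    show "Q \<subseteq> ?D" using QN by blast
    fix t t' assume "t \<in> ?D" "t' \<in> ?D"
    then show "f (s (t + t') v) - f (s t v) - f (s t' v) \<in> Q" using lin_modD(1)[OF f] by (simp add: M.scale_left_distrib)
  next
    fix r t assume "t \<in> ?D"
    then show "f (s (r * t) v) - r * f (s t v) \<in> Q" using lin_modD(2)[OF f, of "s t v" r] by simp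
  qed (use QN in blast)
  then obtain w where w: "\<And>t. s t v \<in> N \<Longrightarrow> f (s t v) - t * w \<in> Q" by blast
  define N' where "N' = {x. \<exists>t. x - s t v \<in> N}"
  \<comment> \<open>\<open>T x\<close> chooses a coefficient of \<open>v\<close>; by
    \<open>key\<close>, another choice changes the value only within \<open>Q\<close>.\<close>
  define T where "T x = (SOME t. x - s t v \<in> N)" for x
  define f' where "f' x = f (x - s (T x) v) + T x * w" for x
  have T: "x - s (T x) v \<in> N" if "x - s t v \<in> N" for x t
    using that unfolding T_def by (rule someI[of "\<lambda>t. x - s t v \<in> N"])
  have key: "f' x - (f (x - s t v) + t * w) \<in> Q" if x: "x - s t v \<in> N" for x t
  proof -
    let ?a = "x - s t v" and ?b = "s (t - T x) v"
    have e: "x - s (T x) v = ?a + ?b" by (simp add: M.scale_left_diff_distrib)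
    have "(x - s (T x) v) - ?a \<in> N" by (rule M.subspace_diff[OF N T[OF x] x])
    then have b: "?b \<in> N" using e by simp
    have 1: "f (?a + ?b) - f ?a - f ?b \<in> Q" by (rule lin_modD(1)[OF f x b])
    have 2: "f ?b - (t - T x) * w \<in> Q" by (rule w[OF b])
    show ?thesis unfolding f'_def e
      by (rule ideal_lin_mem[OF id 1 2, where r = 1 and s = 1]) (simp add: algebra_simps)
  qed
  have NN': "N \<subseteq> N'" unfolding N'_def by (auto intro: exI[of _ 0])
  have vN': "v \<in> N'" unfolding N'_def using M.subspace_0[OF N] by (auto intro: exI[of _ 1])
  have addN: "(x + y) - s (t + t') v = (x - s t v) + (y - s t' v)" for x y t t' by (simp add: M.scale_left_distrib)
  have scaleN: "s r x - s (r * t) v = s r (x - s t v)" for r x t by (simp add: M.scale_right_diff_distrib)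
  have sub: "M.subspace N'"
    unfolding M.subspace_def
  proof (intro conjI ballI allI)
    show "0 \<in> N'" using NN' M.subspace_0[OF N] by blast
    fix x assume "x \<in> N'"
    then obtain t where t: "x - s t v \<in> N" unfolding N'_def by blast
    show "s r x \<in> N'" for r unfolding N'_def using M.subspace_scale[OF N t, of r] scaleN[of r x t] by (metis mem_Collect_eq)
    fix y assume "y \<in> N'"
    then obtain t' where t': "y - s t' v \<in> N" unfolding N'_def by blast
    show "x + y \<in> N'" unfolding N'_def using M.subspace_add[OF N t t'] addN[of x y t t'] by (metis mem_Collect_eq)
  qed
  have "lin_mod Q s N' f'"
    unfolding lin_mod_def
  proof (intro conjI ballI allI)
    fix x assume "x \<in> N'"
    then obtain t where t: "x - s t v \<in> N" unfolding N'_def by blast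
    {
      fix y assume "y \<in> N'"
      then obtain t' where t': "y - s t' v \<in> N" unfolding N'_def by blast
      have tt: "(x + y) - s (t + t') v \<in> N" unfolding addN by (rule M.subspace_add[OF N t t'])
      have a: "f ((x - s t v) + (y - s t' v)) - f (x - s t v) - f (y - s t' v) \<in> Q" by (rule lin_modD(1)[OF f t t'])
      have k: "f' (x + y) - (f ((x - s t v) + (y - s t' v)) + (t + t') * w) \<in> Q" using key[OF tt] unfolding addN .
      have "(f' (x + y) - (f ((x - s t v) + (y - s t' v)) + (t + t') * w))
          + (f ((x - s t v) + (y - s t' v)) - f (x - s t v) - f (y - s t' v))
          - (f' x - (f (x - s t v) + t * w)) - (f' y - (f (y - s t' v) + t' * w)) \<in> Q"
        by (rule ideal_diff[OF id ideal_diff[OF id ideal_add[OF id k a] key[OF t]] key[OF t']])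
      then show "f' (x + y) - f' x - f' y \<in> Q" by (simp add: algebra_simps)
    }
    fix r
    have rt: "s r x - s (r * t) v \<in> N" unfolding scaleN by (rule M.subspace_scale[OF N t])
    have a: "f (s r (x - s t v)) - r * f (x - s t v) \<in> Q" by (rule lin_modD(2)[OF f t])
    have k: "f' (s r x) - (f (s r (x - s t v)) + (r * t) * w) \<in> Q" using key[OF rt] unfolding scaleN .
    have "(f' (s r x) - (f (s r (x - s t v)) + (r * t) * w)) + (f (s r (x - s t v)) - r * f (x - s t v))
        - r * (f' x - (f (x - s t v) + t * w)) \<in> Q"
      by (rule ideal_diff[OF id ideal_add[OF id k a] ideal_mult_left[OF id key[OF t]]])
    then show "f' (s r x) - r * f' x \<in> Q" by (simp add: algebra_simps)
  qed
  moreover have "f' x - f x \<in> Q" if "x \<in> N" for x using key[of x 0] that by simp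
  ultimately show ?thesis using sub NN' vN' by blast
qed

lemma injective_extend:
  fixes s :: "'a \<Rightarrow> 'b::ab_group_add \<Rightarrow> 'b"
  assumes Q: "mprim Q" "type1 Q" and M: "module s" and N: "module.subspace s N" and f: "lin_mod Q s N f"
    and QN: "\<And>t x. t \<in> Q \<Longrightarrow> s t x \<in> N \<and> f (s t x) \<in> Q"
  shows "\<exists>f' N'. module.subspace s N' \<and> N \<subseteq> N' \<and> set vs \<subseteq> N' \<and> lin_mod Q s N' f' \<and> (\<forall>x\<in>N. f' x - f x \<in> Q)"
proof (induction vs)
  case Nil
  have "\<forall>x\<in>N. f x - f x \<in> Q" using ideal_0[OF mprim_ideal[OF Q(1)]] by simp
  then show ?case using N f by (intro exI[of _ f] exI[of _ N]) simp
next
  case (Cons v vs)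
  then obtain f1 N1 where 1: "module.subspace s N1" "N \<subseteq> N1" "set vs \<subseteq> N1" "lin_mod Q s N1 f1" "\<forall>x\<in>N. f1 x - f x \<in> Q"
    by blast
  have id: "ideal Q" using Q by (simp add: mprim_ideal)
  have "s t x \<in> N1 \<and> f1 (s t x) \<in> Q" if "t \<in> Q" for t x
    using QN[OF that, of x] 1(2,5) ideal_cong_mem[OF id, of "f1 (s t x)" "f (s t x)"] by blast
  then obtain f2 N2 where 2: "module.subspace s N2" "N1 \<subseteq> N2" "v \<in> N2" "lin_mod Q s N2 f2" "\<forall>x\<in>N1. f2 x - f1 x \<in> Q"
    using injective_extend_one[OF Q M 1(1,4)] by metis
  have "f2 x - f x \<in> Q" if "x \<in> N" for x
    using ideal_add[OF id, of "f2 x - f1 x" "f1 x - f x"] 1(2,5) 2(5) that by auto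
  then show ?case using 1 2 by (intro exI[of _ f2] exI[of _ N2]) auto
qed

lemma ig_sum: "x \<in> ig ds \<Longrightarrow> \<exists>t. x = (\<Sum>y\<in>set ds. t y * y)" for ds :: "'a list"
proof -
  assume x: "x \<in> ig ds"
  have "qspan (Suc 0) ds = ig ds" by (induction ds) (auto simp: cyc_one)
  then show ?thesis using qspan_sum[OF frobq_1, of x ds] x by simp
qed

text \<open>Submodules of a finite free module are finitely generated, by induction on the rank
  through the ideal of last coordinates. Generation is meant on the first \<open>n\<close>
  coordinates.\<close>

lemma vec_fg:
  fixes N :: "(nat \<Rightarrow> 'a) set"
  assumes "V.subspace N"
  shows "\<exists>S. finite S \<and> S \<subseteq> N \<and> (\<forall>c\<in>N. \<exists>w\<in>V.span S. \<forall>j<n. w j = c j)"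
  using assms
proof (induction n arbitrary: N)
  case 0
  then show ?case by (intro exI[of _ "{}"]) (auto intro: V.span_zero)
next
  case (Suc n)
  note N = Suc.prems
  let ?D = "(\<lambda>c. c n) ` N"
  have D: "ideal ?D"
    unfolding ideal_def
  proof (intro conjI ballI allI impI)
    show "0 \<in> ?D" using V.subspace_0[OF N] by (intro image_eqI[of _ _ 0]) auto
    fix x assume "x \<in> ?D"
    then obtain c where c: "x = c n" "c \<in> N" by blast
    show "r * x \<in> ?D" for r using V.subspace_scale[OF N c(2), of r] c(1) by (intro image_eqI[of _ _ "vscale r c"]) (auto simp: vscale_apply)
    fix y assume "y \<in> ?D"
    then obtain c' where c': "y = c' n" "c' \<in> N" by blast
    show "x + y \<in> ?D" using V.subspace_add[OF N c(2) c'(2)] c c' by (intro image_eqI[of _ _ "c + c'"]) auto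
  qed
  obtain ds where ds: "?D = ig ds" using ideal_fg[OF D] .
  have "\<forall>d\<in>set ds. \<exists>c. c \<in> N \<and> c n = d"
  proof
    fix d assume "d \<in> set ds"
    then have "d \<in> ?D" using ds ig_incl[of ds] by blast
    then show "\<exists>c. c \<in> N \<and> c n = d" by auto
  qed
  then obtain v where v: "\<And>d. d \<in> set ds \<Longrightarrow> v d \<in> N \<and> v d n = d" by metis
  let ?N = "N \<inter> {c. c n = 0}"
  have Z: "V.subspace {c :: nat \<Rightarrow> 'a. c n = 0}" by (auto simp: V.subspace_def vscale_apply)
  have "V.subspace ?N" using N Z by (rule V.subspace_inter)
  from Suc.IH[OF this]
  obtain S where S': "finite S \<and> S \<subseteq> ?N \<and> (\<forall>c\<in>?N. \<exists>w\<in>V.span S. \<forall>j<n. w j = c j)" by (rule exE)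
  note S = conjunct1[OF S'] conjunct1[OF conjunct2[OF S']] bspec[OF conjunct2[OF conjunct2[OF S']]]
  let ?S = "S \<union> v ` set ds"
  have "\<exists>w\<in>V.span ?S. \<forall>j<Suc n. w j = c j" if c: "c \<in> N" for c
  proof -
    have "c n \<in> ig ds" using c ds by blast
    then obtain t where t: "c n = (\<Sum>d\<in>set ds. t d * d)" using ig_sum by blast
    define u where "u = (\<Sum>d\<in>set ds. vscale (t d) (v d))"
    have "u n = (\<Sum>d\<in>set ds. t d * v d n)" unfolding u_def by (simp add: sum_fun_apply vscale_apply)
    also have "\<dots> = c n" unfolding t by (rule sum.cong) (use v in auto)
    finally have un: "u n = c n" .
    have uN: "u \<in> N" unfolding u_def using v by (intro V.subspace_sum[OF N] V.subspace_scale[OF N]) auto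
    have uS: "u \<in> V.span ?S" unfolding u_def by (intro V.span_sum V.span_scale V.span_base) auto
    have "c - u \<in> ?N" using V.subspace_diff[OF N c uN] un by simp
    then obtain w where w: "w \<in> V.span S" "\<forall>j<n. w j = (c - u) j" using S(3)[of "c - u"] by blast
    have "V.span S \<subseteq> {c. c n = 0}" using S(2) by (intro V.span_minimal Z) auto
    then have wn: "w n = 0" using w(1) by blast
    have "w \<in> V.span ?S" using w(1) V.span_mono[of S ?S] by blast
    then have "w + u \<in> V.span ?S" using uS by (rule V.span_add)
    moreover have "\<forall>j<Suc n. (w + u) j = c j" using w(2) wn un by (auto simp: less_Suc_eq)
    ultimately show ?thesis by blast
  qed
  moreover have "finite ?S" "?S \<subseteq> N" using S(1,2) v by auto
  ultimately show ?case by (intro exI[of _ ?S] conjI ballI)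
qed

end

section \<open>A free cover of F_*R, its syzygies and the vanishing of Ext\<close>

locale frob_cover = gorenstein_frob +
  fixes q :: nat and ss :: "'a list"
  assumes q: "frobq q" and ss: "UNIV = qspan q ss"
begin

abbreviation "n \<equiv> length ss"

definition ev :: "(nat \<Rightarrow> 'a) \<Rightarrow> 'a" where
  "ev c = (\<Sum>j<n. c j ^ q * ss ! j)"

lemma ev_add: "ev (c + c') = ev c + ev c'"
  by (simp add: ev_def frob_add[OF q] distrib_right sum.distrib)

lemma ev_diff: "ev (c - c') = ev c - ev c'"
  by (simp add: ev_def frob_diff[OF q] left_diff_distrib sum_subtractf)

lemma ev_scale: "ev (vscale r c) = r ^ q * ev c"
  by (simp add: ev_def vscale_apply power_mult_distrib mult.assoc sum_distrib_left)

lemma ev_surj: "\<exists>c. ev c = x"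
proof -
  have "submod q (range ev)"
    unfolding submod_def
  proof (intro conjI ballI allI impI)
    show "0 \<in> range ev" by (rule range_eqI[of _ _ 0]) (simp add: ev_def frob_zero[OF q])
  next
    fix x y assume "x \<in> range ev" "y \<in> range ev"
    then show "x + y \<in> range ev" by (auto simp: ev_add[symmetric])
  next
    fix r x assume "x \<in> range ev"
    then show "r ^ q * x \<in> range ev" by (auto simp: ev_scale[symmetric])
  qed
  moreover have "set ss \<subseteq> range ev"
  proof
    fix s assume "s \<in> set ss"
    then obtain i where i: "i < n" "s = ss ! i" by (metis in_set_conv_nth)
    have "ev (\<lambda>j. if j = i then 1 else 0) = (\<Sum>j<n. if j = i then ss ! j else 0)"
      unfolding ev_def by (rule sum.cong) (auto simp: frob_zero[OF q])
    also have "\<dots> = s" using i by simp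
    finally show "s \<in> range ev" by (metis rangeI)
  qed
  ultimately have "qspan q ss \<subseteq> range ev" by (rule qspan_subset)
  then show ?thesis using ss by (metis UNIV_I imageE subsetD)
qed

lemma module_twisted: "module (\<lambda>r x :: 'a. r ^ q * x)"
  by standard (simp_all add: frob_add[OF q] distrib_left distrib_right power_mult_distrib mult.assoc)

abbreviation "tw \<equiv> \<lambda>r x :: 'a. r ^ q * x"

text \<open>The preimage, in the free module, of the submodule of F_*R generated by
  \<open>Y\<close>, which is the ideal Y^[q].\<close>

definition K :: "'a set \<Rightarrow> (nat \<Rightarrow> 'a) set" where
  "K Y = {c. ev c \<in> frob_pow Y q}"

lemma K_subspace: "V.subspace (K Y)"
  unfolding V.subspace_def K_def
  by (auto simp: ev_add ev_scale intro: ideal_rules frob_pow_ideal)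
    (simp add: ev_def frob_zero[OF q] ideal_0[OF frob_pow_ideal])

lemma K_memI:
  assumes "\<And>j. j < n \<Longrightarrow> c j \<in> Y"
  shows "c \<in> K Y"
  unfolding K_def ev_def using assms
  by (auto intro!: ideal_sum frob_pow_ideal ideal_mult_right frob_pow_mem)

text \<open>Homomorphisms to R/Y, by representatives, from \<open>K Y\<close> modulo the vectors
  with entries in \<open>Y\<close>.\<close>

definition homK :: "'a set \<Rightarrow> ((nat \<Rightarrow> 'a) \<Rightarrow> 'a) \<Rightarrow> bool" where
  "homK Y f \<longleftrightarrow> lin_mod Y vscale (K Y) f \<and> (\<forall>c. (\<forall>j<n. c j \<in> Y) \<longrightarrow> f c \<in> Y)"

text \<open>This expresses \<open>Ext\<^sup>1(F\<^sub>*R/Y, R/Y) = 0\<close>: \<open>K Y\<close> modulo \<open>Y\<close> is the first syzygy of \<open>F\<^sub>*R/Y\<close> over \<open>R/Y\<close>.\<close>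
definition ext_vanish :: "'a set \<Rightarrow> bool" where
  "ext_vanish Y \<longleftrightarrow> (\<forall>f. homK Y f \<longrightarrow> (\<exists>g. \<forall>c\<in>K Y. f c - dot n g c \<in> Y))"

lemma homK_cong:
  assumes f: "homK Y f" and Y: "ideal Y" and c: "c \<in> K Y" "c' \<in> K Y" "\<And>j. j < n \<Longrightarrow> c j = c' j"
  shows "f c - f c' \<in> Y"
proof -
  have d: "c - c' \<in> K Y" by (rule V.subspace_diff[OF K_subspace c(1,2)])
  have "\<forall>j<n. (c - c') j \<in> Y" using c(3) ideal_0[OF Y] by simp
  then have fd: "f (c - c') \<in> Y" using f unfolding homK_def by blast
  have "f ((c - c') + c') - f (c - c') - f c' \<in> Y"
    using f unfolding homK_def by (intro lin_modD(1)[OF _ d c(2)]) blast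
  then have "(f c - f (c - c') - f c') + f (c - c') \<in> Y" using fd by (intro ideal_add[OF Y]) simp_all
  then show ?thesis by simp
qed

text \<open>Self-injectivity of R/Y extends \<open>f\<close> to the unit vectors, and the values
  there are the entries of \<open>g\<close>.\<close>

lemma ext_vanish_base:
  assumes Y: "mprim Y" "type1 Y"
  shows "ext_vanish Y"
  unfolding ext_vanish_def
proof (intro allI impI)
  fix f assume f: "homK Y f"
  have id: "ideal Y" using Y by (simp add: mprim_ideal)
  define e where "e i = (\<lambda>j :: nat. if j = i then 1 else (0 :: 'a))" for i
  have "vscale t x \<in> K Y \<and> f (vscale t x) \<in> Y" if "t \<in> Y" for t x
  proof -
    have "\<forall>j<n. vscale t x j \<in> Y" using ideal_mult_right[OF id that] by (simp add: vscale_apply)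
    then show ?thesis using f K_memI unfolding homK_def by blast
  qed
  then obtain f' N' where N': "V.subspace N'" "K Y \<subseteq> N'" "set (map e [0..<n]) \<subseteq> N'" "lin_mod Y vscale N' f'"
    "\<forall>x\<in>K Y. f' x - f x \<in> Y"
    using injective_extend[OF Y V.module_axioms K_subspace, where f = f and vs = "map e [0..<n]"] f
    unfolding homK_def by blast
  have eN: "e j \<in> N'" if "j < n" for j using N'(3) that by auto
  have "f c - dot n (\<lambda>j. f' (e j)) c \<in> Y" if c: "c \<in> K Y" for c
  proof -
    let ?u = "\<Sum>j<n. vscale (c j) (e j)"
    have uj: "?u i = c i" if "i < n" for i
    proof -
      have "?u i = (\<Sum>j<n. if j = i then c j else 0)"
        unfolding sum_fun_apply by (rule sum.cong) (auto simp: vscale_apply e_def)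
      then show ?thesis using that by simp
    qed
    have uN: "?u \<in> N'" using eN by (intro V.subspace_sum[OF N'(1)] V.subspace_scale[OF N'(1)]) auto
    have "?u \<in> K Y"
    proof -
      have "ev ?u = ev c" unfolding ev_def by (rule sum.cong) (auto simp: uj)
      then show ?thesis using c unfolding K_def by simp
    qed
    then have a: "f c - f ?u \<in> Y" using uj by (intro homK_cong[OF f id c]) auto
    have b: "f' ?u - f ?u \<in> Y" using N'(5) \<open>?u \<in> K Y\<close> by blast
    have d: "f' ?u - (\<Sum>j<n. c j * f' (e j)) \<in> Y"
      using eN by (intro lin_mod_sum[OF N'(4) id V.module_axioms N'(1)]) auto
    have "dot n (\<lambda>j. f' (e j)) c = (\<Sum>j<n. c j * f' (e j))" unfolding dot_def by (simp add: mult.commute)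
    then show ?thesis
      using ideal_add[OF id ideal_diff[OF id a b] d] by (simp add: algebra_simps)
  qed
  then show "\<exists>g. \<forall>c\<in>K Y. f c - dot n g c \<in> Y" by blast
qed

lemma K_plus_prin:
  assumes Y: "ideal Y" and c: "c \<in> K (Y + prin y)"
  shows "\<exists>b. c - vscale y b \<in> K Y"
proof -
  have "ev c \<in> frob_pow Y q + prin (y ^ q)"
    using c unfolding K_def by (simp add: frob_pow_plus[OF q Y ideal_prin] frob_pow_prin[OF q])
  then obtain t where t: "ev c - t * y ^ q \<in> frob_pow Y q" using mem_plus_prin[OF frob_pow_ideal] by blast
  obtain b where "ev b = t" using ev_surj by blast
  then have "ev (c - vscale y b) \<in> frob_pow Y q" using t by (simp add: ev_diff ev_scale mult.commute)
  then show ?thesis unfolding K_def by blast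
qed

text \<open>Quotients by \<open>y\<close> are chosen pointwise; cancelling the nonzerodivisor
  \<open>y\<close> modulo \<open>Y\<close> makes them linear.\<close>

lemma homK_divide:
  assumes Y: "ideal Y" and y: "nzd Y y" and h: "homK Y h" and hy: "\<And>c. c \<in> K Y \<Longrightarrow> h c \<in> Y + prin y"
  shows "\<exists>f1. homK Y f1 \<and> (\<forall>c\<in>K Y. h c - y * f1 c \<in> Y)"
proof -
  define f1 where "f1 c = (SOME t. h c - t * y \<in> Y)" for c
  have f1: "h c - y * f1 c \<in> Y" if cK: "c \<in> K Y" for c
  proof -
    obtain t where "h c - t * y \<in> Y" using hy[OF cK] mem_plus_prin[OF Y] by blast
    then have "h c - f1 c * y \<in> Y" unfolding f1_def by (rule someI[of "\<lambda>t. h c - t * y \<in> Y"])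
    then show ?thesis by (simp add: mult.commute)
  qed
  have lin: "lin_mod Y vscale (K Y) h" using h unfolding homK_def by blast
  have "lin_mod Y vscale (K Y) f1"
    unfolding lin_mod_def
  proof (intro conjI ballI allI)
    fix c c' assume c: "c \<in> K Y" "c' \<in> K Y"
    have s: "c + c' \<in> K Y" by (rule V.subspace_add[OF K_subspace c])
    have "(h (c + c') - h c - h c') - (h (c + c') - y * f1 (c + c')) + (h c - y * f1 c) + (h c' - y * f1 c') \<in> Y"
      by (intro ideal_add[OF Y] ideal_diff[OF Y] f1 c s lin_modD(1)[OF lin])
    then have "y * (f1 (c + c') - f1 c - f1 c') \<in> Y" by (simp add: algebra_simps)
    then show "f1 (c + c') - f1 c - f1 c' \<in> Y" by (rule nzdD[OF y])
  next
    fix r c assume c: "c \<in> K Y"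
    have s: "vscale r c \<in> K Y" by (rule V.subspace_scale[OF K_subspace c])
    have "(h (vscale r c) - r * h c) - (h (vscale r c) - y * f1 (vscale r c)) + r * (h c - y * f1 c) \<in> Y"
      by (intro ideal_add[OF Y] ideal_diff[OF Y] ideal_mult_left[OF Y f1[OF c]] f1[OF s] lin_modD(2)[OF lin c])
    then have "y * (f1 (vscale r c) - r * f1 c) \<in> Y" by (simp add: algebra_simps)
    then show "f1 (vscale r c) - r * f1 c \<in> Y" by (rule nzdD[OF y])
  qed
  moreover have "f1 c \<in> Y" if c: "\<forall>j<n. c j \<in> Y" for c
  proof -
    have cK: "c \<in> K Y" using c by (intro K_memI) blast
    have "h c \<in> Y" using h c unfolding homK_def by blast
    then have "h c - (h c - y * f1 c) \<in> Y" by (rule ideal_diff[OF Y _ f1[OF cK]])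
    then show ?thesis using nzdD[OF y, of "f1 c"] by simp
  qed
  ultimately show ?thesis using f1 unfolding homK_def by blast
qed

lemma homK_minus_dot:
  assumes Y: "ideal Y" and f: "homK Y f"
  shows "homK Y (\<lambda>c. f c - dot n g c)"
proof -
  have lin: "lin_mod Y vscale (K Y) f" and z: "\<And>c. (\<forall>j<n. c j \<in> Y) \<Longrightarrow> f c \<in> Y" using f unfolding homK_def by blast+
  have "lin_mod Y vscale (K Y) (\<lambda>c. f c - dot n g c)"
    unfolding lin_mod_def
  proof (intro conjI ballI allI)
    fix c c' assume "c \<in> K Y" "c' \<in> K Y"
    then show "f (c + c') - dot n g (c + c') - (f c - dot n g c) - (f c' - dot n g c') \<in> Y"
      using lin_modD(1)[OF lin, of c c'] by (simp add: dot_add algebra_simps)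
  next
    fix r c assume "c \<in> K Y"
    then show "f (vscale r c) - dot n g (vscale r c) - r * (f c - dot n g c) \<in> Y"
      using lin_modD(2)[OF lin, of c r] by (simp add: dot_scale algebra_simps)
  qed
  moreover have "f c - dot n g c \<in> Y" if "\<forall>j<n. c j \<in> Y" for c
    using z[OF that] dot_mem[OF Y, of n c g] that by (intro ideal_diff[OF Y]) auto
  ultimately show ?thesis unfolding homK_def by blast
qed

text \<open>Every vector of \<open>K (Y + prin y)\<close> is a vector of \<open>K Y\<close> up to a
  multiple of \<open>y\<close>, so \<open>f\<close> induces a map over the smaller quotient. By
  hypothesis that map is a scalar product with some \<open>g\<close>; the difference takes values in
  \<open>Y + prin y\<close> and can be divided by \<open>y\<close>.\<close>

lemma homK_reduce:
  assumes Y: "ideal Y" and y: "nzd Y y" and yq: "nzd (frob_pow Y q) (y ^ q)" and ex: "ext_vanish (Y + prin y)"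
    and f: "homK Y f"
  shows "\<exists>g f1. homK Y f1 \<and> (\<forall>c\<in>K Y. f c - dot n g c - y * f1 c \<in> Y)"
proof -
  let ?Z = "Y + prin y"
  have Z: "ideal ?Z" and YZ: "Y \<subseteq> ?Z" using Y plus_left_incl[OF ideal_prin, of Y y] by (auto intro: ideal_plus)
  have yZ: "y * t \<in> ?Z" for t using plus_right_incl[OF Y, of "prin y"] prin_mem(2)[of y t] by blast
  have lin: "lin_mod Y vscale (K Y) f" and z: "\<And>c. (\<forall>j<n. c j \<in> Y) \<Longrightarrow> f c \<in> Y" using f unfolding homK_def by blast+
  define B where "B c = (SOME b. c - vscale y b \<in> K Y)" for c
  define ft where "ft c = f (c - vscale y (B c))" for c
  have key: "ft c - f (c - vscale y b) \<in> ?Z" if cb: "c - vscale y b \<in> K Y" for c b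
  proof -
    have cB: "c - vscale y (B c) \<in> K Y"
      unfolding B_def using cb by (rule someI[of "\<lambda>b. c - vscale y b \<in> K Y"])
    let ?d = "b - B c"
    have e: "c - vscale y (B c) = (c - vscale y b) + vscale y ?d"
      by (simp add: fun_eq_iff vscale_apply algebra_simps)
    have yd: "vscale y ?d \<in> K Y" using V.subspace_diff[OF K_subspace cB cb] e by simp
    then have "y ^ q * ev ?d \<in> frob_pow Y q" unfolding K_def by (simp add: ev_scale)
    \<comment> \<open>Regularity of \<open>y ^ q\<close> modulo Y^[q]: if y times a vector is in
      \<open>K Y\<close>, so is the vector, and the ambiguity in \<open>ft\<close> is a multiple of
      \<open>y\<close>.\<close>
    then have "ev ?d \<in> frob_pow Y q" by (rule nzdD[OF yq])
    then have d: "?d \<in> K Y" unfolding K_def by simp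
    have 1: "f (c - vscale y (B c)) - f (c - vscale y b) - f (vscale y ?d) \<in> ?Z"
      unfolding e using lin_modD(1)[OF lin cb yd] YZ by blast
    have 2: "f (vscale y ?d) - y * f ?d \<in> ?Z" using lin_modD(2)[OF lin d] YZ by blast
    have "(f (c - vscale y (B c)) - f (c - vscale y b) - f (vscale y ?d)) + (f (vscale y ?d) - y * f ?d) + y * f ?d \<in> ?Z"
      by (intro ideal_add[OF Z] 1 2 yZ)
    then show ?thesis unfolding ft_def by simp
  qed
  have "homK ?Z ft"
    unfolding homK_def lin_mod_def
  proof (intro conjI ballI allI impI)
    fix c c' assume "c \<in> K ?Z" "c' \<in> K ?Z"
    then obtain b b' where b: "c - vscale y b \<in> K Y" "c' - vscale y b' \<in> K Y" using K_plus_prin[OF Y] by blast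
    have e: "(c + c') - vscale y (b + b') = (c - vscale y b) + (c' - vscale y b')"
      by (simp add: fun_eq_iff vscale_apply algebra_simps)
    have s: "(c + c') - vscale y (b + b') \<in> K Y" unfolding e by (rule V.subspace_add[OF K_subspace b])
    have 1: "f ((c + c') - vscale y (b + b')) - f (c - vscale y b) - f (c' - vscale y b') \<in> ?Z"
      unfolding e using lin_modD(1)[OF lin b] YZ by blast
    have "(ft (c + c') - f ((c + c') - vscale y (b + b')))
        + (f ((c + c') - vscale y (b + b')) - f (c - vscale y b) - f (c' - vscale y b'))
        - (ft c - f (c - vscale y b)) - (ft c' - f (c' - vscale y b')) \<in> ?Z"
      by (intro ideal_diff[OF Z] ideal_add[OF Z] key 1 s b)
    then show "ft (c + c') - ft c - ft c' \<in> ?Z" by (simp add: algebra_simps)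
  next
    fix r c assume "c \<in> K ?Z"
    then obtain b where b: "c - vscale y b \<in> K Y" using K_plus_prin[OF Y] by blast
    have e: "vscale r c - vscale y (vscale r b) = vscale r (c - vscale y b)"
      by (simp add: fun_eq_iff vscale_apply algebra_simps)
    have s: "vscale r c - vscale y (vscale r b) \<in> K Y" unfolding e by (rule V.subspace_scale[OF K_subspace b])
    have 1: "f (vscale r c - vscale y (vscale r b)) - r * f (c - vscale y b) \<in> ?Z"
      unfolding e using lin_modD(2)[OF lin b] YZ by blast
    have "(ft (vscale r c) - f (vscale r c - vscale y (vscale r b)))
        + (f (vscale r c - vscale y (vscale r b)) - r * f (c - vscale y b)) - r * (ft c - f (c - vscale y b)) \<in> ?Z"
      by (intro ideal_diff[OF Z] ideal_add[OF Z] ideal_mult_left[OF Z key[OF b]] key[OF s] 1)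
    then show "ft (vscale r c) - r * ft c \<in> ?Z" by (simp add: algebra_simps)
  next
    fix c assume "\<forall>j<n. c j \<in> ?Z"
    then have "\<forall>j. \<exists>t. j < n \<longrightarrow> c j - t * y \<in> Y" using mem_plus_prin[OF Y] by blast
    then obtain b where b: "\<And>j. j < n \<Longrightarrow> c j - b j * y \<in> Y" by metis
    have all: "\<forall>j<n. (c - vscale y b) j \<in> Y" using b by (simp add: vscale_apply mult.commute)
    then have bK: "c - vscale y b \<in> K Y" by (intro K_memI) blast
    have "f (c - vscale y b) \<in> ?Z" using z[OF all] YZ by blast
    then have "(ft c - f (c - vscale y b)) + f (c - vscale y b) \<in> ?Z" by (rule ideal_add[OF Z key[OF bK]])
    then show "ft c \<in> ?Z" by simp
  qed
  then obtain g where g: "\<And>c. c \<in> K ?Z \<Longrightarrow> ft c - dot n g c \<in> ?Z" using ex unfolding ext_vanish_def by blast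
  have "f c - dot n g c \<in> ?Z" if c: "c \<in> K Y" for c
  proof -
    have cZ: "c \<in> K ?Z" using c frob_pow_mono[OF YZ] unfolding K_def by blast
    have "c - vscale y 0 \<in> K Y" using c by simp
    from key[OF this] have k: "ft c - f c \<in> ?Z" by simp
    have "(ft c - dot n g c) - (ft c - f c) \<in> ?Z" by (rule ideal_diff[OF Z g[OF cZ] k])
    then show ?thesis by simp
  qed
  from homK_divide[OF Y y homK_minus_dot[OF Y f, of g] this]
  show ?thesis by blast
qed

text \<open>By \<open>homK_reduce\<close> the Ext module equals \<open>y\<close> times itself, so
  Nakayama kills it. To have a finitely generated module at hand, a homomorphism is replaced by the
  vector of its values on finitely many generators of \<open>K Y\<close>.\<close>

lemma ext_vanish_step:
  assumes Y: "ideal Y" and ym: "y \<in> m" and y: "nzd Y y" and yq: "nzd (frob_pow Y q) (y ^ q)"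
    and ex: "ext_vanish (Y + prin y)"
  shows "ext_vanish Y"
  unfolding ext_vanish_def
proof (intro allI impI)
  fix f assume f: "homK Y f"
  obtain S where S': "finite S \<and> S \<subseteq> K Y \<and> (\<forall>c\<in>K Y. \<exists>w\<in>V.span S. \<forall>j<n. w j = c j)"
    using vec_fg[OF K_subspace, of Y n] by (rule exE)
  note S = conjunct1[OF S'] conjunct1[OF conjunct2[OF S']] bspec[OF conjunct2[OF conjunct2[OF S']]]
  obtain ks where ks: "set ks = S" using finite_list[OF S(1)] by blast
  define N where "N = length ks"
  define val where "val h = (\<lambda>l. if l < N then h (ks ! l) else (0 :: 'a))" for h :: "(nat \<Rightarrow> 'a) \<Rightarrow> 'a"
  have ksK: "ks ! l \<in> K Y" if "l < N" for l using that S(2) ks unfolding N_def by (metis nth_mem subsetD)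
  \<comment> \<open>\<open>H\<close> holds the value vectors of all homomorphisms and
    \<open>N0\<close> those of scalar products, both up to errors in \<open>Y\<close>; their
    quotient represents Ext.\<close>
  define H where "H = {v. \<exists>h. homK Y h \<and> (\<forall>l<N. v l - h (ks ! l) \<in> Y)}"
  define N0 where "N0 = {v. \<exists>g. \<forall>l<N. v l - dot n g (ks ! l) \<in> Y}"
  have subN0: "V.subspace N0"
    unfolding V.subspace_def N0_def
  proof (intro conjI ballI allI)
    show "0 \<in> {v. \<exists>g. \<forall>l<N. v l - dot n g (ks ! l) \<in> Y}"
      by (intro CollectI exI[of _ "\<lambda>_. 0"]) (simp add: dot_def ideal_0[OF Y])
    fix v assume "v \<in> {v. \<exists>g. \<forall>l<N. v l - dot n g (ks ! l) \<in> Y}"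
    then obtain g where g: "\<And>l. l < N \<Longrightarrow> v l - dot n g (ks ! l) \<in> Y" by blast
    show "vscale r v \<in> {v. \<exists>g. \<forall>l<N. v l - dot n g (ks ! l) \<in> Y}" for r
    proof (intro CollectI exI[of _ "\<lambda>j. r * g j"] allI impI)
      fix l assume "l < N"
      from ideal_mult_left[OF Y g[OF this], of r]
      show "vscale r v l - dot n (\<lambda>j. r * g j) (ks ! l) \<in> Y" by (simp add: vscale_apply dot_scale_left right_diff_distrib)
    qed
    fix w assume "w \<in> {v. \<exists>g. \<forall>l<N. v l - dot n g (ks ! l) \<in> Y}"
    then obtain g' where g': "\<And>l. l < N \<Longrightarrow> w l - dot n g' (ks ! l) \<in> Y" by blast
    show "v + w \<in> {v. \<exists>g. \<forall>l<N. v l - dot n g (ks ! l) \<in> Y}"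
    proof (intro CollectI exI[of _ "\<lambda>j. g j + g' j"] allI impI)
      fix l assume "l < N"
      from ideal_add[OF Y g[OF this] g'[OF this]]
      show "(v + w) l - dot n (\<lambda>j. g j + g' j) (ks ! l) \<in> Y" by (simp add: dot_add_left algebra_simps)
    qed
  qed
  have subH: "V.subspace H"
    unfolding V.subspace_def
  proof (intro conjI ballI allI)
    have "homK Y (\<lambda>_. 0)" unfolding homK_def lin_mod_def by (simp add: ideal_0[OF Y])
    then show "0 \<in> H" unfolding H_def by (intro CollectI exI[of _ "\<lambda>_. 0"]) (simp add: ideal_0[OF Y])
    fix v assume "v \<in> H"
    then obtain h where h: "homK Y h" "\<And>l. l < N \<Longrightarrow> v l - h (ks ! l) \<in> Y" unfolding H_def by blast
    have hl: "lin_mod Y vscale (K Y) h" and hz: "\<And>c. (\<forall>j<n. c j \<in> Y) \<Longrightarrow> h c \<in> Y" using h(1) unfolding homK_def by blast+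
    show "vscale r v \<in> H" for r
    proof -
      have "homK Y (\<lambda>c. r * h c)"
        unfolding homK_def lin_mod_def
      proof (intro conjI ballI allI impI)
        fix c c' assume "c \<in> K Y" "c' \<in> K Y"
        then show "r * h (c + c') - r * h c - r * h c' \<in> Y"
          using ideal_mult_left[OF Y lin_modD(1)[OF hl, of c c'], of r] by (simp add: algebra_simps)
      next
        fix t c assume "c \<in> K Y"
        then show "r * h (vscale t c) - t * (r * h c) \<in> Y"
          using ideal_mult_left[OF Y lin_modD(2)[OF hl, of c t], of r] by (simp add: algebra_simps)
      next
        fix c assume "\<forall>j<n. c j \<in> Y"
        then show "r * h c \<in> Y" using hz ideal_mult_left[OF Y] by blast
      qed
      moreover have "vscale r v l - r * h (ks ! l) \<in> Y" if "l < N" for l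
        using ideal_mult_left[OF Y h(2)[OF that], of r] by (simp add: vscale_apply algebra_simps)
      ultimately show ?thesis unfolding H_def by blast
    qed
    fix w assume "w \<in> H"
    then obtain k where k: "homK Y k" "\<And>l. l < N \<Longrightarrow> w l - k (ks ! l) \<in> Y" unfolding H_def by blast
    have kl: "lin_mod Y vscale (K Y) k" and kz: "\<And>c. (\<forall>j<n. c j \<in> Y) \<Longrightarrow> k c \<in> Y" using k(1) unfolding homK_def by blast+
    have "homK Y (\<lambda>c. h c + k c)"
      unfolding homK_def lin_mod_def
    proof (intro conjI ballI allI impI)
      fix c c' assume "c \<in> K Y" "c' \<in> K Y"
      then show "h (c + c') + k (c + c') - (h c + k c) - (h c' + k c') \<in> Y"
        using ideal_add[OF Y lin_modD(1)[OF hl, of c c'] lin_modD(1)[OF kl, of c c']] by (simp add: algebra_simps)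
    next
      fix t c assume "c \<in> K Y"
      then show "h (vscale t c) + k (vscale t c) - t * (h c + k c) \<in> Y"
        using ideal_add[OF Y lin_modD(2)[OF hl, of c t] lin_modD(2)[OF kl, of c t]] by (simp add: algebra_simps)
    next
      fix c assume "\<forall>j<n. c j \<in> Y"
      then show "h c + k c \<in> Y" using hz kz ideal_add[OF Y] by blast
    qed
    moreover have "(v + w) l - (h (ks ! l) + k (ks ! l)) \<in> Y" if "l < N" for l
      using ideal_add[OF Y h(2)[OF that] k(2)[OF that]] by (simp add: algebra_simps)
    ultimately show "v + w \<in> H" unfolding H_def by blast
  qed
  obtain T where T': "finite T \<and> T \<subseteq> H \<and> (\<forall>v\<in>H. \<exists>w\<in>V.span T. \<forall>l<N. w l = v l)"
    using vec_fg[OF subH, of N] by (rule exE)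
  note T = conjunct1[OF T'] conjunct1[OF conjunct2[OF T']] bspec[OF conjunct2[OF conjunct2[OF T']]]
  have near: "v - w \<in> N0" if "\<And>l. l < N \<Longrightarrow> v l - w l \<in> Y" for v w
    unfolding N0_def using that by (intro CollectI exI[of _ "\<lambda>_. 0"]) (simp add: dot_def)
  have "T \<subseteq> N0"
  proof (rule nakayama[OF V.module_axioms subN0 T(1)], intro ballI)
    fix v assume "v \<in> T"
    then obtain h where h: "homK Y h" "\<And>l. l < N \<Longrightarrow> v l - h (ks ! l) \<in> Y" using T(2) unfolding H_def by blast
    obtain g f1 where g: "homK Y f1" "\<And>c. c \<in> K Y \<Longrightarrow> h c - dot n g c - y * f1 c \<in> Y"
      using homK_reduce[OF Y y yq ex h(1)] by blast
    have "val f1 \<in> H" unfolding H_def val_def using g(1) by (intro CollectI exI[of _ f1]) (simp add: ideal_0[OF Y])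
    then obtain w where w: "w \<in> V.span T" "\<And>l. l < N \<Longrightarrow> w l = val f1 l" using T(3)[of "val f1"] by blast
    obtain a where a: "w = (\<Sum>t\<in>T. vscale (a t) t)" using w(1) V.span_finite[OF T(1)] by blast
    have eq: "(\<Sum>t\<in>T. vscale (y * a t) t) = vscale y w"
      unfolding a by (simp add: V.scale_sum_right)
    have "v - vscale y w \<in> N0"
      unfolding N0_def
    proof (intro CollectI exI[of _ g] allI impI)
      fix l assume l: "l < N"
      have "(v l - h (ks ! l)) + (h (ks ! l) - dot n g (ks ! l) - y * f1 (ks ! l)) \<in> Y"
        by (rule ideal_add[OF Y h(2)[OF l] g(2)[OF ksK[OF l]]])
      moreover have "w l = f1 (ks ! l)" using w(2)[OF l] l by (simp add: val_def)
      ultimately show "(v - vscale y w) l - dot n g (ks ! l) \<in> Y" by (simp add: vscale_apply algebra_simps)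
    qed
    moreover have "\<forall>t\<in>T. y * a t \<in> m" using ideal_mult_right[OF m_ideal ym] by blast
    ultimately show "\<exists>c. (\<forall>t\<in>T. c t \<in> m) \<and> v - (\<Sum>t\<in>T. vscale (c t) t) \<in> N0"
      by (intro exI[of _ "\<lambda>t. y * a t"] conjI) (simp_all only: eq)
  qed
  then have span: "V.span T \<subseteq> N0" using subN0 by (rule V.span_minimal)
  have "val f \<in> H" unfolding H_def val_def using f by (intro CollectI exI[of _ f]) (simp add: ideal_0[OF Y])
  then obtain w where w: "w \<in> V.span T" "\<And>l. l < N \<Longrightarrow> w l = val f l" using T(3)[of "val f"] by blast
  then have "val f \<in> N0"
    using V.subspace_add[OF subN0, of "val f - w" w] near[of "val f" w] span ideal_0[OF Y] by auto
  then obtain g where g: "\<And>l. l < N \<Longrightarrow> f (ks ! l) - dot n g (ks ! l) \<in> Y" unfolding N0_def val_def by auto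
  let ?f = "\<lambda>c. f c - dot n g c"
  have hom: "homK Y ?f" by (rule homK_minus_dot[OF Y f])
  have lin: "lin_mod Y vscale (K Y) ?f" using hom unfolding homK_def by blast
  have subZ: "V.subspace {c \<in> K Y. ?f c \<in> Y}"
    unfolding V.subspace_def
  proof (intro conjI ballI allI)
    have "?f 0 \<in> Y" by (rule lin_mod_0[OF lin Y V.subspace_0[OF K_subspace]])
    then show "0 \<in> {c \<in> K Y. ?f c \<in> Y}" using V.subspace_0[OF K_subspace] by simp
    fix c assume c: "c \<in> {c \<in> K Y. ?f c \<in> Y}"
    then have cK: "c \<in> K Y" and cY: "?f c \<in> Y" by auto
    show "vscale r c \<in> {c \<in> K Y. ?f c \<in> Y}" for r
      using V.subspace_scale[OF K_subspace cK, of r] ideal_add[OF Y lin_modD(2)[OF lin cK, of r] ideal_mult_left[OF Y cY, of r]]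
      by simp
    fix c' assume "c' \<in> {c \<in> K Y. ?f c \<in> Y}"
    then have cK': "c' \<in> K Y" and cY': "?f c' \<in> Y" by auto
    show "c + c' \<in> {c \<in> K Y. ?f c \<in> Y}"
      using V.subspace_add[OF K_subspace cK cK'] ideal_add[OF Y ideal_add[OF Y lin_modD(1)[OF lin cK cK'] cY'] cY] by simp
  qed
  have "S \<subseteq> {c \<in> K Y. ?f c \<in> Y}"
    using g S(2) unfolding ks[symmetric] N_def by (auto simp: in_set_conv_nth)
  then have span2: "V.span S \<subseteq> {c \<in> K Y. ?f c \<in> Y}" using subZ by (rule V.span_minimal)
  show "\<exists>g. \<forall>c\<in>K Y. f c - dot n g c \<in> Y"
  proof (intro exI[of _ g] ballI)
    fix c assume c: "c \<in> K Y"
    obtain w where w: "w \<in> V.span S" "\<forall>j<n. w j = c j" using S(3)[OF c] by blast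
    then have wK: "w \<in> K Y" and wY: "?f w \<in> Y" using span2 by auto
    have "?f c - ?f w \<in> Y" using w(2) by (intro homK_cong[OF hom Y c wK]) auto
    then show "?f c \<in> Y" using ideal_cong_mem[OF Y] wY by blast
  qed
qed

text \<open>Y^[q] is the submodule of F_*R generated by \<open>Y\<close>, and \<open>Y\<close>
  annihilates R/Z.\<close>

lemma lin_mod_frob_pow:
  assumes Z: "ideal Z" and psi: "lin_mod Z tw UNIV \<psi>" and YZ: "Y \<subseteq> Z" and k: "k \<in> frob_pow Y q"
  shows "\<psi> k \<in> Z"
proof -
  have "ideal {k. \<forall>x. \<psi> (x * k) \<in> Z}"
    unfolding ideal_def
  proof (intro conjI ballI allI impI)
    show "0 \<in> {k. \<forall>x. \<psi> (x * k) \<in> Z}" using lin_mod_0[OF psi Z] by simp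
  next
    fix k l assume kl: "k \<in> {k. \<forall>x. \<psi> (x * k) \<in> Z}" "l \<in> {k. \<forall>x. \<psi> (x * k) \<in> Z}"
    have "\<psi> (x * (k + l)) \<in> Z" for x
    proof -
      have "\<psi> (x * k + x * l) - \<psi> (x * k) - \<psi> (x * l) \<in> Z" by (rule lin_modD(1)[OF psi]) auto
      then have "(\<psi> (x * k + x * l) - \<psi> (x * k) - \<psi> (x * l)) + \<psi> (x * k) + \<psi> (x * l) \<in> Z"
        using kl by (intro ideal_add[OF Z]) auto
      then show ?thesis by (simp add: distrib_left)
    qed
    then show "k + l \<in> {k. \<forall>x. \<psi> (x * k) \<in> Z}" by blast
  next
    fix r k assume "k \<in> {k. \<forall>x. \<psi> (x * k) \<in> Z}"
    then have "\<psi> ((x * r) * k) \<in> Z" for x by blast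
    then show "r * k \<in> {k. \<forall>x. \<psi> (x * k) \<in> Z}" by (simp add: mult.assoc)
  qed
  moreover have "a ^ q \<in> {k. \<forall>x. \<psi> (x * k) \<in> Z}" if a: "a \<in> Y" for a
  proof -
    have "\<psi> (x * a ^ q) \<in> Z" for x
    proof -
      have "\<psi> (a ^ q * x) - a * \<psi> x \<in> Z" by (rule lin_modD(2)[OF psi]) simp
      moreover have "a * \<psi> x \<in> Z" using a YZ by (intro ideal_mult_right[OF Z]) auto
      ultimately have "(\<psi> (a ^ q * x) - a * \<psi> x) + a * \<psi> x \<in> Z" by (rule ideal_add[OF Z])
      then show ?thesis by (simp add: mult.commute)
    qed
    then show ?thesis by blast
  qed
  ultimately have "frob_pow Y q \<subseteq> {k. \<forall>x. \<psi> (x * k) \<in> Z}" by (rule frob_pow_least)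
  then have "\<psi> (1 * k) \<in> Z" using k by blast
  then show ?thesis by simp
qed

text \<open>The map is lifted on the free cover. On \<open>K Y\<close> the lift has values divisible
  by \<open>y\<close>, and the quotient is a scalar product with some \<open>g\<close> since Ext
  vanishes. Subtracting \<open>y\<close> times this product makes the lift vanish on
  \<open>K Y\<close>, so it descends to F_*R.\<close>

lemma lift_step:
  assumes Y: "ideal Y" and y: "nzd Y y" and ex: "ext_vanish Y" and psi: "lin_mod (Y + prin y) tw UNIV \<psi>"
  shows "\<exists>\<phi>. lin_mod Y tw UNIV \<phi> \<and> (\<forall>x. \<phi> x - \<psi> x \<in> Y + prin y)"
proof -
  let ?Z = "Y + prin y"
  have Z: "ideal ?Z" and YZ: "Y \<subseteq> ?Z" using Y plus_left_incl[OF ideal_prin, of Y y] by (auto intro: ideal_plus)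
  have yZ: "y * t \<in> ?Z" for t using plus_right_incl[OF Y, of "prin y"] prin_mem(2)[of y t] by blast
  interpret M: module tw by (rule module_twisted)
  let ?g0 = "\<lambda>j. \<psi> (ss ! j)"
  have h0: "\<psi> (ev c) - dot n ?g0 c \<in> ?Z" for c
  proof -
    have "\<psi> (\<Sum>j<n. c j ^ q * ss ! j) - (\<Sum>j<n. c j * \<psi> (ss ! j)) \<in> ?Z"
      by (rule lin_mod_sum[OF psi Z M.module_axioms M.subspace_UNIV]) simp
    moreover have "(\<Sum>j<n. c j * \<psi> (ss ! j)) = dot n ?g0 c" unfolding dot_def by (simp add: mult.commute)
    ultimately show ?thesis unfolding ev_def by simp
  qed
  have hom0: "homK Y (dot n ?g0)"
    unfolding homK_def lin_mod_def using dot_mem[OF Y, of n] by (simp add: dot_add dot_scale ideal_0[OF Y])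
  have "dot n ?g0 c \<in> ?Z" if c: "c \<in> K Y" for c
  proof -
    have "\<psi> (ev c) \<in> ?Z" using c unfolding K_def by (intro lin_mod_frob_pow[OF Z psi YZ]) simp
    then show ?thesis using ideal_cong_mem[OF Z h0] by blast
  qed
  from homK_divide[OF Y y hom0 this]
  obtain f where f: "homK Y f" "\<And>c. c \<in> K Y \<Longrightarrow> dot n ?g0 c - y * f c \<in> Y" by blast
  then obtain g where g: "\<And>c. c \<in> K Y \<Longrightarrow> f c - dot n g c \<in> Y" using ex unfolding ext_vanish_def by blast
  define h1 where "h1 c = dot n ?g0 c - y * dot n g c" for c
  have h1K: "h1 c \<in> Y" if c: "c \<in> K Y" for c
    by (rule ideal_lin_mem[OF Y f(2)[OF c] g[OF c], where r = 1 and s = y]) (simp add: h1_def algebra_simps)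
  have h1_add: "h1 (c + c') = h1 c + h1 c'" for c c' by (simp add: h1_def dot_add algebra_simps)
  have h1_diff: "h1 (c - c') = h1 c - h1 c'" for c c' by (simp add: h1_def dot_diff algebra_simps)
  have h1_scale: "h1 (vscale r c) = r * h1 c" for r c by (simp add: h1_def dot_scale algebra_simps)
  define \<phi> where "\<phi> x = h1 (SOME c. ev c = x)" for x
  have key: "\<phi> (ev c) - h1 c \<in> Y" for c
  proof -
    let ?c = "SOME c'. ev c' = ev c"
    have "ev ?c = ev c" by (rule someI[of _ c]) simp
    then have "?c - c \<in> K Y" unfolding K_def by (simp add: ev_diff ideal_0[OF frob_pow_ideal])
    from h1K[OF this] show ?thesis unfolding \<phi>_def by (simp add: h1_diff)
  qed
  have "lin_mod Y tw UNIV \<phi>"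
    unfolding lin_mod_def
  proof (intro conjI ballI allI)
    fix a b
    obtain c c' where c: "a = ev c" "b = ev c'" using ev_surj by metis
    have "(\<phi> (ev (c + c')) - h1 (c + c')) - (\<phi> (ev c) - h1 c) - (\<phi> (ev c') - h1 c') \<in> Y"
      by (intro ideal_diff[OF Y] key)
    then show "\<phi> (a + b) - \<phi> a - \<phi> b \<in> Y" unfolding c by (simp add: ev_add h1_add algebra_simps)
  next
    fix r b
    obtain c where c: "b = ev c" using ev_surj by metis
    have "(\<phi> (ev (vscale r c)) - h1 (vscale r c)) - r * (\<phi> (ev c) - h1 c) \<in> Y"
      by (intro ideal_diff[OF Y] ideal_mult_left[OF Y] key)
    then show "\<phi> (r ^ q * b) - r * \<phi> b \<in> Y" unfolding c by (simp add: ev_scale h1_scale algebra_simps)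
  qed
  moreover have "\<phi> x - \<psi> x \<in> ?Z" for x
  proof -
    obtain c where c: "x = ev c" using ev_surj by metis
    have k: "\<phi> (ev c) - h1 c \<in> ?Z" using key YZ by blast
    have "(\<phi> (ev c) - h1 c) - (\<psi> (ev c) - dot n ?g0 c) - y * dot n g c \<in> ?Z"
      by (intro ideal_diff[OF Z] k h0 yZ)
    then show ?thesis unfolding c h1_def by (simp add: algebra_simps)
  qed
  ultimately show ?thesis by blast
qed

text \<open>Vanishing of Ext spreads from the Artinian end of the sequence back to \<open>Y\<close>,
  and homomorphisms are lifted through the same ideals. The hypothesis on \<open>q\<close>-th powers
  says that \<open>ys\<close> is regular also on F_*R modulo \<open>Y\<close>.\<close>

lemma lift_regseq:
  assumes "ideal Y" "set ys \<subseteq> m" "regseq Y ys" "regseq (frob_pow Y q) (map (\<lambda>y. y ^ q) ys)"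
    "mprim (Y + ig ys)" "type1 (Y + ig ys)"
  shows "ext_vanish Y \<and> (\<forall>\<psi>. lin_mod (Y + ig ys) tw UNIV \<psi> \<longrightarrow>
    (\<exists>\<phi>. lin_mod Y tw UNIV \<phi> \<and> (\<forall>x. \<phi> x - \<psi> x \<in> Y + ig ys)))"
  using assms
proof (induction ys arbitrary: Y)
  case Nil
  have "\<phi> x - \<phi> x \<in> Y" for \<phi> :: "'a \<Rightarrow> 'a" and x using ideal_0[OF Nil(1)] by simp
  then show ?case using Nil ext_vanish_base[of Y] by auto
next
  case (Cons y ys)
  note Y = Cons.prems(1)
  have Z: "ideal (Y + prin y)" using Y by (simp add: ideal_plus)
  have fz: "frob_pow (Y + prin y) q = frob_pow Y q + prin (y ^ q)"
    by (simp add: frob_pow_plus[OF q Y ideal_prin] frob_pow_prin[OF q])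
  have eq: "Y + prin y + ig ys = Y + ig (y # ys)" by (simp add: add.assoc)
  have ny: "nzd Y y" "nzd (frob_pow Y q) (y ^ q)" "y \<in> m" using Cons.prems by auto
  have IH: "ext_vanish (Y + prin y) \<and> (\<forall>\<psi>. lin_mod (Y + ig (y # ys)) tw UNIV \<psi> \<longrightarrow>
    (\<exists>\<phi>. lin_mod (Y + prin y) tw UNIV \<phi> \<and> (\<forall>x. \<phi> x - \<psi> x \<in> Y + ig (y # ys))))"
    using Cons.IH[OF Z] Cons.prems unfolding eq fz by simp
  have ex: "ext_vanish Y" using IH by (intro ext_vanish_step[OF Y ny(3,1,2)]) blast
  show ?case
  proof (intro conjI ex allI impI)
    fix \<psi> assume "lin_mod (Y + ig (y # ys)) tw UNIV \<psi>"
    then obtain \<phi>1 where 1: "lin_mod (Y + prin y) tw UNIV \<phi>1" "\<And>x. \<phi>1 x - \<psi> x \<in> Y + ig (y # ys)" using IH by blast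
    obtain \<phi> where 2: "lin_mod Y tw UNIV \<phi>" "\<And>x. \<phi> x - \<phi>1 x \<in> Y + prin y" using lift_step[OF Y ny(1) ex 1(1)] by blast
    have id: "ideal (Y + ig (y # ys))" by (rule ideal_plus[OF Y ideal_ig])
    have "Y + prin y \<subseteq> Y + ig (y # ys)" unfolding eq[symmetric] by (rule plus_left_incl[OF ideal_ig])
    then have "\<phi> x - \<phi>1 x \<in> Y + ig (y # ys)" for x using 2(2) by blast
    then have "(\<phi> x - \<phi>1 x) + (\<phi>1 x - \<psi> x) \<in> Y + ig (y # ys)" for x by (intro ideal_add[OF id] 1(2))
    then have "\<phi> x - \<psi> x \<in> Y + ig (y # ys)" for x by simp
    then show "\<exists>\<phi>. lin_mod Y tw UNIV \<phi> \<and> (\<forall>x. \<phi> x - \<psi> x \<in> Y + ig (y # ys))" using 2(1) by blast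
  qed
qed

lemma lift_hom:
  assumes "lin_mod J tw UNIV \<psi>"
  obtains \<phi> where "\<And>a b. \<phi> (a + b) = \<phi> a + \<phi> b" "\<And>r x. \<phi> (r ^ q * x) = r * \<phi> x" "\<And>x. \<phi> x - \<psi> x \<in> J"
proof -
  have "regseq (frob_pow {0} q) (map (\<lambda>y. y ^ q) xs)"
    using regseq_powers[OF ideal_zero xs_m xs_reg frobq_pos[OF q]] by (simp add: frob_pow_zero[OF q])
  then have "\<exists>\<phi>. lin_mod {0} tw UNIV \<phi> \<and> (\<forall>x. \<phi> x - \<psi> x \<in> J)"
    using lift_regseq[OF ideal_zero xs_m xs_reg] xs_prim xs_type1 assms by simp
  then obtain \<phi> where p: "lin_mod {0} tw UNIV \<phi>" "\<And>x. \<phi> x - \<psi> x \<in> J" by blast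
  show ?thesis
  proof (rule that[of \<phi>])
    show "\<phi> (a + b) = \<phi> a + \<phi> b" for a b using lin_modD(1)[OF p(1), of a b] by (simp add: algebra_simps)
    show "\<phi> (r ^ q * x) = r * \<phi> x" for r x using lin_modD(2)[OF p(1), of x r] by simp
  qed (rule p(2))
qed

end

section \<open>The F-signature\<close>

context frob_cover
begin

text \<open>For \<open>r\<close> outside I_q the map from t to t^q r embeds R/J into F_*R modulo
  \<open>J\<close>, as its kernel would otherwise contain the socle. The inverse on the image
  extends by self-injectivity and lifts to a homomorphism into \<open>R\<close> with a unit value at
  \<open>r\<close>.\<close>

lemma splitting:
  assumes u: "u \<notin> J" "\<And>r. r \<in> m \<Longrightarrow> r * u \<in> J" "\<And>v. (\<forall>r\<in>m. r * v \<in> J) \<Longrightarrow> v \<in> J + prin u"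
    and r: "r \<notin> Iq u q"
  obtains \<phi> where "\<And>a b. \<phi> (a + b) = \<phi> a + \<phi> b" "\<And>t x. \<phi> (t ^ q * x) = t * \<phi> x" "\<phi> r = 1"
proof -
  let ?Jq = "frob_pow J q"
  let ?T = "{t. t ^ q * r \<in> ?Jq}"
  interpret M: module tw by (rule module_twisted)
  have T: "ideal ?T" by (rule ideal_twisted_colon[OF q ideal_submod[OF frob_pow_ideal]])
  have JT: "J \<subseteq> ?T" using ideal_mult_right[OF frob_pow_ideal frob_pow_mem] by blast
  have TJ: "?T = J"
  proof (rule ccontr)
    assume "?T \<noteq> J"
    then have "1 \<le> elen ideal J ?T" using JT T by (intro elen_ge_1) auto
    moreover have "elen ideal J ?T \<noteq> \<infinity>"
      using IL.elen_add[OF ideal_UNIV ideal_ig T JT subset_UNIV] mprim_elen_finite[OF xs_prim]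
      by (cases "elen ideal J ?T") simp_all
    ultimately obtain k where k: "elen ideal J ?T = enat (Suc k)"
      by (cases "elen ideal J ?T") (auto simp: one_enat_def Suc_le_D dest!: Suc_le_D)
    obtain a where a: "a \<in> ?T" "a \<notin> J" "\<And>r. r \<in> m \<Longrightarrow> r * a \<in> J"
      using simple_step[OF ideal_ig T JT k] by metis
    have "a \<in> J + prin u" using a(3) by (intro u(3)) blast
    then obtain s where s: "a - s * u \<in> J" using mem_plus_prin[OF ideal_ig] by blast
    have "s \<notin> m" using u(2) s a(2) ideal_cong_mem[OF ideal_ig s] by blast
    then obtain s' where s': "s' * s = 1" using unit_ex by blast
    have sT: "a - s * u \<in> ?T" using s JT by blast
    have "s' * (s * u) = u" using s' by (simp add: mult.assoc[symmetric])
    then have "u = s' * a + (- s') * (a - s * u)" by (simp add: algebra_simps)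
    then have "u \<in> ?T" using ideal_lin_mem[OF T a(1) sT] by blast
    then show False using r by (simp add: Iq_def mult.commute)
  qed
  \<comment> \<open>The inverse of the embedding, with values determined modulo
    \<open>J\<close>.\<close>
  define f where "f x = (SOME t. x - t ^ q * r \<in> ?Jq)" for x
  have key: "f x - t \<in> J" if x: "x - t ^ q * r \<in> ?Jq" for x t
  proof -
    have fx: "x - f x ^ q * r \<in> ?Jq"
      unfolding f_def using x by (rule someI[of "\<lambda>t. x - t ^ q * r \<in> ?Jq"])
    have "(x - t ^ q * r) - (x - f x ^ q * r) \<in> ?Jq" by (rule ideal_diff[OF frob_pow_ideal x fx])
    then have "(f x - t) ^ q * r \<in> ?Jq" by (simp add: frob_diff[OF q] algebra_simps)
    then show ?thesis using TJ by blast
  qed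
  define N where "N = {x. \<exists>t. x - t ^ q * r \<in> ?Jq}"
  have addN: "(x + y) - (t + t') ^ q * r \<in> ?Jq" if xy: "x - t ^ q * r \<in> ?Jq" "y - t' ^ q * r \<in> ?Jq" for x y t t'
    using ideal_add[OF frob_pow_ideal xy] by (simp add: frob_add[OF q] algebra_simps)
  have scaleN: "s ^ q * x - (s * t) ^ q * r \<in> ?Jq" if x: "x - t ^ q * r \<in> ?Jq" for x s t
    using ideal_mult_left[OF frob_pow_ideal x, of "s ^ q"] by (simp add: power_mult_distrib algebra_simps)
  have JN: "x \<in> N" if "x \<in> ?Jq" for x
    unfolding N_def using that by (intro CollectI exI[of _ 0]) (simp add: frob_zero[OF q])
  have subN: "M.subspace N"
    unfolding M.subspace_def
  proof (intro conjI ballI allI)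
    show "0 \<in> N" by (rule JN[OF ideal_0[OF frob_pow_ideal]])
    fix x assume "x \<in> N"
    then obtain t where t: "x - t ^ q * r \<in> ?Jq" unfolding N_def by blast
    show "s ^ q * x \<in> N" for s unfolding N_def using scaleN[OF t, of s] by blast
    fix y assume "y \<in> N"
    then obtain t' where t': "y - t' ^ q * r \<in> ?Jq" unfolding N_def by blast
    show "x + y \<in> N" unfolding N_def using addN[OF t t'] by blast
  qed
  have lin: "lin_mod J tw N f"
    unfolding lin_mod_def
  proof (intro conjI ballI allI)
    fix x assume "x \<in> N"
    then obtain t where t: "x - t ^ q * r \<in> ?Jq" unfolding N_def by blast
    {
      fix y assume "y \<in> N"
      then obtain t' where t': "y - t' ^ q * r \<in> ?Jq" unfolding N_def by blast
      have "(f (x + y) - (t + t')) - (f x - t) - (f y - t') \<in> J"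
        by (rule ideal_diff[OF ideal_ig ideal_diff[OF ideal_ig key[OF addN[OF t t']] key[OF t]] key[OF t']])
      then show "f (x + y) - f x - f y \<in> J" by (simp add: algebra_simps)
    }
    fix s
    have "(f (s ^ q * x) - s * t) - s * (f x - t) \<in> J"
      by (rule ideal_diff[OF ideal_ig key[OF scaleN[OF t]] ideal_mult_left[OF ideal_ig key[OF t]]])
    then show "f (s ^ q * x) - s * f x \<in> J" by (simp add: algebra_simps)
  qed
  have QN: "t ^ q * x \<in> N \<and> f (t ^ q * x) \<in> J" if t: "t \<in> J" for t x
  proof -
    have tJ: "t ^ q * x \<in> ?Jq" by (rule ideal_mult_right[OF frob_pow_ideal frob_pow_mem[OF t]])
    then have "t ^ q * x - 0 ^ q * r \<in> ?Jq" by (simp add: frob_zero[OF q])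
    from key[OF this] show ?thesis using JN[OF tJ] by simp
  qed
  obtain f' N' where f': "M.subspace N' \<and> N \<subseteq> N' \<and> set ss \<subseteq> N' \<and> lin_mod J tw N' f' \<and> (\<forall>x\<in>N. f' x - f x \<in> J)"
    using injective_extend[OF xs_prim xs_type1 module_twisted subN lin QN, of ss] by blast
  have "submod q N'" using f' unfolding M.subspace_def submod_def by blast
  then have "qspan q ss \<subseteq> N'" using f' by (intro qspan_subset) blast+
  then have N'U: "N' = UNIV" using ss by blast
  have "r - 1 ^ q * r \<in> ?Jq" by (simp add: ideal_0[OF frob_pow_ideal])
  then have f1: "f r - 1 \<in> J" and rN: "r \<in> N" using key unfolding N_def by blast+
  have lin': "lin_mod J tw UNIV f'" using f' N'U by blast
  obtain \<phi> where phi: "\<And>a b. \<phi> (a + b) = \<phi> a + \<phi> b" "\<And>r x. \<phi> (r ^ q * x) = r * \<phi> x" "\<And>x. \<phi> x - f' x \<in> J"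
    using lift_hom[OF lin'] by blast
  have f'r: "f' r - f r \<in> J" using f' rN by blast
  have "(\<phi> r - f' r) + (f' r - f r) + (f r - 1) \<in> J" by (intro ideal_add[OF ideal_ig] phi(3) f'r f1)
  then have "\<phi> r - 1 \<in> m" using J_m by auto
  then have "\<phi> r \<notin> m" using ideal_cong_mem[OF m_ideal] one_notin_m by blast
  then obtain w where w: "w * \<phi> r = 1" using unit_ex by blast
  show ?thesis
  proof (rule that[of "\<lambda>x. w * \<phi> x"])
    show "w * \<phi> (a + b) = w * \<phi> a + w * \<phi> b" for a b by (simp add: phi(1) distrib_left)
    show "w * \<phi> (t ^ q * x) = t * (w * \<phi> x)" for t x by (simp add: phi(2) mult.left_commute)
  qed (rule w)
qed

text \<open>By linearity \<open>\<phi>\<close> sends \<open>u ^ q * x\<close> to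
  \<open>u * \<phi> x\<close>, which lies in \<open>J\<close>; a unit value \<open>\<phi> x\<close>
  would put \<open>u\<close> into \<open>J\<close>.\<close>

lemma hom_Iq_m:
  assumes u: "u \<notin> J" and add: "\<And>a b. \<phi> (a + b) = \<phi> a + \<phi> b" and scale: "\<And>t x. \<phi> (t ^ q * x) = t * \<phi> x"
    and x: "x \<in> Iq u q"
  shows "\<phi> x \<in> m"
proof (rule ccontr)
  assume "\<phi> x \<notin> m"
  have "lin_mod J tw UNIV \<phi>" unfolding lin_mod_def by (simp add: add scale ideal_0)
  then have "\<phi> (x * u ^ q) \<in> J" using x unfolding Iq_def by (intro lin_mod_frob_pow[OF ideal_ig _ subset_refl]) auto
  then have "\<phi> x * u \<in> J" using scale[of u x] by (simp add: mult.commute)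
  then show False using unit_mult_mem[OF ideal_ig \<open>\<phi> x \<notin> m\<close>] u by blast
qed

text \<open>The condition inside \<open>free_rank_frob\<close>, isolated so that it can be folded
  there.\<close>

definition dual_system :: "nat \<Rightarrow> (nat \<Rightarrow> 'a \<Rightarrow> 'a) \<Rightarrow> (nat \<Rightarrow> 'a) \<Rightarrow> bool" where
  "dual_system k \<phi> y \<longleftrightarrow>
    (\<forall>i<k. (\<forall>a b. \<phi> i (a + b) = \<phi> i a + \<phi> i b) \<and> (\<forall>r x. \<phi> i (r ^ q * x) = r * \<phi> i x)) \<and>
    (\<forall>i<k. \<forall>j<k. \<phi> i (y j) = (if i = j then 1 else 0))"

lemma hom_sum:
  fixes \<phi> :: "'a \<Rightarrow> 'a"
  assumes "\<And>a b. \<phi> (a + b) = \<phi> a + \<phi> b"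
  shows "\<phi> (sum f A) = (\<Sum>i\<in>A. \<phi> (f i))"
proof -
  have "\<phi> 0 = 0" using assms[of 0 0] by simp
  then show ?thesis by (induction A rule: infinite_finite_induct) (auto simp: assms)
qed

text \<open>Adding the \<open>y i\<close> to I_q one at a time gives a strict chain:
  \<open>\<phi> i\<close> maps I_q into \<open>m\<close> and kills the earlier vectors, yet takes
  the value 1 at \<open>y i\<close>.\<close>

lemma dual_system_le:
  assumes u: "u \<notin> J" and ds: "dual_system k \<phi> y"
  shows "k \<le> len (Iq u q)"
proof -
  interpret SL: subgroup_lattice "submod q :: 'a set \<Rightarrow> bool" by (rule subgroup_lattice_submod[OF q])
  define E where "E i = Iq u q + qspan q (map y [0..<i])" for i
  have subE: "submod q (E i)" for i
    unfolding E_def by (rule submod_plus[OF ideal_submod[OF ideal_Iq] submod_qspan[OF q]])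
  have E_Suc: "E (Suc i) = E i + cyc q (y i)" for i by (simp add: E_def qspan_append add.assoc)
  have E_mono: "E i \<subseteq> E (Suc i)" for i
    unfolding E_Suc using set_zero_plus2[OF submod_0[OF submod_cyc[OF q, of "y i"]], of "E i"] by (simp only: add.commute)
  have yE: "y i \<in> E (Suc i)" for i
    unfolding E_Suc using set_zero_plus2[OF submod_0[OF subE[of i]], of "cyc q (y i)"] cyc_self by blast
  have ny: "y i \<notin> E i" if i: "i < k" for i
  proof
    assume yi: "y i \<in> E i"
    have add: "\<And>a b. \<phi> i (a + b) = \<phi> i a + \<phi> i b" and scale: "\<And>r x. \<phi> i (r ^ q * x) = r * \<phi> i x"
      using ds i unfolding dual_system_def by blast+
    have "submod q {v. \<phi> i v \<in> m}"
      unfolding submod_def using hom_sum[OF add, of _ "{}"] by (auto simp: add scale intro: ideal_rules)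
    moreover have "Iq u q \<subseteq> {v. \<phi> i v \<in> m}" using hom_Iq_m[OF u add scale] by blast
    moreover have "set (map y [0..<i]) \<subseteq> {v. \<phi> i v \<in> m}"
      using ds i unfolding dual_system_def by (auto simp: ideal_0)
    ultimately have "E i \<subseteq> {v. \<phi> i v \<in> m}" unfolding E_def by (intro submod_plus_subset[of q] qspan_subset)
    then have "\<phi> i (y i) \<in> m" using yi by blast
    moreover have "\<phi> i (y i) = 1" using ds i unfolding dual_system_def by simp
    ultimately show False by simp
  qed
  have "enat (card {i. i < k \<and> E i \<noteq> E (Suc i)}) \<le> elen (submod q) (E 0) (E k) \<and> E 0 \<subseteq> E k"
    by (rule SL.weak_chain_le) (auto simp: subE intro: subsetD[OF E_mono])
  moreover have "{i. i < k \<and> E i \<noteq> E (Suc i)} = {..<k}" using ny yE by blast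
  moreover have "elen (submod q) (E 0) (E k) \<le> elen (submod q) (E 0) UNIV"
    using calculation(1) by (intro SL.elen_mono subE) auto
  moreover have "E 0 = Iq u q" by (simp add: E_def)
  moreover have "elen (submod q) (Iq u q) UNIV = enat (len (Iq u q))"
    using finite_len_qspan[OF q ideal_Iq ideal_UNIV subset_UNIV elen_eq_len[OF mprim_Iq[OF q, of u]]] by blast
  ultimately have "enat k \<le> enat (len (Iq u q))" by (metis card_lessThan order_trans)
  then show ?thesis by simp
qed

text \<open>If the common kernel of the forms lay in I_q, F_*R modulo I_q would be spanned by
  \<open>k\<close> vectors killed by \<open>m\<close>, too few for its length. A kernel vector
  \<open>v\<close> outside I_q splits off, and the new form is corrected so as to vanish on the old
  vectors.\<close>

lemma dual_system_extend:
  assumes u: "u \<notin> J" "\<And>r. r \<in> m \<Longrightarrow> r * u \<in> J" "\<And>v. (\<forall>r\<in>m. r * v \<in> J) \<Longrightarrow> v \<in> J + prin u"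
    and ds: "dual_system k \<phi> y" and k: "k < len (Iq u q)"
  shows "\<exists>\<phi> y. dual_system (Suc k) \<phi> y"
proof -
  have add: "\<And>i a b. i < k \<Longrightarrow> \<phi> i (a + b) = \<phi> i a + \<phi> i b" and scale: "\<And>i r x. i < k \<Longrightarrow> \<phi> i (r ^ q * x) = r * \<phi> i x"
    and dual: "\<And>i j. i < k \<Longrightarrow> j < k \<Longrightarrow> \<phi> i (y j) = (if i = j then 1 else 0)"
    using ds unfolding dual_system_def by blast+
  have "\<exists>v. v \<notin> Iq u q \<and> (\<forall>i<k. \<phi> i v = 0)"
  proof (rule ccontr)
    assume "\<nexists>v. v \<notin> Iq u q \<and> (\<forall>i<k. \<phi> i v = 0)"
    then have H: "\<And>v. (\<forall>i<k. \<phi> i v = 0) \<Longrightarrow> v \<in> Iq u q" by blast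
    let ?ys = "map y [0..<k]"
    have "v \<in> Iq u q + qspan q ?ys" for v
    proof -
      let ?w = "\<Sum>j<k. \<phi> j v ^ q * y j"
      have "\<phi> i (v - ?w) = 0" if i: "i < k" for i
      proof -
        have "\<phi> i ?w = (\<Sum>j<k. \<phi> j v * \<phi> i (y j))" by (simp add: hom_sum[OF add[OF i]] scale[OF i])
        also have "\<dots> = (\<Sum>j<k. if j = i then \<phi> j v else 0)" by (rule sum.cong) (auto simp: dual i)
        also have "\<dots> = \<phi> i v" using i by simp
        finally show ?thesis using add[OF i, of "v - ?w" ?w] by simp
      qed
      then have "v - ?w \<in> Iq u q" by (intro H) blast
      moreover have "?w \<in> qspan q ?ys"
        using qspan_incl[OF q, of ?ys] by (intro submod_sum[OF submod_qspan[OF q]] submod_scale[OF submod_qspan[OF q]]) auto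
      ultimately have "(v - ?w) + ?w \<in> Iq u q + qspan q ?ys" by (rule set_plus_intro)
      then show ?thesis by simp
    qed
    then have U: "Iq u q + qspan q ?ys = UNIV" by blast
    have "elen (submod q) (Iq u q) (Iq u q + qspan q ?ys) \<le> enat (length ?ys) * elen ideal m UNIV"
    proof (rule elen_qspan_le[OF q ideal_submod[OF ideal_Iq] m_ideal])
      fix a r assume "r \<in> m"
      then have "r ^ q \<in> Iq u q" using frob_pow_mem[of r m q] frob_m_Iq[OF q u(2)] by blast
      then show "r ^ q * a \<in> Iq u q" by (rule ideal_mult_right[OF ideal_Iq])
    qed
    moreover have "elen (submod q) (Iq u q) UNIV = enat (len (Iq u q))"
      using finite_len_qspan[OF q ideal_Iq ideal_UNIV subset_UNIV elen_eq_len[OF mprim_Iq[OF q, of u]]] by blast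
    ultimately have "len (Iq u q) \<le> k" unfolding U elen_m by simp
    then show False using k by simp
  qed
  then obtain v where v: "v \<notin> Iq u q" "\<And>i. i < k \<Longrightarrow> \<phi> i v = 0" by blast
  obtain \<psi> where psi: "\<And>a b. \<psi> (a + b) = \<psi> a + \<psi> b" "\<And>t x. \<psi> (t ^ q * x) = t * \<psi> x" "\<psi> v = 1"
    using splitting[OF u v(1)] by blast
  define \<psi>' where "\<psi>' x = \<psi> x - (\<Sum>i<k. \<psi> (y i) * \<phi> i x)" for x
  have p1: "\<psi>' (a + b) = \<psi>' a + \<psi>' b" for a b
    by (simp add: \<psi>'_def psi(1) add distrib_left sum.distrib)
  have p2: "\<psi>' (t ^ q * x) = t * \<psi>' x" for t x
    by (simp add: \<psi>'_def psi(2) scale right_diff_distrib sum_distrib_left mult.left_commute)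
  have p3: "\<psi>' v = 1" by (simp add: \<psi>'_def psi(3) v(2))
  have p4: "\<psi>' (y j) = 0" if j: "j < k" for j
  proof -
    have "(\<Sum>i<k. \<psi> (y i) * \<phi> i (y j)) = (\<Sum>i<k. if i = j then \<psi> (y i) else 0)"
      by (rule sum.cong) (auto simp: dual j)
    then show ?thesis using j by (simp add: \<psi>'_def)
  qed
  have "dual_system (Suc k) (\<phi>(k := \<psi>')) (y(k := v))"
    unfolding dual_system_def using add scale dual p1 p2 p3 p4 v(2) by (auto simp: less_Suc_eq)
  then show ?thesis by blast
qed

lemma free_rank_eq:
  assumes u: "u \<notin> J" "\<And>r. r \<in> m \<Longrightarrow> r * u \<in> J" "\<And>v. (\<forall>r\<in>m. r * v \<in> J) \<Longrightarrow> v \<in> J + prin u"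
  shows "free_rank_frob q TYPE('a) = len (Iq u q)"
proof -
  let ?S = "{k. \<exists>\<phi> y. dual_system k \<phi> y}"
  have "k \<le> len (Iq u q) \<Longrightarrow> k \<in> ?S" for k
  proof (induction k)
    case 0
    have "dual_system 0 (\<lambda>_ _. 0) (\<lambda>_. 0)" by (simp add: dual_system_def)
    then show ?case by blast
  next
    case (Suc k)
    then obtain \<phi> y where "dual_system k \<phi> y" by auto
    then show ?case using dual_system_extend[OF u] Suc.prems by auto
  qed
  moreover have "k \<le> len (Iq u q)" if "k \<in> ?S" for k using that dual_system_le[OF u(1)] by blast
  ultimately have "?S = {..len (Iq u q)}" by blast
  then show ?thesis unfolding free_rank_frob_def dual_system_def[symmetric] by (simp add: cSup_eq_maximum[of "len (Iq u q)"])
qed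

end

section \<open>Passage to the limit\<close>

context gorenstein_frob
begin

text \<open>Over a perfect field \<open>y 0\<close> and \<open>y 1\<close> are \<open>p\<close>-th
  powers of some \<open>b0\<close> and \<open>b1\<close>, so the coefficients \<open>b1\<close> and
  \<open>- b0\<close> give a relation over \<open>p\<close>-th powers.\<close>

lemma residue_frob_degree_eq: "residue_frob_degree p m = 1"
proof -
  let ?S = "{n. \<exists>y :: nat \<Rightarrow> 'a. \<forall>c :: nat \<Rightarrow> 'a. (\<Sum>i<n. c i ^ p * y i) \<in> m \<longrightarrow> (\<forall>i<n. c i \<in> m)}"
  have "n \<le> 1" if nS: "n \<in> ?S" for n
  proof (rule ccontr)
    assume "\<not> n \<le> 1"
    then have n: "0 < n" "1 < n" by auto
    obtain y :: "nat \<Rightarrow> 'a" where y: "\<And>c :: nat \<Rightarrow> 'a. (\<Sum>i<n. c i ^ p * y i) \<in> m \<Longrightarrow> (\<forall>i<n. c i \<in> m)" using nS by blast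
    obtain b0 where b0: "y 0 - b0 ^ p \<in> m" using frob_perfect[OF frobq_p] by blast
    obtain b1 where b1: "y 1 - b1 ^ p \<in> m" using frob_perfect[OF frobq_p] by blast
    have sum01: "(\<Sum>i<n. (if i = 0 then s else if i = 1 then t else 0) ^ p * y i) = s ^ p * y 0 + t ^ p * y 1" for s t
    proof -
      have "(\<Sum>i<n. (if i = 0 then s else if i = 1 then t else 0) ^ p * y i)
          = (\<Sum>i<n. (if i = 0 then s ^ p * y 0 else 0) + (if i = 1 then t ^ p * y 1 else 0))"
        by (rule sum.cong) (auto simp: frob_zero)
      then show ?thesis using n by (simp add: sum.distrib)
    qed
    have "b1 ^ p * y 0 + (- b0) ^ p * y 1 = b1 ^ p * (y 0 - b0 ^ p) + (- (b0 ^ p)) * (y 1 - b1 ^ p)"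
      by (simp add: frob_minus[OF frobq_p] algebra_simps)
    then have "b1 ^ p * y 0 + (- b0) ^ p * y 1 \<in> m" using ideal_lin_mem[OF m_ideal b0 b1] by blast
    then have "(\<Sum>i<n. (if i = 0 then b1 else if i = 1 then - b0 else 0) ^ p * y i) \<in> m" unfolding sum01 .
    then have "\<forall>i<n. (if i = 0 then b1 else if i = 1 then - b0 else 0) \<in> m" by (rule y)
    from this[rule_format, OF n(2)] have "- b0 \<in> m" by simp
    then have "b0 \<in> m" using ideal_uminus[OF m_ideal, of "- b0"] by simp
    then have "b0 ^ p \<in> m" using p_gt_1 by (intro power_mem_m) auto
    \<comment> \<open>The relation could only be trivial with \<open>y 0\<close> in
      \<open>m\<close>; but then 1 is the coefficient of a relation consisting of \<open>y 0\<close>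
      alone.\<close>
    then have "y 0 \<in> m" using ideal_cong_mem[OF m_ideal b0] by blast
    then have "1 ^ p * y 0 + 0 ^ p * y 1 \<in> m" by (simp add: frob_zero)
    then have "(\<Sum>i<n. (if i = 0 then 1 else if i = 1 then 0 else 0) ^ p * y i) \<in> m" unfolding sum01 .
    then have "\<forall>i<n. (if i = 0 then 1 else if i = 1 then 0 else 0) \<in> m" by (rule y)
    from this[rule_format, OF n(1)] show False using one_notin_m by simp
  qed
  moreover have "1 \<in> ?S"
  proof (intro CollectI exI[of _ "\<lambda>_. 1"] allI impI)
    fix c :: "nat \<Rightarrow> 'a" and i assume "(\<Sum>i<1. c i ^ p * 1) \<in> m" "i < (1 :: nat)"
    then show "c i \<in> m" using m_power[of "c 0" p] by simp
  qed
  ultimately show ?thesis unfolding residue_frob_degree_def by (intro cSup_eq_maximum) auto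
qed

text \<open>Over a perfect residue field the exponent is just \<open>d\<close>, and the free rank is
  a difference of two Hilbert-Kunz functions by \<open>len_Iq\<close>.\<close>

lemma F_signature_lim:
  assumes u: "u \<notin> J" "\<And>r. r \<in> m \<Longrightarrow> r * u \<in> J" "\<And>v. (\<forall>r\<in>m. r * v \<in> J) \<Longrightarrow> v \<in> J + prin u"
  shows "(\<lambda>e. real (len (Iq u (p ^ e))) / real (p ^ e) ^ d) \<longlonglongrightarrow> F_signature p m d"
proof -
  have rank: "free_rank_frob (p ^ e) TYPE('a) = len (Iq u (p ^ e))" for e
  proof -
    obtain ss :: "'a list" where ss: "UNIV = qspan (p ^ e) ss" using finite_gens[OF frobq_power] .
    interpret FC: frob_cover m p xs "p ^ e" ss by unfold_locales (simp_all add: ss[symmetric])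
    show ?thesis by (rule FC.free_rank_eq[OF u])
  qed
  have "alpha_F p m = 0" by (simp add: alpha_F_def residue_frob_degree_eq)
  then have pw: "real (p ^ e) powr (real d + alpha_F p m) = real (p ^ e) ^ d" for e
    using p_gt_1 by (simp add: powr_realpow)
  let ?A = "\<lambda>e. real (len (Iq u (p ^ e))) / real (p ^ e) ^ d"
  have pU: "mprim (J + prin u)" by (rule mprim_mono[OF xs_prim ideal_plus plus_left_incl]) auto
  have "?A e = real (len (frob_pow J (p ^ e))) / real (p ^ e) ^ d - real (len (frob_pow (J + prin u) (p ^ e))) / real (p ^ e) ^ d" for e
  proof -
    have "real (len (Iq u (p ^ e))) + real (len (frob_pow (J + prin u) (p ^ e))) = real (len (frob_pow J (p ^ e)))"
      using len_Iq[OF frobq_power, of u e] by (simp only: of_nat_add[symmetric])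
    then show ?thesis by (simp add: diff_divide_distrib[symmetric])
  qed
  then have "convergent ?A"
    using convergent_diff[OF hk_convergent[OF xs_prim] hk_convergent[OF pU]] by simp
  then show ?thesis
    unfolding F_signature_def rank pw by (simp add: convergent_LIMSEQ_iff)
qed

lemma hk_lower_bound:
  fixes I :: "'a set"
  assumes I: "ideal I" "J \<subseteq> I" and int: "\<And>a. a \<in> m \<Longrightarrow> integral_over_ideal J a"
  shows "let e = hs_mult m d; s = F_signature p m d; \<mu> = real (mu_quot I J)
         in hk_mult p m d \<ge> (e - s * \<mu>) / (e - \<mu>) \<and> hk_mult p m d \<ge> 1 + \<mu> / (e - \<mu>) * (1 - s)"
proof -
  obtain u where u: "u \<notin> J" "\<And>r. r \<in> m \<Longrightarrow> r * u \<in> J" "\<And>v. (\<forall>r\<in>m. r * v \<in> J) \<Longrightarrow> v \<in> J + prin u"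
    using xs_type1 unfolding type1_def by blast
  define E where "E = hk_mult p m d"
  define s where "s = F_signature p m d"
  define \<mu> where "\<mu> = real (mu_quot I J)"
  define L where "L = real (len J)"
  let ?h = "\<lambda>e. real (len (frob_pow m (p ^ e))) / real (p ^ e) ^ d"
  let ?a = "\<lambda>e. real (len (Iq u (p ^ e))) / real (p ^ e) ^ d"
  have hE: "?h \<longlonglongrightarrow> E" unfolding E_def by (rule hk_mult_lim[OF mprim_m])
  have as: "?a \<longlonglongrightarrow> s" unfolding s_def by (rule F_signature_lim[OF u])
  note fin = finite_level_inequality[OF frobq_power I u(2,3)]
  have ineq: "L + \<mu> * ?h e \<le> L * ?h e + \<mu> * ?a e" for e
  proof -
    have pos: "0 < real (p ^ e) ^ d" using p_gt_1 by simp
    have "real (len J * (p ^ e) ^ d + mu_quot I J * len (frob_pow m (p ^ e)))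
        \<le> real (len J * len (frob_pow m (p ^ e)) + mu_quot I J * len (Iq u (p ^ e)))"
      using fin(1)[of e] by (simp only: of_nat_le_iff)
    then have "L * real (p ^ e) ^ d + \<mu> * real (len (frob_pow m (p ^ e)))
        \<le> L * real (len (frob_pow m (p ^ e))) + \<mu> * real (len (Iq u (p ^ e)))"
      by (simp only: of_nat_add of_nat_mult of_nat_power L_def \<mu>_def)
    then have "(L * real (p ^ e) ^ d + \<mu> * real (len (frob_pow m (p ^ e)))) / real (p ^ e) ^ d
        \<le> (L * real (len (frob_pow m (p ^ e))) + \<mu> * real (len (Iq u (p ^ e)))) / real (p ^ e) ^ d"
      using pos by (intro divide_right_mono) auto
    then show ?thesis using pos p_gt_1 by (simp add: add_divide_distrib)
  qed
  have main: "L + \<mu> * E \<le> L * E + \<mu> * s"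
  proof (rule LIMSEQ_le)
    show "(\<lambda>e. L + \<mu> * ?h e) \<longlonglongrightarrow> L + \<mu> * E" by (intro tendsto_intros hE)
    show "(\<lambda>e. L * ?h e + \<mu> * ?a e) \<longlonglongrightarrow> L * E + \<mu> * s" by (intro tendsto_intros hE as)
  qed (use ineq in blast)
  have "s \<le> E"
  proof (rule LIMSEQ_le[OF as hE], intro exI allI impI)
    fix e show "?a e \<le> ?h e" using fin(2)[of e] by (intro divide_right_mono) auto
  qed
  have "0 \<le> E" by (rule LIMSEQ_le_const[OF hE]) auto
  have mL: "\<mu> \<le> L" using fin(3) by (simp add: \<mu>_def L_def)
  have "elen ideal m UNIV = enat (len m)" by (rule elen_eq_len[OF mprim_m])
  then have "len m = 1" by (simp add: elen_m one_enat_def)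
  then have L1: "1 \<le> L" using len_mono[OF xs_prim m_ideal J_m] by (simp add: L_def)
  have hs: "hs_mult m d = L" unfolding L_def by (rule hs_mult_eq[OF int])
  have "E \<ge> (L - s * \<mu>) / (L - \<mu>) \<and> E \<ge> 1 + \<mu> / (L - \<mu>) * (1 - s)"
  proof (cases "L = \<mu>")
    \<comment> \<open>With zero denominator the quotients are 0 by convention, and the claims become
      \<open>E \<ge> 0\<close> and \<open>E \<ge> 1\<close>. The limit inequality now says
      \<open>1 \<le> s\<close>, and \<open>s \<le> E\<close>.\<close>
    case True
    then have "L \<le> L * s" using main by simp
    then have "1 \<le> s" using L1 by simp
    then show ?thesis using True \<open>s \<le> E\<close> \<open>0 \<le> E\<close> by simp
  next
    case False
    then have pos: "0 < L - \<mu>" using mL by simp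
    have "(L - s * \<mu>) / (L - \<mu>) \<le> E" using main pos by (simp add: field_simps)
    moreover have "1 + \<mu> / (L - \<mu>) * (1 - s) = (L - s * \<mu>) / (L - \<mu>)" using pos by (simp add: field_simps)
    ultimately show ?thesis by simp
  qed
  then show ?thesis unfolding Let_def hs E_def s_def \<mu>_def .
qed

end

section \<open>From the hypotheses to regular generators of the reduction\<close>

context frob_local
begin

text \<open>If \<open>u\<close> and \<open>v\<close> are socle elements outside \<open>Q\<close>,
  irreducibility makes \<open>Q + prin u\<close> and \<open>Q + prin v\<close> meet outside
  \<open>Q\<close>. A common element is a unit multiple of \<open>v\<close> and a multiple of
  \<open>u\<close>, modulo \<open>Q\<close>.\<close>

lemma irreducible_type1:
  assumes Q: "mprim Q" "Q \<noteq> UNIV" and irr: "irreducible_ideal Q"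
  shows "type1 Q"
proof -
  have id: "ideal Q" using Q by (simp add: mprim_ideal)
  have "1 \<le> elen ideal Q UNIV" using id Q by (intro elen_ge_1) auto
  then obtain k where k: "elen ideal Q UNIV = enat (Suc k)"
    using mprim_elen_finite[OF Q(1)] by (cases "elen ideal Q UNIV") (auto simp: one_enat_def dest!: Suc_le_D)
  obtain u where u: "u \<notin> Q" "\<And>r. r \<in> m \<Longrightarrow> r * u \<in> Q"
    using simple_step[OF id ideal_UNIV subset_UNIV k] by metis
  have "v \<in> Q + prin u" if v: "\<forall>r\<in>m. r * v \<in> Q" for v
  proof (cases "v \<in> Q")
    case True
    then show ?thesis using plus_left_incl[OF ideal_prin, of Q u] by blast
  next
    case False
    have big: "Q + prin a \<noteq> Q" if "a \<notin> Q" for a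
      using that plus_right_incl[OF id, of "prin a"] prin_mem(3)[of a] by blast
    have sub: "Q \<subseteq> (Q + prin u) \<inter> (Q + prin v)"
      using plus_left_incl[OF ideal_prin, of Q u] plus_left_incl[OF ideal_prin, of Q v] by blast
    have "Q \<noteq> (Q + prin u) \<inter> (Q + prin v)"
      using irr[unfolded irreducible_ideal_def, rule_format, of "Q + prin u" "Q + prin v"] big[OF u(1)] big[OF False]
        ideal_plus[OF id ideal_prin] by blast
    then obtain w where w: "w \<in> Q + prin u" "w \<in> Q + prin v" "w \<notin> Q" using sub by blast
    obtain s where s: "w - s * u \<in> Q" using w(1) mem_plus_prin[OF id] by blast
    obtain t where t: "w - t * v \<in> Q" using w(2) mem_plus_prin[OF id] by blast
    have "t \<notin> m" using v t w(3) ideal_cong_mem[OF id t] by blast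
    then obtain t' where t': "t' * t = 1" using unit_ex by blast
    have "t' * (t * v) = v" using t' by (simp add: mult.assoc[symmetric])
    then have "v - (t' * s) * u = t' * (w - s * u) + (- t') * (w - t * v)" by (simp add: algebra_simps)
    then have "v - (t' * s) * u \<in> Q" using ideal_lin_mem[OF id s t] by blast
    then show ?thesis using mem_plus_prin[OF id] by blast
  qed
  then show ?thesis using u unfolding type1_def by blast
qed

lemma regular_sequence_regseq:
  assumes "regular_sequence k z"
  shows "regseq {0} (map z [0..<k])"
proof -
  have "j \<le> k \<Longrightarrow> regseq {0} (map z [0..<j])" for j
  proof (induction j)
    case (Suc j)
    have "nzd (gen_ideal (z ` {..<j})) (z j)"
      using assms Suc.prems unfolding regular_sequence_def by (intro nzdI) simp
    moreover have "ig (map z [0..<j]) = gen_ideal (z ` {..<j})" by (simp add: ig_eq_gen_ideal atLeast0LessThan)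
    ultimately show ?case using Suc by (simp add: regseq_snoc)
  qed simp
  then show ?thesis by simp
qed

end

theorem theorem1p2:
  fixes m :: "'a::comm_ring_1 set" and p d :: nat and x :: "nat \<Rightarrow> 'a" and I :: "'a set"
  assumes "prime p" and "CHAR('a) = p"
    and "local_ring m" and "noetherian_ring TYPE('a)" and "reduced_ring TYPE('a)"
    and "F_finite p TYPE('a)" and "krull_dim_eq TYPE('a) d" and "gorenstein_local m d"
    and "residue_field_infinite m" and "residue_field_perfect p m"
    and "minimal_reduction m d x"
    and "ideal I" and "gen_ideal (x ` {..<d}) \<subseteq> I"
  shows "let e = hs_mult m d; s = F_signature p m d;
             \<mu> = real (mu_quot I (gen_ideal (x ` {..<d})))
         in hk_mult p m d \<ge> (e - s * \<mu>) / (e - \<mu>)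
          \<and> hk_mult p m d \<ge> 1 + \<mu> / (e - \<mu>) * (1 - s)"
proof -
  interpret F: frob_finite m p by unfold_locales (use assms in auto)
  have ig: "ig (map z [0..<d]) = gen_ideal (z ` {..<d})" for z :: "nat \<Rightarrow> 'a"
    by (simp add: ig_eq_gen_ideal atLeast0LessThan)
  obtain z where z: "sop m d z" "regular_sequence d z" "irreducible_ideal (gen_ideal (z ` {..<d}))"
    using assms(8) unfolding gorenstein_local_def by blast
  let ?ys = "map z [0..<d]" and ?xs = "map x [0..<d]"
  have ysm: "set ?ys \<subseteq> m" using z(1) unfolding sop_def by auto
  have ysp: "F.mprim (ig ?ys)"
  proof -
    obtain n where "ideal_pow m n \<subseteq> ig ?ys" using z(1) unfolding sop_def ig by blast
    then have "\<exists>n. a ^ n \<in> ig ?ys" if "a \<in> m" for a using power_mem_ideal_pow[OF that, of n] by blast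
    then show ?thesis unfolding F.mprim_def by (intro conjI ballI ideal_ig)
  qed
  have yst: "F.type1 (ig ?ys)"
    using F.irreducible_type1[OF ysp] z(2,3) unfolding regular_sequence_def ig by blast
  have int: "integral_over_ideal (ig ?xs) a" if "a \<in> m" for a
    using assms(11) that unfolding minimal_reduction_def ig by blast
  have xsm: "set ?xs \<subseteq> m" using assms(11) unfolding minimal_reduction_def by auto
  have xsp: "F.mprim (ig ?xs)"
    unfolding F.mprim_def
  proof (intro conjI ballI ideal_ig)
    fix a assume "a \<in> m"
    then obtain N where "\<And>j. a ^ j \<in> ideal_pow (ig ?xs) (j - N)" using integral_power_mem[OF int] by blast
    \<comment> \<open>\<open>Suc N\<close> is the first exponent at which the bound gives a positive
      power of the reduction.\<close>
    from this[of "Suc N"] have "a ^ Suc N \<in> ideal_pow (ig ?xs) (Suc 0)" by simp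
    then show "\<exists>n. a ^ n \<in> ig ?xs" unfolding ideal_pow_1[OF ideal_ig] by blast
  qed
  \<comment> \<open>The Gorenstein data belong to \<open>z\<close>. They are transported to the
    ideal of \<open>x\<close>, for which new generators forming a regular sequence are found, equal
    in number to the old ones.\<close>
  have "\<exists>xs'. length xs' = length ?xs \<and> set xs' \<subseteq> m \<and> F.regseq {0} xs' \<and> {0} + ig xs' = {0} + ig ?xs \<and> F.type1 ({0} + ig xs')"
    by (rule F.regular_generators[of _ ?ys])
      (use F.regular_sequence_regseq[OF z(2)] ysm ysp yst xsm xsp in auto)
  then obtain xs where xs: "length xs = d" "set xs \<subseteq> m" "F.regseq {0} xs" "ig xs = ig ?xs" "F.type1 (ig xs)" by auto
  interpret G: gorenstein_frob m p xs
    by unfold_locales (use xs xsp assms(5) in auto)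
  show ?thesis
    using G.hk_lower_bound[OF assms(12)] int assms(13) unfolding xs(1) xs(4) ig by blast
qed

end
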